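(* Let $\lambda>0$, let $(\tilde{\boldsymbol{u}},\tilde q)\in\tilde{\boldsymbol{X}}_B\times\operatorname{div}\tilde{\boldsymbol{X}}_B$ be the solution of $$a(\tilde{\boldsymbol{u}},\boldsymbol{v})-(\tilde q,\operatorname{div}\boldsymbol{v})=L(\boldsymbol{v})\quad\forall\boldsymbol{v}\in\tilde{\boldsymbol{X}}_B^\dagger,\qquad-(r,\operatorname{div}\tilde{\boldsymbol{u}})=0\quad\forall r\in\operatorname{div}\tilde{\boldsymbol{X}}_B^\dagger,$$ and let $\tilde{\boldsymbol{u}}^n,\tilde{\boldsymbol{w}}^n\in\tilde{\boldsymbol{X}}_B$, $n=0,1,2,\dots$, be the iterates of the Statically Condensed Iterated Penalty (SCIP) method: $\tilde{\boldsymbol{w}}^0:=\boldsymbol{0}$ and, for each $n$, $$a(\tilde{\boldsymbol{u}}^n,\boldsymbol{v})+\lambda(\operatorname{div}\tilde{\boldsymbol{u}}^n,\operatorname{div}\boldsymbol{v})=L(\boldsymbol{v})+(\operatorname{div}\tilde{\boldsymbol{w}}^n,\operatorname{div}\boldsymbol{v})\quad\forall\boldsymbol{v}\in\tilde{\boldsymbol{X}}_B^\dagger,\qquad\tilde{\boldsymbol{w}}^{n+1}:=\tilde{\boldsymbol{w}}^n-\lambda\tilde{\boldsymbol{u}}^n.$$ Then for every $n$, $$\max\left\{\|\tilde{\boldsymbol{u}}-\tilde{\boldsymbol{u}}^n\|_1,\ \left(\frac{M(M+\alpha)^3}{\alpha^3\beta_X^2}+\frac{\sqrt d\,\lambda(M+\alpha)}{\alpha\beta_X}\right)^{-1}\|\tilde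 q-\operatorname{div}\tilde{\boldsymbol{w}}^n\|\right\}\le\frac{(M+\alpha)^2}{\alpha^2\beta_X}\|\operatorname{div}\tilde{\boldsymbol{u}}^n\|.$$ Moreover, for every $n$, $$\|\operatorname{div}\tilde{\boldsymbol{u}}^n\|\le\sqrt d\left[\frac{M(M+\alpha)^4}{\alpha^4\beta_X^2\lambda}\right]^n\|\tilde{\boldsymbol{u}}-\tilde{\boldsymbol{u}}^0\|_1.$$
   Context: Let $d\in\{2,3\}$ and let $\Omega\subset\mathbb{R}^d$ be a polygonal (polyhedral) domain whose boundary $\Gamma$ is partitioned into disjoint subsets $\Gamma_D,\Gamma_N$ with $|\Gamma_D|>0$. $(\cdot,\cdot)_\omega$ is the $L^2(\omega)$ inner product (subscript omitted when $\omega=\Omega$), $\|\cdot\|$ the $L^2(\Omega)$ norm, and $\|\cdot\|_1$ the $H^1(\Omega)^d$ norm. $\boldsymbol{H}^1_D(\Omega)=\{\boldsymbol{v}\in H^1(\Omega)^d:\boldsymbol{v}|_{\Gamma_D}=\boldsymbol{0}\}$. $a(\cdot,\cdot)$ is a (not necessarily symmetric) bilinear form on $H^1(\Omega)^d$ for which there are constants $M,\alpha>0$ with $|a(\boldsymbol{u},\boldsymbol{v})|\le M\|\boldsymbol{u}\|_1\|\boldsymbol{v}\|_1$ and $a(\boldsymbol{u},\boldsymbol{u})\ge\alpha\|\boldsymbol{u}\|_1^2$ for all $\boldsymbol{u},\boldsymbol{v}\in\boldsymbol{H}^1_D(\Omega)$. $L(\boldsymbol{v})=(\boldsymbol{v},\boldsymbol{f})+(\boldsymbol{v},\boldsymbol{g})_{\Gamma_N}$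 for given $\boldsymbol{f}\in L^2(\Omega)^d$, $\boldsymbol{g}\in L^2(\Gamma_N)^d$. $\mathcal{T}$ is a partition of $\Omega$ into simplices such that the nonempty intersection of any two distinct elements is a single common sub-simplex of both, with element boundaries located at the intersections of $\bar\Gamma_D$ and $\bar\Gamma_N$. For $p\in\mathbb{N}$, $X=\{v\in C^0(\bar\Omega): v|_K\in\mathcal{P}_p(K)\ \forall K\in\mathcal{T}\}$ ($\mathcal{P}_p(K)$: polynomials of degree at most $p$), $X_D=\{v\in X: v|_{\Gamma_D}=0\}$, $\boldsymbol{X}_D=[X_D]^d$; $\operatorname{div}\boldsymbol{Y}$ denotes the image of a space $\boldsymbol{Y}$ under the divergence. The (strictly positive) inf-sup constant is $$\beta_X:=\inf_{0\ne q\in\operatorname{div}\boldsymbol{X}_D}\ \sup_{\boldsymbol{0}\ne\boldsymbol{v}\in\boldsymbol{X}_D}\frac{(\operatorname{div}\boldsymbol{v},q)}{\|\boldsymbol{v}\|_1\|q\|}.$$ Interior spaces: $\boldsymbol{X}_I(K)=\{\boldsymbol{v}\in\boldsymbol{X}_D:\operatorname{supp}\boldsymbol{v}\subseteq K,\ \boldsymbol{v}|_{\partial K}=\boldsymbol{0}\}$, $\boldsymbol{X}_I=\bigoplus_{K\in\mathcal{T}}\boldsymbol{X}_I(K)$, $\boldsymbol{N}_I(K)=\{\boldsymbol{v}\in\boldsymbol{X}_I(K):\operatorname{div}\boldsymbol{v}\equiv0\}$, $\boldsymbol{N}_I=\bigoplus_{K\in\mathcal{T}}\boldsymbol{N}_I(K)$.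 Boundary spaces: $$\tilde{\boldsymbol{X}}_B=\{\boldsymbol{v}\in\boldsymbol{X}_D:a(\boldsymbol{v},\boldsymbol{z})=0\ \forall\boldsymbol{z}\in\boldsymbol{N}_I\text{ and }(\operatorname{div}\boldsymbol{v},r)=0\ \forall r\in\operatorname{div}\boldsymbol{X}_I\},$$ $$\tilde{\boldsymbol{X}}_B^\dagger=\{\boldsymbol{v}\in\boldsymbol{X}_D:a(\boldsymbol{z},\boldsymbol{v})=0\ \forall\boldsymbol{z}\in\boldsymbol{N}_I\text{ and }(\operatorname{div}\boldsymbol{v},r)=0\ \forall r\in\operatorname{div}\boldsymbol{X}_I\}.$$ *)

theory Defs
  imports "HOL-Analysis.Analysis"
begin

section \<open>Surface measure\<close>

text \<open>
  The Hausdorff measure of dimension \<open>s > 0\<close>, obtained by Caratheodory's construction and normalised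
  so that for integer \<open>s\<close> it agrees with \<open>s\<close>-dimensional surface measure on flat pieces.
  The covering sets are required to be bounded because \<^const>\<open>diameter\<close> is meaningless otherwise.
\<close>

definition hausdorff_content :: "real \<Rightarrow> real \<Rightarrow> 'a::metric_space set \<Rightarrow> ennreal" where
  "hausdorff_content \<delta> s A =
     (INF U \<in> {U :: nat \<Rightarrow> 'a set. A \<subseteq> (\<Union>i. U i) \<and> (\<forall>i. bounded (U i) \<and> diameter (U i) \<le> \<delta>)}.
        \<Sum>i. ennreal (diameter (U i) powr s))"

definition hausdorff_outer :: "real \<Rightarrow> 'a::metric_space set \<Rightarrow> ennreal" where
  "hausdorff_outer s A =
     ennreal (unit_ball_vol s / 2 powr s) * (SUP \<delta> \<in> {0<..}. hausdorff_content \<delta> s A)"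

definition hausdorff_measure :: "real \<Rightarrow> 'a::metric_space measure" where
  "hausdorff_measure s =
     measure_of UNIV (lambda_system UNIV UNIV (hausdorff_outer s)) (hausdorff_outer s)"

definition surface_measure :: "(real ^ 'n::finite) measure" where
  "surface_measure = hausdorff_measure (real CARD('n) - 1)"

text \<open>
  The side condition of \<^const>\<open>measure_of\<close> (countable additivity) holds, so that
  \<^const>\<open>hausdorff_measure\<close> does not collapse to the null measure.
\<close>

lemma hausdorff_content_empty [simp]: "0 \<le> \<delta> \<Longrightarrow> hausdorff_content \<delta> s {} = 0"
proof -
  assume "0 \<le> \<delta>"
  then have "hausdorff_content \<delta> s ({}::'a set) \<le> (\<Sum>i::nat. ennreal (diameter ({}::'a set) powr s))"
    unfolding hausdorff_content_def by (intro INF_lower) auto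
  then show ?thesis by simp
qed

lemma hausdorff_content_mono: "A \<subseteq> B \<Longrightarrow> hausdorff_content \<delta> s A \<le> hausdorff_content \<delta> s B"
  unfolding hausdorff_content_def by (intro INF_superset_mono) auto

lemma hausdorff_content_countably_subadditive:
  fixes A :: "nat \<Rightarrow> 'a::metric_space set"
  shows "hausdorff_content \<delta> s (\<Union>n. A n) \<le> (\<Sum>n. hausdorff_content \<delta> s (A n))"
proof (rule ennreal_le_epsilon)
  fix e :: real
  assume fin: "(\<Sum>n. hausdorff_content \<delta> s (A n)) < top" and e: "0 < e"
  have "\<exists>U::nat \<Rightarrow> 'a set. A n \<subseteq> (\<Union>i. U i) \<and> (\<forall>i. bounded (U i) \<and> diameter (U i) \<le> \<delta>) \<and>
      (\<Sum>i. ennreal (diameter (U i) powr s)) \<le> hausdorff_content \<delta> s (A n) + ennreal (e * (1/2) ^ Suc n)" for n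
  proof -
    have "hausdorff_content \<delta> s (A n) \<noteq> top"
      using fin ennreal_suminf_lessD by (metis less_irrefl)
    then have "hausdorff_content \<delta> s (A n) < hausdorff_content \<delta> s (A n) + ennreal (e * (1/2) ^ Suc n)"
      using e by (cases "hausdorff_content \<delta> s (A n)" rule: ennreal_cases)
        (auto simp: ennreal_plus[symmetric] ennreal_less_iff simp del: ennreal_plus)
    then show ?thesis
      unfolding hausdorff_content_def INF_less_iff using less_imp_le by blast
  qed
  then obtain U :: "nat \<Rightarrow> nat \<Rightarrow> 'a set" where
    U: "\<And>n. A n \<subseteq> (\<Union>i. U n i)" "\<And>n i. bounded (U n i)" "\<And>n i. diameter (U n i) \<le> \<delta>"
       "\<And>n. (\<Sum>i. ennreal (diameter (U n i) powr s)) \<le> hausdorff_content \<delta> s (A n) + ennreal (e * (1/2) ^ Suc n)"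
    by metis
  define V where "V = (\<lambda>k. case prod_decode k of (n, i) \<Rightarrow> U n i)"
  have "hausdorff_content \<delta> s (\<Union>n. A n) \<le> (\<Sum>k. ennreal (diameter (V k) powr s))"
    unfolding hausdorff_content_def
  proof (intro INF_lower CollectI conjI allI)
    show "(\<Union>n. A n) \<subseteq> (\<Union>k. V k)"
    proof
      fix x assume "x \<in> (\<Union>n. A n)"
      then obtain n i where "x \<in> U n i" using U(1) by blast
      then have "x \<in> V (prod_encode (n, i))" by (simp add: V_def)
      then show "x \<in> (\<Union>k. V k)" by blast
    qed
  qed (auto simp: V_def U split: prod.split)
  also have "(\<Sum>k. ennreal (diameter (V k) powr s)) =
      (\<Sum>k. (\<lambda>(n, i). ennreal (diameter (U n i) powr s)) (prod_decode k))"
    by (rule suminf_cong) (simp add: V_def split: prod.split)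
  also have "\<dots> = (\<Sum>n. \<Sum>i. ennreal (diameter (U n i) powr s))"
    by (rule suminf_ennreal_2dimen) simp
  also have "\<dots> \<le> (\<Sum>n. hausdorff_content \<delta> s (A n) + ennreal (e * (1/2) ^ Suc n))"
    by (intro suminf_le U) auto
  also have "\<dots> = (\<Sum>n. hausdorff_content \<delta> s (A n)) + (\<Sum>n. ennreal (e * (1/2) ^ Suc n))"
    by (simp add: suminf_add)
  also have "(\<Sum>n. ennreal (e * (1/2) ^ Suc n)) = ennreal e"
    using e power_half_series[THEN sums_mult, of e] by (intro suminf_ennreal_eq) auto
  finally show "hausdorff_content \<delta> s (\<Union>n. A n) \<le> (\<Sum>n. hausdorff_content \<delta> s (A n)) + ennreal e" .
qed

lemma outer_measure_space_hausdorff: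
  "outer_measure_space (UNIV :: 'a::metric_space set set) (hausdorff_outer s)"
  unfolding outer_measure_space_def
proof (intro conjI)
  show "positive (UNIV :: 'a set set) (hausdorff_outer s)"
    by (auto simp: positive_def hausdorff_outer_def)
  show "increasing (UNIV :: 'a set set) (hausdorff_outer s)"
    unfolding increasing_def hausdorff_outer_def
    by (intro ballI impI mult_left_mono SUP_mono') (auto intro: hausdorff_content_mono)
  show "countably_subadditive (UNIV :: 'a set set) (hausdorff_outer s)"
    unfolding countably_subadditive_def hausdorff_outer_def ennreal_suminf_cmult
  proof (intro allI impI mult_left_mono SUP_least)
    fix A :: "nat \<Rightarrow> 'a set" and \<delta> :: real
    assume \<delta>: "\<delta> \<in> {0<..}"
    have "hausdorff_content \<delta> s (\<Union>n. A n) \<le> (\<Sum>n. hausdorff_content \<delta> s (A n))"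
      by (rule hausdorff_content_countably_subadditive)
    also have "\<dots> \<le> (\<Sum>n. SUP \<delta>\<in>{0<..}. hausdorff_content \<delta> s (A n))"
      by (intro suminf_le SUP_upper \<delta>) auto
    finally show "hausdorff_content \<delta> s (\<Union>n. A n) \<le> (\<Sum>n. SUP \<delta>\<in>{0<..}. hausdorff_content \<delta> s (A n))" .
  qed simp
qed

lemma
  shows sets_hausdorff_measure:
      "sets (hausdorff_measure s :: 'a::metric_space measure) = lambda_system UNIV UNIV (hausdorff_outer s)"
    and emeasure_hausdorff_measure:
      "A \<in> lambda_system UNIV UNIV (hausdorff_outer s) \<Longrightarrow>
        emeasure (hausdorff_measure s) A = hausdorff_outer s (A :: 'a set)"
proof -
  have "measure_space (UNIV :: 'a set) (lambda_system UNIV UNIV (hausdorff_outer s)) (hausdorff_outer s)"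
    using sigma_algebra.caratheodory_lemma[OF sigma_algebra_Pow[of "UNIV :: 'a set"]]
      outer_measure_space_hausdorff[where 'a = 'a and s = s] by simp
  then have sa: "sigma_algebra (UNIV :: 'a set) (lambda_system UNIV UNIV (hausdorff_outer s))"
    and pos: "positive (lambda_system (UNIV :: 'a set) UNIV (hausdorff_outer s)) (hausdorff_outer s)"
    and ca: "countably_additive (lambda_system (UNIV :: 'a set) UNIV (hausdorff_outer s)) (hausdorff_outer s)"
    by (auto simp: measure_space_def)
  show "sets (hausdorff_measure s :: 'a measure) = lambda_system UNIV UNIV (hausdorff_outer s)"
    unfolding hausdorff_measure_def by (rule sigma_algebra.sets_measure_of_eq[OF sa])
  show "emeasure (hausdorff_measure s) A = hausdorff_outer s A"
    if "A \<in> lambda_system UNIV UNIV (hausdorff_outer s)" for A :: "'a set"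
    unfolding hausdorff_measure_def by (rule emeasure_measure_of_sigma[OF sa pos ca that])
qed


section \<open>Square-integrable functions and Sobolev spaces\<close>

text \<open>
  Elements of function spaces are represented by functions on all of \<open>\<real>\<^sup>n\<close>. Only their values
  in \<open>\<Omega>\<close> (almost everywhere) or, for continuous functions, in the closure of \<open>\<Omega>\<close> matter.
\<close>

definition l2_space :: "'a measure \<Rightarrow> ('a \<Rightarrow> 'b::euclidean_space) set" where
  "l2_space M = {f. f \<in> borel_measurable M \<and> integrable M (\<lambda>x. (norm (f x))\<^sup>2)}"

definition l2_inner :: "'a measure \<Rightarrow> ('a \<Rightarrow> 'b::euclidean_space) \<Rightarrow> ('a \<Rightarrow> 'b) \<Rightarrow> real" where
  "l2_inner M f g = (LINT x|M. f x \<bullet> g x)"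

definition l2_norm :: "'a measure \<Rightarrow> ('a \<Rightarrow> 'b::euclidean_space) \<Rightarrow> real" where
  "l2_norm M f = sqrt (l2_inner M f f)"

definition partial :: "'n::finite \<Rightarrow> (real ^ 'n \<Rightarrow> real) \<Rightarrow> real ^ 'n \<Rightarrow> real" where
  "partial i f x = frechet_derivative f (at x) (axis i 1)"

primrec C_k :: "nat \<Rightarrow> (real ^ 'n::finite \<Rightarrow> real) \<Rightarrow> bool" where
  "C_k 0 f \<longleftrightarrow> continuous_on UNIV f"
| "C_k (Suc k) f \<longleftrightarrow> (\<forall>x. f differentiable (at x)) \<and> (\<forall>i. C_k k (partial i f))"

definition test_functions :: "(real ^ 'n::finite) set \<Rightarrow> (real ^ 'n \<Rightarrow> real) set" where
  "test_functions \<Omega> =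
     {\<phi>. (\<forall>k. C_k k \<phi>) \<and> compact (closure {x. \<phi> x \<noteq> 0}) \<and> closure {x. \<phi> x \<noteq> 0} \<subseteq> \<Omega>}"

definition is_weak_partial ::
    "(real ^ 'n::finite) set \<Rightarrow> 'n \<Rightarrow> (real ^ 'n \<Rightarrow> real) \<Rightarrow> (real ^ 'n \<Rightarrow> real) \<Rightarrow> bool" where
  "is_weak_partial \<Omega> i u g \<longleftrightarrow>
     (\<forall>\<phi> \<in> test_functions \<Omega>.
        (LINT x|lebesgue_on \<Omega>. u x * partial i \<phi> x) = - (LINT x|lebesgue_on \<Omega>. g x * \<phi> x))"

text \<open>Weak derivatives are determined almost everywhere only; \<open>weak_partial\<close> picks a representative.\<close>

definition weak_partial :: "(real ^ 'n::finite) set \<Rightarrow> 'n \<Rightarrow> (real ^ 'n \<Rightarrow> real) \<Rightarrow> real ^ 'n \<Rightarrow> real" where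
  "weak_partial \<Omega> i u = (SOME g. g \<in> l2_space (lebesgue_on \<Omega>) \<and> is_weak_partial \<Omega> i u g)"

definition H1 :: "(real ^ 'n::finite) set \<Rightarrow> (real ^ 'n \<Rightarrow> real) set" where
  "H1 \<Omega> = {u \<in> l2_space (lebesgue_on \<Omega>).
             \<forall>i. \<exists>g \<in> l2_space (lebesgue_on \<Omega>). is_weak_partial \<Omega> i u g}"

definition H1_vec :: "(real ^ 'n::finite) set \<Rightarrow> (real ^ 'n \<Rightarrow> real ^ 'n) set" where
  "H1_vec \<Omega> = {v. \<forall>j. (\<lambda>x. v x $ j) \<in> H1 \<Omega>}"

definition h1_norm :: "(real ^ 'n::finite) set \<Rightarrow> (real ^ 'n \<Rightarrow> real ^ 'n) \<Rightarrow> real" where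
  "h1_norm \<Omega> v =
     sqrt ((l2_norm (lebesgue_on \<Omega>) v)\<^sup>2 +
           (\<Sum>j\<in>UNIV. \<Sum>i\<in>UNIV. (l2_norm (lebesgue_on \<Omega>) (weak_partial \<Omega> i (\<lambda>x. v x $ j)))\<^sup>2))"

definition divergence :: "(real ^ 'n::finite) set \<Rightarrow> (real ^ 'n \<Rightarrow> real ^ 'n) \<Rightarrow> real ^ 'n \<Rightarrow> real" where
  "divergence \<Omega> v x = (\<Sum>i\<in>UNIV. weak_partial \<Omega> i (\<lambda>x. v x $ i) x)"

text \<open>The image of a space of vector fields under the divergence, as a set of (classes of) \<open>L\<^sup>2\<close> functions.\<close>

definition div_space ::
    "(real ^ 'n::finite) set \<Rightarrow> (real ^ 'n \<Rightarrow> real ^ 'n) set \<Rightarrow> (real ^ 'n \<Rightarrow> real) set" where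
  "div_space \<Omega> Y = {q. \<exists>v\<in>Y. AE x in lebesgue_on \<Omega>. q x = divergence \<Omega> v x}"

text \<open>
  The trace on a part \<open>A\<close> of the boundary: the \<open>H\<^sup>1\<close>-continuous extension of the
  restriction map \<open>v \<mapsto> v|A\<close> from \<open>H\<^sup>1(\<Omega>) \<inter> C(closure \<Omega>)\<close>, with values in \<open>L\<^sup>2(A)\<close>.
\<close>

definition has_trace_on ::
    "(real ^ 'n::finite) set \<Rightarrow> (real ^ 'n) set \<Rightarrow> (real ^ 'n \<Rightarrow> real ^ 'n) \<Rightarrow> (real ^ 'n \<Rightarrow> real ^ 'n) \<Rightarrow> bool"
  where
  "has_trace_on \<Omega> A v g \<longleftrightarrow>
     g \<in> l2_space (restrict_space surface_measure A) \<and>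
     (\<exists>\<phi>. (\<forall>k::nat. \<phi> k \<in> H1_vec \<Omega> \<and> continuous_on (closure \<Omega>) (\<phi> k)) \<and>
          (\<lambda>k. h1_norm \<Omega> (\<lambda>x. v x - \<phi> k x)) \<longlonglongrightarrow> 0 \<and>
          (\<lambda>k. l2_norm (restrict_space surface_measure A) (\<lambda>x. g x - \<phi> k x)) \<longlonglongrightarrow> 0)"

definition H1_D :: "(real ^ 'n::finite) set \<Rightarrow> (real ^ 'n) set \<Rightarrow> (real ^ 'n \<Rightarrow> real ^ 'n) set" where
  "H1_D \<Omega> \<Gamma>\<^sub>D = {v \<in> H1_vec \<Omega>. has_trace_on \<Omega> \<Gamma>\<^sub>D v (\<lambda>x. 0)}"

text \<open>
  Bilinear forms on \<open>H\<^sup>1(\<Omega>)\<^sup>d\<close>. The last clause says that the form is a function of the elements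
  of \<open>H\<^sup>1(\<Omega>)\<^sup>d\<close>, i.e. independent of the chosen representatives.
\<close>

definition bilinear_form_H1 ::
    "(real ^ 'n::finite) set \<Rightarrow> ((real ^ 'n \<Rightarrow> real ^ 'n) \<Rightarrow> (real ^ 'n \<Rightarrow> real ^ 'n) \<Rightarrow> real) \<Rightarrow> bool" where
  "bilinear_form_H1 \<Omega> a \<longleftrightarrow>
     (\<forall>u\<in>H1_vec \<Omega>. \<forall>v\<in>H1_vec \<Omega>. \<forall>w\<in>H1_vec \<Omega>.
        a (\<lambda>x. u x + v x) w = a u w + a v w \<and>
        a w (\<lambda>x. u x + v x) = a w u + a w v) \<and>
     (\<forall>u\<in>H1_vec \<Omega>. \<forall>v\<in>H1_vec \<Omega>. \<forall>c.
        a (\<lambda>x. c *\<^sub>R u x) v = c * a u v \<and>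
        a u (\<lambda>x. c *\<^sub>R v x) = c * a u v) \<and>
     (\<forall>u\<in>H1_vec \<Omega>. \<forall>u'\<in>H1_vec \<Omega>. \<forall>v\<in>H1_vec \<Omega>.
        (AE x in lebesgue_on \<Omega>. u x = u' x) \<longrightarrow> a u v = a u' v \<and> a v u = a v u')"


section \<open>Polyhedral domains and meshes\<close>

definition polyhedral_domain :: "(real ^ 'n::finite) set \<Rightarrow> bool" where
  "polyhedral_domain \<Omega> \<longleftrightarrow>
     open \<Omega> \<and> connected \<Omega> \<and> bounded \<Omega> \<and> \<Omega> \<noteq> {} \<and> interior (closure \<Omega>) = \<Omega> \<and>
     (\<exists>\<F>. finite \<F> \<and> (\<forall>F\<in>\<F>. polytope F \<and> aff_dim F = int CARD('n) - 1) \<and> frontier \<Omega> = \<Union>\<F>)"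

definition simplicial_mesh :: "(real ^ 'n::finite) set \<Rightarrow> (real ^ 'n) set set \<Rightarrow> bool" where
  "simplicial_mesh \<Omega> \<T> \<longleftrightarrow>
     triangulation \<T> \<and> (\<forall>K\<in>\<T>. int CARD('n) simplex K) \<and> \<Union>\<T> = closure \<Omega>"

text \<open>
  The mesh resolves the interface between the two parts of the boundary: the interface is made up
  of vertices (and, in three dimensions, edges) of elements.
\<close>

definition mesh_resolves_interface ::
    "(real ^ 'n::finite) set set \<Rightarrow> (real ^ 'n) set \<Rightarrow> (real ^ 'n) set \<Rightarrow> bool" where
  "mesh_resolves_interface \<T> \<Gamma>\<^sub>D \<Gamma>\<^sub>N \<longleftrightarrow>
     (\<exists>\<F> \<subseteq> {F. \<exists>K\<in>\<T>. F face_of K \<and> aff_dim F \<le> int CARD('n) - 2}.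
        closure \<Gamma>\<^sub>D \<inter> closure \<Gamma>\<^sub>N = \<Union>\<F>)"


section \<open>Finite element spaces\<close>

definition polynomial_deg_le :: "nat \<Rightarrow> (real ^ 'n::finite \<Rightarrow> real) \<Rightarrow> bool" where
  "polynomial_deg_le p P \<longleftrightarrow>
     (\<exists>c. \<forall>x. P x = (\<Sum>\<alpha> | (\<Sum>i\<in>UNIV. \<alpha> i) \<le> p. c \<alpha> * (\<Prod>i\<in>UNIV. (x $ i) ^ \<alpha> i)))"

definition fe_space ::
    "(real ^ 'n::finite) set \<Rightarrow> (real ^ 'n) set set \<Rightarrow> nat \<Rightarrow> (real ^ 'n \<Rightarrow> real) set" where
  "fe_space \<Omega> \<T> p =
     {v. continuous_on (closure \<Omega>) v \<and> (\<forall>K\<in>\<T>. \<exists>P. polynomial_deg_le p P \<and> (\<forall>x\<in>K. v x = P x))}"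

definition fe_space_D ::
    "(real ^ 'n::finite) set \<Rightarrow> (real ^ 'n) set \<Rightarrow> (real ^ 'n) set set \<Rightarrow> nat \<Rightarrow> (real ^ 'n \<Rightarrow> real) set" where
  "fe_space_D \<Omega> \<Gamma>\<^sub>D \<T> p = {v \<in> fe_space \<Omega> \<T> p. \<forall>x\<in>\<Gamma>\<^sub>D. v x = 0}"

definition X_D ::
    "(real ^ 'n::finite) set \<Rightarrow> (real ^ 'n) set \<Rightarrow> (real ^ 'n) set set \<Rightarrow> nat \<Rightarrow> (real ^ 'n \<Rightarrow> real ^ 'n) set" where
  "X_D \<Omega> \<Gamma>\<^sub>D \<T> p = {v. \<forall>i. (\<lambda>x. v x $ i) \<in> fe_space_D \<Omega> \<Gamma>\<^sub>D \<T> p}"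

text \<open>
  The set over which the infimum is taken is empty only if all divergences of \<open>X_D\<close> fields vanish.
  The value of the infimum is then unspecified.
\<close>

definition inf_sup_const ::
    "(real ^ 'n::finite) set \<Rightarrow> (real ^ 'n) set \<Rightarrow> (real ^ 'n) set set \<Rightarrow> nat \<Rightarrow> real" where
  "inf_sup_const \<Omega> \<Gamma>\<^sub>D \<T> p =
     (INF q \<in> {q \<in> div_space \<Omega> (X_D \<Omega> \<Gamma>\<^sub>D \<T> p). \<not> (AE x in lebesgue_on \<Omega>. q x = 0)}.
      SUP v \<in> {v \<in> X_D \<Omega> \<Gamma>\<^sub>D \<T> p. \<not> (AE x in lebesgue_on \<Omega>. v x = 0)}.
        l2_inner (lebesgue_on \<Omega>) (divergence \<Omega> v) q / (h1_norm \<Omega> v * l2_norm (lebesgue_on \<Omega>) q))"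

definition X_I_loc ::
    "(real ^ 'n::finite) set \<Rightarrow> (real ^ 'n) set \<Rightarrow> (real ^ 'n) set set \<Rightarrow> nat \<Rightarrow> (real ^ 'n) set \<Rightarrow>
       (real ^ 'n \<Rightarrow> real ^ 'n) set" where
  "X_I_loc \<Omega> \<Gamma>\<^sub>D \<T> p K =
     {v \<in> X_D \<Omega> \<Gamma>\<^sub>D \<T> p. closure {x \<in> closure \<Omega>. v x \<noteq> 0} \<subseteq> K \<and> (\<forall>x\<in>frontier K. v x = 0)}"

definition N_I_loc ::
    "(real ^ 'n::finite) set \<Rightarrow> (real ^ 'n) set \<Rightarrow> (real ^ 'n) set set \<Rightarrow> nat \<Rightarrow> (real ^ 'n) set \<Rightarrow>
       (real ^ 'n \<Rightarrow> real ^ 'n) set" where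
  "N_I_loc \<Omega> \<Gamma>\<^sub>D \<T> p K =
     {v \<in> X_I_loc \<Omega> \<Gamma>\<^sub>D \<T> p K. AE x in lebesgue_on \<Omega>. divergence \<Omega> v x = 0}"

text \<open>
  The sum over the elements of the mesh of a family of spaces \<open>V K\<close> of fields. It is direct in the
  uses below because the fields in \<open>V K\<close> are supported in \<open>K\<close> and vanish on its boundary.
\<close>

definition mesh_sum ::
    "(real ^ 'n::finite) set set \<Rightarrow> ((real ^ 'n) set \<Rightarrow> (real ^ 'n \<Rightarrow> real ^ 'n) set) \<Rightarrow>
       (real ^ 'n \<Rightarrow> real ^ 'n) set" where
  "mesh_sum \<T> V = {v. \<exists>w. (\<forall>K\<in>\<T>. w K \<in> V K) \<and> v = (\<lambda>x. \<Sum>K\<in>\<T>. w K x)}"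

definition X_I ::
    "(real ^ 'n::finite) set \<Rightarrow> (real ^ 'n) set \<Rightarrow> (real ^ 'n) set set \<Rightarrow> nat \<Rightarrow> (real ^ 'n \<Rightarrow> real ^ 'n) set" where
  "X_I \<Omega> \<Gamma>\<^sub>D \<T> p = mesh_sum \<T> (X_I_loc \<Omega> \<Gamma>\<^sub>D \<T> p)"

definition N_I ::
    "(real ^ 'n::finite) set \<Rightarrow> (real ^ 'n) set \<Rightarrow> (real ^ 'n) set set \<Rightarrow> nat \<Rightarrow> (real ^ 'n \<Rightarrow> real ^ 'n) set" where
  "N_I \<Omega> \<Gamma>\<^sub>D \<T> p = mesh_sum \<T> (N_I_loc \<Omega> \<Gamma>\<^sub>D \<T> p)"

definition X_B ::
    "(real ^ 'n::finite) set \<Rightarrow> (real ^ 'n) set \<Rightarrow> (real ^ 'n) set set \<Rightarrow> nat \<Rightarrow>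
       ((real ^ 'n \<Rightarrow> real ^ 'n) \<Rightarrow> (real ^ 'n \<Rightarrow> real ^ 'n) \<Rightarrow> real) \<Rightarrow> (real ^ 'n \<Rightarrow> real ^ 'n) set" where
  "X_B \<Omega> \<Gamma>\<^sub>D \<T> p a =
     {v \<in> X_D \<Omega> \<Gamma>\<^sub>D \<T> p. (\<forall>z\<in>N_I \<Omega> \<Gamma>\<^sub>D \<T> p. a v z = 0) \<and>
        (\<forall>r\<in>div_space \<Omega> (X_I \<Omega> \<Gamma>\<^sub>D \<T> p). l2_inner (lebesgue_on \<Omega>) (divergence \<Omega> v) r = 0)}"

definition X_B_dagger ::
    "(real ^ 'n::finite) set \<Rightarrow> (real ^ 'n) set \<Rightarrow> (real ^ 'n) set set \<Rightarrow> nat \<Rightarrow>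
       ((real ^ 'n \<Rightarrow> real ^ 'n) \<Rightarrow> (real ^ 'n \<Rightarrow> real ^ 'n) \<Rightarrow> real) \<Rightarrow> (real ^ 'n \<Rightarrow> real ^ 'n) set" where
  "X_B_dagger \<Omega> \<Gamma>\<^sub>D \<T> p a =
     {v \<in> X_D \<Omega> \<Gamma>\<^sub>D \<T> p. (\<forall>z\<in>N_I \<Omega> \<Gamma>\<^sub>D \<T> p. a z v = 0) \<and>
        (\<forall>r\<in>div_space \<Omega> (X_I \<Omega> \<Gamma>\<^sub>D \<T> p). l2_inner (lebesgue_on \<Omega>) (divergence \<Omega> v) r = 0)}"

definition load ::
    "(real ^ 'n::finite) set \<Rightarrow> (real ^ 'n) set \<Rightarrow> (real ^ 'n \<Rightarrow> real ^ 'n) \<Rightarrow> (real ^ 'n \<Rightarrow> real ^ 'n) \<Rightarrow>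
       (real ^ 'n \<Rightarrow> real ^ 'n) \<Rightarrow> real" where
  "load \<Omega> \<Gamma>\<^sub>N f g v =
     l2_inner (lebesgue_on \<Omega>) v f + l2_inner (restrict_space surface_measure \<Gamma>\<^sub>N) v g"

end

theory Submission
  imports Defs "HOL-Library.Function_Algebras"
begin

text \<open>
  The iteration error \<open>e\<^sup>n = u - u\<^sup>n\<close> satisfies \<open>a(e\<^sup>n, v) = (q - div w\<^sup>n\<^sup>+\<^sup>1, div v)\<close> for all \<open>v\<close> in the
  dual boundary space, and \<open>div e\<^sup>n = - div u\<^sup>n\<close>. In finite dimensions the inf-sup condition provides
  for every divergence \<open>r\<close> a preimage of norm at most \<open>\<beta>\<^sup>-\<^sup>1 \<parallel>r\<parallel>\<close>; if \<open>r\<close> is orthogonal to \<open>div X\<^sub>I\<close>, subtracting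
  the \<open>a\<close>-projection onto \<open>N\<^sub>I\<close> moves it into the boundary space at the cost of a factor \<open>(M + \<alpha>)/\<alpha>\<close>.
  The same projection turns a member of the boundary space into one of its dual without changing its
  divergence or its \<open>a\<close>-product with the boundary space, which restores coercivity on the pair of
  spaces. Testing with preimages bounds the two errors by \<open>\<parallel>div u\<^sup>n\<parallel>\<close>; testing the difference of two
  consecutive error equations with \<open>e\<^sup>n\<^sup>+\<^sup>1\<close> gives \<open>\<lambda> \<parallel>div u\<^sup>n\<^sup>+\<^sup>1\<parallel>\<^sup>2 \<le> M \<parallel>e\<^sup>n\<parallel> \<parallel>e\<^sup>n\<^sup>+\<^sup>1\<parallel>\<close>, hence the contraction.

  That the finite element fields lie in \<open>H\<^sup>1\<close> is seen without boundary integrals: the product of a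
  continuous piecewise polynomial with a test function is Lipschitz on the whole space, so the
  integral of its difference quotients, which vanishes by translation invariance, converges to
  the integral of its almost everywhere derivative.
\<close>

section \<open>Galerkin systems for bilinear forms on subspaces\<close>

text \<open>Fields are arbitrary functions on the whole space of which only the values in the domain
  count, and \<open>weak_partial\<close> is a choice that is linear only almost everywhere. Hence
  the inner products have null vectors, finite dimension holds only modulo them, and the Galerkin
  systems may be degenerate; the linear algebra is built for this situation instead of passing to
  quotients. The constants have few sources. Put B = (M + \<alpha>)/\<alpha>. One factor B is the
  price of moving a preimage into the boundary space, another that of comparing the error with a
  preimage of its divergence, so the error is at most B^2/\<beta> times the norm of its divergence;
  using this twice gives the contraction factor M B^4/(\<beta>^2 lam). The multiplier estimate comes
  out sharper than claimed and is weakened by \<beta> \<le> sqrt d \<le> 2 \<le> B. If all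
  divergences vanish, \<beta> is the infimum of the empty set and carries no information; that case
  is settled separately.\<close>

definition bilinear_on :: "'v::real_vector set \<Rightarrow> ('v \<Rightarrow> 'v \<Rightarrow> real) \<Rightarrow> bool" where
  "bilinear_on V b \<longleftrightarrow>
     (\<forall>u\<in>V. \<forall>v\<in>V. \<forall>w\<in>V. b (u + v) w = b u w + b v w \<and> b w (u + v) = b w u + b w v) \<and>
     (\<forall>u\<in>V. \<forall>v\<in>V. \<forall>c. b (c *\<^sub>R u) v = c * b u v \<and> b u (c *\<^sub>R v) = c * b u v)"

lemma bilinear_on_subset: "bilinear_on V b \<Longrightarrow> W \<subseteq> V \<Longrightarrow> bilinear_on W b"
  unfolding bilinear_on_def by blast

lemma bilinear_on_flip: "bilinear_on V b \<Longrightarrow> bilinear_on V (\<lambda>u v. b v u)"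
  unfolding bilinear_on_def by blast

context
  fixes V :: "'v::real_vector set" and b :: "'v \<Rightarrow> 'v \<Rightarrow> real"
  assumes bil: "bilinear_on V b" and sub: "subspace V"
begin

lemma bilinear_on_add_left: "u \<in> V \<Longrightarrow> v \<in> V \<Longrightarrow> w \<in> V \<Longrightarrow> b (u + v) w = b u w + b v w"
  and bilinear_on_add_right: "u \<in> V \<Longrightarrow> v \<in> V \<Longrightarrow> w \<in> V \<Longrightarrow> b w (u + v) = b w u + b w v"
  and bilinear_on_scale_left: "u \<in> V \<Longrightarrow> v \<in> V \<Longrightarrow> b (c *\<^sub>R u) v = c * b u v"
  and bilinear_on_scale_right: "u \<in> V \<Longrightarrow> v \<in> V \<Longrightarrow> b u (c *\<^sub>R v) = c * b u v"
  using bil unfolding bilinear_on_def by blast+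

lemma bilinear_on_diff_left: "u \<in> V \<Longrightarrow> v \<in> V \<Longrightarrow> w \<in> V \<Longrightarrow> b (u - v) w = b u w - b v w"
  using bilinear_on_add_left[of u "(-1) *\<^sub>R v" w] bilinear_on_scale_left[of v w "-1"]
    subspace_scale[OF sub, of v "-1"] by simp

lemma bilinear_on_diff_right: "u \<in> V \<Longrightarrow> v \<in> V \<Longrightarrow> w \<in> V \<Longrightarrow> b w (u - v) = b w u - b w v"
  using bilinear_on_add_right[of u "(-1) *\<^sub>R v" w] bilinear_on_scale_right[of w v "-1"]
    subspace_scale[OF sub, of v "-1"] by simp

lemma bilinear_on_zero_left: "v \<in> V \<Longrightarrow> b 0 v = 0"
  using bilinear_on_scale_left[of v v 0] by simp

lemma bilinear_on_zero_right: "v \<in> V \<Longrightarrow> b v 0 = 0"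
  using bilinear_on_scale_right[of v v 0] by simp

end

lemmas bilinear_on_simps =
  bilinear_on_add_left bilinear_on_add_right bilinear_on_scale_left bilinear_on_scale_right
  bilinear_on_diff_left bilinear_on_diff_right bilinear_on_zero_left bilinear_on_zero_right

text \<open>Definiteness is left out on purpose: a field vanishing almost everywhere in the domain
  is null for the Sobolev product, and every divergence-free field is null for the product of
  divergences.\<close>

definition semi_inner_on :: "'v::real_vector set \<Rightarrow> ('v \<Rightarrow> 'v \<Rightarrow> real) \<Rightarrow> bool" where
  "semi_inner_on V b \<longleftrightarrow>
     bilinear_on V b \<and> (\<forall>u\<in>V. \<forall>v\<in>V. b u v = b v u) \<and> (\<forall>u\<in>V. 0 \<le> b u u)"

lemma semi_inner_on_subset: "semi_inner_on V b \<Longrightarrow> W \<subseteq> V \<Longrightarrow> semi_inner_on W b"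
  unfolding semi_inner_on_def using bilinear_on_subset by blast

section \<open>Cauchy-Schwarz and null vectors of a semi-inner product\<close>

context
  fixes V :: "'v::real_vector set" and b :: "'v \<Rightarrow> 'v \<Rightarrow> real"
  assumes semi: "semi_inner_on V b" and sub: "subspace V"
begin

lemma semi_inner_on_bilinear: "bilinear_on V b"
  and semi_inner_on_commute: "u \<in> V \<Longrightarrow> v \<in> V \<Longrightarrow> b u v = b v u"
  and semi_inner_on_nonneg: "u \<in> V \<Longrightarrow> 0 \<le> b u u"
  using semi unfolding semi_inner_on_def by blast+

lemma semi_inner_on_Cauchy_Schwarz_square:
  assumes "u \<in> V" "v \<in> V"
  shows "(b u v)\<^sup>2 \<le> b u u * b v v"
proof -
  have expand: "0 \<le> b u u + 2 * t * b u v + t\<^sup>2 * b v v" for t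
  proof -
    have m: "u + t *\<^sub>R v \<in> V" "t *\<^sub>R v \<in> V"
      using assms sub by (auto intro: subspace_add subspace_scale)
    have "b (u + t *\<^sub>R v) (u + t *\<^sub>R v) = b u u + 2 * t * b u v + t\<^sup>2 * b v v"
      using assms m semi_inner_on_commute[OF assms]
      by (simp add: bilinear_on_simps[OF semi_inner_on_bilinear sub] algebra_simps power2_eq_square)
    then show ?thesis using semi_inner_on_nonneg[OF m(1)] by simp
  qed
  show ?thesis
  proof (cases "b v v = 0")
    case True
    have "b u v = 0"
    proof (rule ccontr)
      assume nz: "b u v \<noteq> 0"
      \<comment> \<open>With \<open>b v v = 0\<close> the quadratic in \<open>t\<close> is affine;
        this is its value at the point where it equals -1.\<close>
      have "0 \<le> b u u + 2 * (-(b u u + 1) / (2 * b u v)) * b u v"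
        using expand[of "-(b u u + 1) / (2 * b u v)"] True by simp
      then show False using nz by (simp add: field_simps)
    qed
    then show ?thesis using True by simp
  next
    case False
    then have pos: "b v v > 0" using semi_inner_on_nonneg[OF assms(2)] by simp
    have "0 \<le> b u u + 2 * (- b u v / b v v) * b u v + (- b u v / b v v)\<^sup>2 * b v v"
      by (rule expand)
    also have "\<dots> = (b u u * b v v - (b u v)\<^sup>2) / b v v"
      using pos by (simp add: field_simps power2_eq_square)
    finally show ?thesis using pos by (simp add: zero_le_divide_iff)
  qed
qed

lemma semi_inner_on_Cauchy_Schwarz:
  assumes "u \<in> V" "v \<in> V"
  shows "\<bar>b u v\<bar> \<le> sqrt (b u u) * sqrt (b v v)"
  using real_sqrt_le_mono[OF semi_inner_on_Cauchy_Schwarz_square[OF assms]]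
  by (simp add: real_sqrt_mult)

lemma semi_inner_on_null:
  assumes "u \<in> V" "v \<in> V" "b u u = 0"
  shows "b u v = 0" "b v u = 0"
  using semi_inner_on_Cauchy_Schwarz[OF assms(1,2)] assms(3) semi_inner_on_commute[OF assms(1,2)]
  by auto

lemma semi_inner_on_triangle:
  assumes "u \<in> V" "v \<in> V"
  shows "sqrt (b (u + v) (u + v)) \<le> sqrt (b u u) + sqrt (b v v)"
proof (rule real_le_lsqrt)
  have "u + v \<in> V" using assms sub by (auto intro: subspace_add)
  then have "b (u + v) (u + v) = b u u + 2 * b u v + b v v"
    using assms semi_inner_on_commute[OF assms]
    by (simp add: bilinear_on_simps[OF semi_inner_on_bilinear sub])
  also have "\<dots> \<le> b u u + 2 * (sqrt (b u u) * sqrt (b v v)) + b v v"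
    using semi_inner_on_Cauchy_Schwarz[OF assms] by linarith
  also have "\<dots> = (sqrt (b u u) + sqrt (b v v))\<^sup>2"
    using semi_inner_on_nonneg assms by (simp add: power2_sum)
  finally show "b (u + v) (u + v) \<le> (sqrt (b u u) + sqrt (b v v))\<^sup>2" .
qed (use semi_inner_on_nonneg assms in auto)

text \<open>Substitute for working in the quotient: by Cauchy-Schwarz, vectors with a null
  difference may be exchanged in either argument of \<open>b\<close>.\<close>

lemma semi_inner_on_null_diff:
  assumes "u \<in> V" "v \<in> V" "w \<in> V" "b (u - v) (u - v) = 0"
  shows "b u w = b v w" "b w u = b w v" "b u u = b v v"
proof -
  have m: "u - v \<in> V" using assms sub by (auto intro: subspace_diff)
  have eq: "b u x = b v x" if "x \<in> V" for x
    using semi_inner_on_null(1)[OF m that assms(4)] assms that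
    by (simp add: bilinear_on_simps[OF semi_inner_on_bilinear sub])
  show "b u w = b v w" by (rule eq) fact
  then show "b w u = b w v" using assms semi_inner_on_commute by metis
  have "b u u = b v u" by (rule eq) fact
  also have "\<dots> = b u v" using assms semi_inner_on_commute by auto
  also have "\<dots> = b v v" by (rule eq) fact
  finally show "b u u = b v v" .
qed

lemma semi_inner_on_scale_norm:
  assumes "u \<in> V" shows "sqrt (b (c *\<^sub>R u) (c *\<^sub>R u)) = \<bar>c\<bar> * sqrt (b u u)"
proof -
  have "b (c *\<^sub>R u) (c *\<^sub>R u) = c\<^sup>2 * b u u"
    using assms subspace_scale[OF sub, of u c]
    by (simp add: bilinear_on_simps[OF semi_inner_on_bilinear sub] power2_eq_square)
  then show ?thesis by (simp add: real_sqrt_mult)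
qed

lemma semi_inner_on_kernel_subspace: "subspace {v \<in> V. b v v = 0}"
proof (rule subspaceI)
  note simps = bilinear_on_simps[OF semi_inner_on_bilinear sub] subspace_add[OF sub] subspace_scale[OF sub]
  show "0 \<in> {v \<in> V. b v v = 0}" using subspace_0[OF sub] by (simp add: simps)
next
  fix u v assume "u \<in> {v \<in> V. b v v = 0}" "v \<in> {v \<in> V. b v v = 0}"
  then show "u + v \<in> {v \<in> V. b v v = 0}"
    using semi_inner_on_null[of u v] bilinear_on_simps[OF semi_inner_on_bilinear sub] subspace_add[OF sub]
    by auto
next
  fix c u assume "u \<in> {v \<in> V. b v v = 0}"
  then show "c *\<^sub>R u \<in> {v \<in> V. b v v = 0}"
    using bilinear_on_simps[OF semi_inner_on_bilinear sub] subspace_scale[OF sub] by auto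
qed

end

text \<open>Finite dimension modulo \<open>h\<close>-null vectors. The finite element spaces
  themselves are infinite-dimensional here, since fields are unrestricted outside the closure of the
  domain.\<close>

definition finitely_spanned_mod :: "('v::real_vector \<Rightarrow> 'v \<Rightarrow> real) \<Rightarrow> 'v set \<Rightarrow> bool" where
  "finitely_spanned_mod h V \<longleftrightarrow>
     (\<exists>S. finite S \<and> S \<subseteq> V \<and> (\<forall>v\<in>V. \<exists>s\<in>span S. h (v - s) (v - s) = 0))"

text \<open>A basis taken from the image of \<open>V\<close> under \<open>r\<close> is lifted back
  to \<open>V\<close>; vectors with the same image differ by an element of the kernel of
  \<open>r\<close>, which is \<open>h\<close>-null.\<close>

lemma finitely_spanned_modI:
  assumes r: "linear r" and B: "finite B" "r ` V \<subseteq> span B"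
    and V: "subspace V" and null: "\<And>v. v \<in> V \<Longrightarrow> r v = 0 \<Longrightarrow> h v v = 0"
  shows "finitely_spanned_mod h V"
proof -
  obtain C where C: "C \<subseteq> r ` V" "independent C" "r ` V \<subseteq> span C"
    by (metis basis_exists)
  have "finite C"
    using independent_span_bound[OF B(1) C(2)] C(1) B(2) by (metis subset_trans)
  then obtain S where S: "S \<subseteq> V" "finite S" "C = r ` S"
    using C(1) by (metis finite_subset_image)
  have "\<exists>s\<in>span S. h (v - s) (v - s) = 0" if "v \<in> V" for v
  proof -
    have "r v \<in> r ` span S"
      using C(3) that S(3) linear_span_image[OF r, of S] by auto
    then obtain s where s: "s \<in> span S" "r v = r s" by auto
    have "s \<in> V" using s(1) S(1) V by (metis span_minimal subsetD)
    then show ?thesis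
      using s that null[of "v - s"] subspace_diff[OF V] by (auto simp: linear_diff[OF r])
  qed
  then show ?thesis unfolding finitely_spanned_mod_def using S by blast
qed

section \<open>Galerkin systems with possibly degenerate forms\<close>

definition linear_functional_on :: "'v::real_vector set \<Rightarrow> ('v \<Rightarrow> real) \<Rightarrow> bool" where
  "linear_functional_on V l \<longleftrightarrow>
     (\<forall>u\<in>V. \<forall>v\<in>V. l (u + v) = l u + l v) \<and> (\<forall>u\<in>V. \<forall>c. l (c *\<^sub>R u) = c * l u)"

lemma linear_functional_on_bilinear_left:
  "bilinear_on V b \<Longrightarrow> u \<in> V \<Longrightarrow> W \<subseteq> V \<Longrightarrow> linear_functional_on W (b u)"
  unfolding linear_functional_on_def bilinear_on_def by blast

text \<open>
  The solvability of a square Galerkin system, by induction on the spanning set: a new vector is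
  first corrected so that the form vanishes on it against the span of the old ones.
\<close>

lemma galerkin_solve_span:
  assumes bil: "bilinear_on V b" and V: "subspace V"
    and null: "\<And>e v. e \<in> V \<Longrightarrow> v \<in> V \<Longrightarrow> b e e = 0 \<Longrightarrow> b e v = 0 \<and> b v e = 0"
    and "finite S" "S \<subseteq> V"
    and "linear_functional_on V l" "\<And>e. e \<in> V \<Longrightarrow> b e e = 0 \<Longrightarrow> l e = 0"
  shows "\<exists>z\<in>span S. \<forall>v\<in>span S. b z v = l v"
  using assms(4-)
proof (induction S arbitrary: l rule: finite_induct)
  case empty
  then have "l 0 = 0" using V subspace_0[OF V] unfolding linear_functional_on_def
    by (metis mult_zero_left scaleR_zero_left)
  then show ?case using bilinear_on_zero_left[OF bil V] subspace_0[OF V] by simp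
next
  case (insert s S)
  note simps = bilinear_on_simps[OF bil V]
  have sV: "s \<in> V" and SV: "span S \<subseteq> V" using insert.prems(1) V by (auto simp: span_minimal)
  \<comment> \<open>The induction hypothesis serves two functionals, \<open>b s\<close> for the
    correction of the new vector and \<open>l\<close> for the old system, which is why it is
    generalised over \<open>l\<close>.\<close>
  obtain y where y: "y \<in> span S" "\<And>v. v \<in> span S \<Longrightarrow> b y v = b s v"
    using insert.IH[of "b s"] linear_functional_on_bilinear_left[OF bil sV] null[OF _ sV]
      insert.prems(1) by auto
  obtain z where z: "z \<in> span S" "\<And>v. v \<in> span S \<Longrightarrow> b z v = l v"
    using insert.IH[of l] insert.prems by auto
  define e where "e = s - y"
  have yV: "y \<in> V" and zV: "z \<in> V" using SV y z by auto
  have eV: "e \<in> V" unfolding e_def using sV yV V by (auto intro: subspace_diff)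
  have be: "b e v = 0" if "v \<in> span S" for v
    using y(2)[OF that] sV yV SV that by (auto simp: e_def simps)
  \<comment> \<open>\<open>e\<close> is orthogonal to the old span in its first argument only,
    because \<open>b\<close> need not be symmetric; the coupling \<open>b z e\<close> is therefore
    compensated in \<open>t\<close>. If \<open>b e e = 0\<close>, then \<open>l e\<close> and
    \<open>b z e\<close> vanish and any \<open>t\<close> works.\<close>
  define t where "t = (if b e e = 0 then 0 else (l e - b z e) / b e e)"
  have t: "b z e + t * b e e = l e"
    using insert.prems(3)[OF eV] null[OF eV zV] by (auto simp: t_def)
  have teV: "t *\<^sub>R e \<in> V" using eV V by (auto intro: subspace_scale)
  have "z + t *\<^sub>R e \<in> span (insert s S)"
    unfolding e_def using y(1) z(1) span_mono[of S "insert s S"]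
    by (intro span_add span_scale span_diff) (auto intro: span_base)
  moreover have "b (z + t *\<^sub>R e) v = l v" if "v \<in> span (insert s S)" for v
  proof -
    obtain k where k: "v - k *\<^sub>R s \<in> span S" using \<open>v \<in> span (insert s S)\<close> span_breakdown_eq by blast
    define v0 where "v0 = (v - k *\<^sub>R s) + k *\<^sub>R y"
    have v0: "v0 \<in> span S" unfolding v0_def using k y(1) by (intro span_add span_scale)
    have v0V: "v0 \<in> V" and keV: "k *\<^sub>R e \<in> V" using v0 SV eV V by (auto intro: subspace_scale)
    have v: "v = v0 + k *\<^sub>R e" by (simp add: v0_def e_def algebra_simps)
    have "b (z + t *\<^sub>R e) v = l v0 + k * (b z e + t * b e e)"
      unfolding v using zV eV v0V keV teV z(2)[OF v0] be[OF v0]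
      by (simp add: simps subspace_add[OF V] algebra_simps)
    also have "\<dots> = l v"
      unfolding t v using insert.prems(2) v0V keV eV unfolding linear_functional_on_def by simp
    finally show ?thesis .
  qed
  ultimately show ?case by blast
qed

text \<open>A vector of \<open>V\<close> differs from one in the span by an \<open>h\<close>-null
  vector, hence by a \<open>b\<close>-null one; neither \<open>b z\<close> nor \<open>l\<close> sees
  the difference, so solving on the span is enough.\<close>

lemma galerkin_solve:
  assumes bil: "bilinear_on V b" and V: "subspace V"
    and null: "\<And>e v. e \<in> V \<Longrightarrow> v \<in> V \<Longrightarrow> b e e = 0 \<Longrightarrow> b e v = 0 \<and> b v e = 0"
    and fin: "finitely_spanned_mod h V" and hb: "\<And>e. e \<in> V \<Longrightarrow> h e e = 0 \<Longrightarrow> b e e = 0"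
    and l: "linear_functional_on V l" "\<And>e. e \<in> V \<Longrightarrow> b e e = 0 \<Longrightarrow> l e = 0"
  obtains z where "z \<in> V" "\<And>v. v \<in> V \<Longrightarrow> b z v = l v"
proof -
  obtain S where S: "finite S" "S \<subseteq> V" "\<And>v. v \<in> V \<Longrightarrow> \<exists>s\<in>span S. h (v - s) (v - s) = 0"
    using fin unfolding finitely_spanned_mod_def by auto
  obtain z where z: "z \<in> span S" "\<And>v. v \<in> span S \<Longrightarrow> b z v = l v"
    using galerkin_solve_span[OF bil V null S(1,2) l] by blast
  have SV: "span S \<subseteq> V" using S(2) V by (simp add: span_minimal)
  have "b z v = l v" if v: "v \<in> V" for v
  proof -
    obtain s where s: "s \<in> span S" "h (v - s) (v - s) = 0" using S(3)[OF v] by blast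
    have m: "s \<in> V" "v - s \<in> V" "z \<in> V" using s(1) SV v V z(1) by (auto intro: subspace_diff)
    have nul: "b (v - s) (v - s) = 0" using hb m(2) s(2) by auto
    have "b z v = b z s" using null[OF m(2,3) nul] m v by (simp add: bilinear_on_simps[OF bil V])
    moreover have "l (s + (v - s)) = l s + l (v - s)"
      using l(1) m(1,2) unfolding linear_functional_on_def by blast
    ultimately show ?thesis using z(2)[OF s(1)] l(2)[OF m(2) nul] by simp
  qed
  then show thesis using that z SV by blast
qed

text \<open>Comparison of seminorms in finite dimension without compactness: a new vector is made
  \<open>b\<close>-orthogonal to the old span, and by Pythagoras each part of the decomposition is
  dominated by the whole in the \<open>b\<close>-seminorm.\<close>

lemma seminorm_bound_span:
  assumes h: "semi_inner_on V h" and b: "semi_inner_on V b" and V: "subspace V"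
    and bh: "\<And>e. e \<in> V \<Longrightarrow> b e e = 0 \<Longrightarrow> h e e = 0"
    and "finite S" "S \<subseteq> V"
  shows "\<exists>C\<ge>0. \<forall>v\<in>span S. sqrt (h v v) \<le> C * sqrt (b v v)"
  using assms(5-)
proof (induction S rule: finite_induct)
  case empty
  have "h 0 0 = 0"
    using bilinear_on_zero_left[OF semi_inner_on_bilinear[OF h V] V] subspace_0[OF V] by simp
  moreover have "b 0 0 = 0"
    using bilinear_on_zero_left[OF semi_inner_on_bilinear[OF b V] V] subspace_0[OF V] by simp
  ultimately show ?case by auto
next
  case (insert s S)
  note bb = semi_inner_on_bilinear[OF b V]
  note simps = bilinear_on_simps[OF bb V]
  have sV: "s \<in> V" and SV: "span S \<subseteq> V" and S: "S \<subseteq> V"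
    using insert.prems(1) V by (auto simp: span_minimal)
  obtain C where C: "C \<ge> 0" "\<And>v. v \<in> span S \<Longrightarrow> sqrt (h v v) \<le> C * sqrt (b v v)"
    using insert.IH[OF S] by blast
  have lf: "linear_functional_on V (b s)"
    by (rule linear_functional_on_bilinear_left[OF bb sV order_refl])
  have nl: "b s e = 0" if "e \<in> V" "b e e = 0" for e
    by (rule semi_inner_on_null(2)[OF b V that(1) sV that(2)])
  obtain y where y: "y \<in> span S" "\<And>v. v \<in> span S \<Longrightarrow> b y v = b s v"
    using galerkin_solve_span[OF bb V _ insert.hyps(1) S lf nl] semi_inner_on_null[OF b V] by blast
  define e where "e = s - y"
  have yV: "y \<in> V" using SV y by auto
  have eV: "e \<in> V" unfolding e_def using sV yV V by (auto intro: subspace_diff)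
  have be: "b e v = 0" "b v e = 0" if "v \<in> span S" for v
    using y(2)[OF that] sV yV SV that semi_inner_on_commute[OF b V eV, of v]
    by (auto simp: e_def simps)
  \<comment> \<open>Division by zero yields 0, the right value here: \<open>b e e = 0\<close> forces
    \<open>h e e = 0\<close>.\<close>
  define D where "D = sqrt (h e e) / sqrt (b e e)"
  have D0: "D \<ge> 0" using semi_inner_on_nonneg[OF h V eV] semi_inner_on_nonneg[OF b V eV]
    by (simp add: D_def)
  have D: "sqrt (h e e) = D * sqrt (b e e)" using bh[OF eV] by (auto simp: D_def)
  have "sqrt (h v v) \<le> (C + D) * sqrt (b v v)" if "v \<in> span (insert s S)" for v
  proof -
    obtain k where k: "v - k *\<^sub>R s \<in> span S" using \<open>v \<in> span (insert s S)\<close> span_breakdown_eq by blast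
    define v0 where "v0 = (v - k *\<^sub>R s) + k *\<^sub>R y"
    have v0: "v0 \<in> span S" unfolding v0_def using k y(1) by (intro span_add span_scale)
    have v0V: "v0 \<in> V" and keV: "k *\<^sub>R e \<in> V" using v0 SV eV V by (auto intro: subspace_scale)
    have v: "v = v0 + k *\<^sub>R e" by (simp add: v0_def e_def algebra_simps)
    have bv: "b v v = b v0 v0 + k\<^sup>2 * b e e"
      unfolding v using eV v0V keV be[OF v0]
      by (simp add: simps subspace_add[OF V] algebra_simps power2_eq_square)
    have p: "0 \<le> b v0 v0" "0 \<le> b e e" using semi_inner_on_nonneg[OF b V] v0V eV by auto
    have "sqrt (h v v) \<le> sqrt (h v0 v0) + \<bar>k\<bar> * sqrt (h e e)"
      using semi_inner_on_triangle[OF h V v0V keV] semi_inner_on_scale_norm[OF h V eV] v by simp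
    also have "\<dots> \<le> C * sqrt (b v0 v0) + D * (\<bar>k\<bar> * sqrt (b e e))"
      using C(2)[OF v0] D by simp
    also have "\<dots> \<le> C * sqrt (b v v) + D * sqrt (b v v)"
    proof (intro add_mono mult_left_mono C(1) D0)
      show "sqrt (b v0 v0) \<le> sqrt (b v v)" using bv p by simp
      have "\<bar>k\<bar> * sqrt (b e e) = sqrt (k\<^sup>2 * b e e)" by (simp add: real_sqrt_mult)
      then show "\<bar>k\<bar> * sqrt (b e e) \<le> sqrt (b v v)" using bv p by simp
    qed
    finally show ?thesis by (simp add: algebra_simps)
  qed
  then show ?case using C(1) D0 by (intro exI[of _ "C + D"]) auto
qed

lemma seminorm_bound:
  assumes h: "semi_inner_on V h" and b: "semi_inner_on V b" and V: "subspace V"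
    and hb: "\<And>e. e \<in> V \<Longrightarrow> h e e = 0 \<Longrightarrow> b e e = 0"
    and bh: "\<And>e. e \<in> V \<Longrightarrow> b e e = 0 \<Longrightarrow> h e e = 0"
    and fin: "finitely_spanned_mod h V"
  obtains C where "C \<ge> 0" "\<And>v. v \<in> V \<Longrightarrow> sqrt (h v v) \<le> C * sqrt (b v v)"
proof -
  obtain S where S: "finite S" "S \<subseteq> V" "\<And>v. v \<in> V \<Longrightarrow> \<exists>s\<in>span S. h (v - s) (v - s) = 0"
    using fin unfolding finitely_spanned_mod_def by auto
  obtain C where C: "C \<ge> 0" "\<And>v. v \<in> span S \<Longrightarrow> sqrt (h v v) \<le> C * sqrt (b v v)"
    using seminorm_bound_span[OF h b V bh S(1,2)] by blast
  have SV: "span S \<subseteq> V" using S(2) V by (simp add: span_minimal)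
  have "sqrt (h v v) \<le> C * sqrt (b v v)" if v: "v \<in> V" for v
  proof -
    obtain s where s: "s \<in> span S" "h (v - s) (v - s) = 0" using S(3)[OF v] by blast
    have m: "s \<in> V" "v - s \<in> V" using s(1) SV v V by (auto intro: subspace_diff)
    show ?thesis
      using C(2)[OF s(1)] semi_inner_on_null_diff(3)[OF h V v m(1) v s(2)]
        semi_inner_on_null_diff(3)[OF b V v m(1) v hb[OF m(2) s(2)]] by simp
  qed
  then show thesis using that C(1) by blast
qed

section \<open>The condensed iteration in an abstract setting\<close>

text \<open>Pressures do not occur: each is represented by a field having it as divergence, and
  \<open>b\<close> is the L2 product of divergences. In the application \<open>h\<close> is the
  Sobolev product, \<open>N\<close> the divergence-free interior fields, \<open>R\<close> the
  interior fields and \<open>d\<close> the dimension.\<close>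

locale mixed_galerkin =
  fixes X N R :: "'v::real_vector set" and h b a :: "'v \<Rightarrow> 'v \<Rightarrow> real" and M \<alpha> d :: real
  assumes X: "subspace X" and N: "subspace N" "N \<subseteq> X" and R: "R \<subseteq> X"
    and h: "semi_inner_on X h" and b: "semi_inner_on X b" and a: "bilinear_on X a"
    and d_nonneg: "0 \<le> d" and b_le_h: "v \<in> X \<Longrightarrow> b v v \<le> d * h v v"
    and N_null: "z \<in> N \<Longrightarrow> b z z = 0"
    and finitely_spanned: "subspace V \<Longrightarrow> V \<subseteq> X \<Longrightarrow> finitely_spanned_mod h V"
    and M_pos: "0 < M" and \<alpha>_pos: "0 < \<alpha>"
    and bounded: "u \<in> X \<Longrightarrow> v \<in> X \<Longrightarrow> \<bar>a u v\<bar> \<le> M * sqrt (h u u) * sqrt (h v v)"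
    and coercive: "u \<in> X \<Longrightarrow> \<alpha> * h u u \<le> a u u"
begin

abbreviation nh :: "'v \<Rightarrow> real" where "nh v \<equiv> sqrt (h v v)"
abbreviation nb :: "'v \<Rightarrow> real" where "nb v \<equiv> sqrt (b v v)"

lemmas bil_h = semi_inner_on_bilinear[OF h X]
lemmas bil_b = semi_inner_on_bilinear[OF b X]
lemmas h_simps = bilinear_on_simps[OF bil_h X]
lemmas b_simps = bilinear_on_simps[OF bil_b X]
lemmas a_simps = bilinear_on_simps[OF a X]
lemmas X_closed = subspace_add[OF X] subspace_diff[OF X] subspace_scale[OF X] subspace_0[OF X]

lemma h_nonneg: "v \<in> X \<Longrightarrow> 0 \<le> h v v" and b_nonneg: "v \<in> X \<Longrightarrow> 0 \<le> b v v"
  using semi_inner_on_nonneg[OF h X] semi_inner_on_nonneg[OF b X] by auto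

lemma h_null_b: "v \<in> X \<Longrightarrow> h v v = 0 \<Longrightarrow> b v v = 0"
  using b_le_h[of v] b_nonneg[of v] by simp

lemma nb_le_nh: "v \<in> X \<Longrightarrow> nb v \<le> sqrt d * nh v"
  using real_sqrt_le_mono[OF b_le_h] by (simp add: real_sqrt_mult)

section \<open>Preimages under the divergence\<close>

lemma orthogonal_kernel_subspace: "subspace {v \<in> X. \<forall>z\<in>X. b z z = 0 \<longrightarrow> h v z = 0}"
  by (rule subspaceI) (auto simp: h_simps X_closed)

text \<open>Subtracting from \<open>s\<close> its \<open>h\<close>-projection onto the kernel of
  \<open>b\<close> keeps the divergence and leaves the preimage of least norm.\<close>

lemma minimal_preimage:
  assumes s: "s \<in> X"
  obtains v where "v \<in> X" "b (v - s) (v - s) = 0" "\<And>z. z \<in> X \<Longrightarrow> b z z = 0 \<Longrightarrow> h v z = 0"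
proof -
  define Z where "Z = {v \<in> X. b v v = 0}"
  have Z: "subspace Z" "Z \<subseteq> X" using semi_inner_on_kernel_subspace[OF b X] by (auto simp: Z_def)
  obtain z where z: "z \<in> Z" "\<And>z'. z' \<in> Z \<Longrightarrow> h z z' = h s z'"
  proof (rule galerkin_solve[of Z h h "h s"])
    show "bilinear_on Z h" by (rule bilinear_on_subset[OF bil_h Z(2)])
    show "h e v = 0 \<and> h v e = 0" if "e \<in> Z" "v \<in> Z" "h e e = 0" for e v
      using semi_inner_on_null[OF h X, of e v] that Z(2) by blast
    show "linear_functional_on Z (h s)" by (rule linear_functional_on_bilinear_left[OF bil_h s Z(2)])
    show "h s e = 0" if "e \<in> Z" "h e e = 0" for e
      using semi_inner_on_null(2)[OF h X, of e s] that Z(2) s by blast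
  qed (use Z finitely_spanned in auto)
  have zX: "z \<in> X" "b z z = 0" using z(1) by (auto simp: Z_def)
  show thesis
  proof (rule that[of "s - z"])
    show "s - z \<in> X" using s zX X_closed by auto
    show "b (s - z - s) (s - z - s) = 0"
      using b_simps(3)[of z "- z" "-1"] semi_inner_on_null(1)[OF b X zX(1) _ zX(2), of "- z"]
        zX X_closed(3)[of z "-1"] by simp
    show "h (s - z) y = 0" if "y \<in> X" "b y y = 0" for y
      using z(2)[of y] that s zX by (simp add: Z_def h_simps)
  qed
qed

text \<open>On the \<open>h\<close>-complement of the kernel of \<open>b\<close> the two seminorms
  are equivalent. The constant is not explicit; it serves to bound the inf-sup constant away from
  zero. One is added to it because it may be zero.\<close>

lemma bounded_right_inverse:
  obtains C where "C > 0" "\<And>s. s \<in> X \<Longrightarrow> \<exists>v\<in>X. b (v - s) (v - s) = 0 \<and> nh v \<le> C * nb s"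
proof -
  define W where "W = {v \<in> X. \<forall>z\<in>X. b z z = 0 \<longrightarrow> h v z = 0}"
  have W: "subspace W" "W \<subseteq> X" using orthogonal_kernel_subspace by (auto simp: W_def)
  obtain C where C: "C \<ge> 0" "\<And>v. v \<in> W \<Longrightarrow> nh v \<le> C * nb v"
  proof (rule seminorm_bound[of W h b])
    show "semi_inner_on W h" "semi_inner_on W b" using h b W(2) semi_inner_on_subset by blast+
    show "b e e = 0" if "e \<in> W" "h e e = 0" for e using that h_null_b W(2) by blast
    show "h e e = 0" if "e \<in> W" "b e e = 0" for e using that by (auto simp: W_def)
  qed (use W finitely_spanned in auto)
  show thesis
  proof (rule that[of "C + 1"])
    show "\<exists>v\<in>X. b (v - s) (v - s) = 0 \<and> nh v \<le> (C + 1) * nb s" if s: "s \<in> X" for s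
    proof -
      obtain v where v: "v \<in> X" "b (v - s) (v - s) = 0" "\<And>z. z \<in> X \<Longrightarrow> b z z = 0 \<Longrightarrow> h v z = 0"
        using minimal_preimage[OF s] by blast
      have "nh v \<le> C * nb v" using v by (intro C(2)) (auto simp: W_def)
      also have "\<dots> = C * nb s" using semi_inner_on_null_diff(3)[OF b X v(1) s s v(2)] by simp
      also have "\<dots> \<le> (C + 1) * nb s" using b_nonneg[OF s] by (intro mult_right_mono) auto
      finally show ?thesis using v by blast
    qed
  qed (use C in auto)
qed

text \<open>
  The inf-sup condition bounds the adjoint of the divergence from below; the Riesz representative of
  \<open>h v\<close> transfers this to the divergence on the orthogonal complement of its kernel.
\<close>

lemma preimage_inf_sup:
  assumes \<beta>: "0 < \<beta>"
    and inf_sup: "\<And>s c. s \<in> X \<Longrightarrow> 0 \<le> c \<Longrightarrow> (\<And>v. v \<in> X \<Longrightarrow> b v s \<le> c * nh v) \<Longrightarrow> \<beta> * nb s \<le> c"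
    and s: "s \<in> X"
  obtains v where "v \<in> X" "b (v - s) (v - s) = 0" "\<beta> * nh v \<le> nb s"
proof -
  obtain v where v: "v \<in> X" "b (v - s) (v - s) = 0" "\<And>z. z \<in> X \<Longrightarrow> b z z = 0 \<Longrightarrow> h v z = 0"
    using minimal_preimage[OF s] by blast
  \<comment> \<open>The form \<open>b\<close> may be degenerate on \<open>X\<close>; the system is
    solvable because minimality of \<open>v\<close> makes \<open>h v\<close> vanish on the kernel of
    \<open>b\<close>.\<close>
  obtain r where r: "r \<in> X" "\<And>w. w \<in> X \<Longrightarrow> b r w = h v w"
  proof (rule galerkin_solve[of X b h "h v"])
    show "linear_functional_on X (h v)"
      by (rule linear_functional_on_bilinear_left[OF bil_h v(1) order_refl])
    show "b e v = 0 \<and> b v e = 0" if "e \<in> X" "v \<in> X" "b e e = 0" for e v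
      using semi_inner_on_null[OF b X that] by blast
  qed (use X bil_b finitely_spanned h_null_b v(3) in auto)
  have "\<beta> * nb r \<le> nh v"
  proof (rule inf_sup[OF r(1)])
    show "b w r \<le> nh v * nh w" if "w \<in> X" for w
      using semi_inner_on_Cauchy_Schwarz[OF h X v(1) that] r(2)[OF that]
        semi_inner_on_commute[OF b X r(1) that] by simp
  qed (use h_nonneg[OF v(1)] in auto)
  have nv: "nb v = nb s" using semi_inner_on_null_diff(3)[OF b X v(1) s s v(2)] by simp
  have "nh v * nh v = b r v" using r(2)[OF v(1)] h_nonneg[OF v(1)] by simp
  also have "\<dots> \<le> nb r * nb v" using semi_inner_on_Cauchy_Schwarz[OF b X r(1) v(1)] by simp
  finally have "\<beta> * (nh v * nh v) \<le> (\<beta> * nb r) * nb s" using \<beta> nv by simp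
  also have "\<dots> \<le> nh v * nb s" using \<open>\<beta> * nb r \<le> nh v\<close> b_nonneg[OF s] by (intro mult_right_mono) auto
  finally have "nh v * (\<beta> * nh v) \<le> nh v * nb s" by (simp add: algebra_simps)
  then have "\<beta> * nh v \<le> nb s"
    using h_nonneg[OF v(1)] b_nonneg[OF s] by (cases "nh v = 0") auto
  then show thesis using that v by blast
qed

text \<open>Solvable because coercivity turns \<open>a e e = 0\<close> into
  \<open>h e e = 0\<close>, and boundedness then makes \<open>e\<close> null for \<open>a\<close> on
  both sides. Testing with \<open>z\<close> itself gives the norm bound.\<close>

lemma interior_projection:
  assumes v: "v \<in> X"
  obtains z where "z \<in> N" "\<And>z'. z' \<in> N \<Longrightarrow> a z z' = a v z'" "\<alpha> * nh z \<le> M * nh v"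
proof -
  have h0: "h e e = 0" if "e \<in> X" "a e e = 0" for e
    using coercive[OF that(1)] that(2) h_nonneg[OF that(1)] \<alpha>_pos
    by (metis linorder_not_le mult_pos_pos order_le_less)
  have null: "a e v = 0" "a v e = 0" if "e \<in> X" "v \<in> X" "h e e = 0" for e v
    using bounded[OF that(1,2)] bounded[OF that(2,1)] that(3) by auto
  obtain z where z: "z \<in> N" "\<And>z'. z' \<in> N \<Longrightarrow> a z z' = a v z'"
  proof (rule galerkin_solve[of N a h "a v"])
    show "bilinear_on N a" by (rule bilinear_on_subset[OF a N(2)])
    show "a e v = 0 \<and> a v e = 0" if "e \<in> N" "v \<in> N" "a e e = 0" for e v
      using null h0 that N(2) by (metis subsetD)
    show "linear_functional_on N (a v)" by (rule linear_functional_on_bilinear_left[OF a v N(2)])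
    show "a v e = 0" if "e \<in> N" "a e e = 0" for e using null h0 that v N(2) by (metis subsetD)
    show "a e e = 0" if "e \<in> N" "h e e = 0" for e using null that N(2) by (metis subsetD)
  qed (use N finitely_spanned in auto)
  have zX: "z \<in> X" using z N by auto
  have "\<alpha> * h z z \<le> a v z" using coercive[OF zX] z by simp
  also have "\<dots> \<le> M * nh v * nh z" using bounded[OF v zX] by simp
  finally have "nh z * (\<alpha> * nh z) \<le> nh z * (M * nh v)"
    using h_nonneg[OF zX] by (simp add: algebra_simps)
  then have "\<alpha> * nh z \<le> M * nh v"
    using h_nonneg[OF zX] h_nonneg[OF v] M_pos by (cases "nh z = 0") auto
  then show thesis using that z by blast
qed

definition Y :: "'v set" where
  "Y = {v \<in> X. (\<forall>z\<in>N. a v z = 0) \<and> (\<forall>r\<in>R. b v r = 0)}"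

text \<open>\<open>z\<close> is the projection of \<open>v\<close> in the first argument of
  \<open>a\<close>, so \<open>a (v - z)\<close> vanishes on \<open>N\<close>; being divergence-free,
  \<open>z\<close> leaves the products with \<open>R\<close> intact. The factor is 1 + M/\<alpha> by
  the triangle inequality.\<close>

lemma boundary_correction:
  assumes v: "v \<in> X" "\<And>r. r \<in> R \<Longrightarrow> b v r = 0"
  obtains z where "z \<in> N" "v - z \<in> Y" "\<alpha> * nh (v - z) \<le> (M + \<alpha>) * nh v"
proof -
  obtain z where z: "z \<in> N" "\<And>z'. z' \<in> N \<Longrightarrow> a z z' = a v z'" "\<alpha> * nh z \<le> M * nh v"
    using interior_projection[OF v(1)] by blast
  have zX: "z \<in> X" using z N by auto
  have "v - z \<in> Y"
  proof -
    have "a (v - z) y = 0" if "y \<in> N" for y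
      using z(2)[OF that] that N(2) v zX by (simp add: a_simps subset_iff)
    moreover have "b (v - z) r = 0" if "r \<in> R" for r
      using semi_inner_on_null(1)[OF b X zX _ N_null[OF z(1)], of r] v that R zX
      by (simp add: b_simps subset_iff)
    ultimately show ?thesis using v zX X_closed by (auto simp: Y_def)
  qed
  moreover have "\<alpha> * nh (v - z) \<le> (M + \<alpha>) * nh v"
  proof -
    have "nh (v - z) \<le> nh v + nh z"
      using semi_inner_on_triangle[OF h X v(1) X_closed(3)[OF zX, of "-1"]]
        semi_inner_on_scale_norm[OF h X zX, of "-1"] by simp
    then have "\<alpha> * nh (v - z) \<le> \<alpha> * nh v + \<alpha> * nh z"
      using \<alpha>_pos by (metis distrib_left mult_le_cancel_left_pos)
    then show ?thesis using z(3) by (simp add: algebra_simps)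
  qed
  ultimately show thesis using that z(1) by blast
qed

text \<open>The factor 1/\<beta> is paid for the preimage in \<open>X\<close> and (M +
  \<alpha>)/\<alpha> for its correction, which applies since the preimage has the same products with
  \<open>R\<close> as \<open>s\<close>.\<close>

lemma boundary_preimage_inf_sup:
  assumes \<beta>: "0 < \<beta>"
    and inf_sup: "\<And>s c. s \<in> X \<Longrightarrow> 0 \<le> c \<Longrightarrow> (\<And>v. v \<in> X \<Longrightarrow> b v s \<le> c * nh v) \<Longrightarrow> \<beta> * nb s \<le> c"
    and s: "s \<in> X" "\<And>r. r \<in> R \<Longrightarrow> b s r = 0"
  obtains v where "v \<in> Y" "b (v - s) (v - s) = 0" "\<alpha> * \<beta> * nh v \<le> (M + \<alpha>) * nb s"
proof -
  obtain v where v: "v \<in> X" "b (v - s) (v - s) = 0" "\<beta> * nh v \<le> nb s"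
    using preimage_inf_sup[OF \<beta> inf_sup s(1)] by blast
  have "b v r = 0" if "r \<in> R" for r
    using semi_inner_on_null_diff(1)[OF b X v(1) s(1) _ v(2)] that R s(2) by auto
  then obtain z where z: "z \<in> N" "v - z \<in> Y" "\<alpha> * nh (v - z) \<le> (M + \<alpha>) * nh v"
    using boundary_correction[OF v(1)] by blast
  have zX: "z \<in> X" "b z z = 0" using z N N_null by auto
  have "b (v - z - s) (v - z - s) = 0"
  proof -
    have e: "v - s \<in> X" "v - z - s = (v - s) - z" using v s X_closed by auto
    show ?thesis unfolding e(2)
      using semi_inner_on_null[OF b X e(1) zX(1) v(2)] e(1) zX v(2) by (simp add: b_simps X_closed)
  qed
  moreover have "\<alpha> * \<beta> * nh (v - z) \<le> (M + \<alpha>) * nb s"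
  proof -
    have "\<beta> * (\<alpha> * nh (v - z)) \<le> \<beta> * ((M + \<alpha>) * nh v)" using z(3) \<beta> by simp
    also have "\<dots> = (M + \<alpha>) * (\<beta> * nh v)" by simp
    also have "\<dots> \<le> (M + \<alpha>) * nb s" using v(3) M_pos \<alpha>_pos by simp
    finally show ?thesis by (simp add: algebra_simps)
  qed
  ultimately show thesis using that z(2) by blast
qed

end

text \<open>The dual space is spelled out in \<open>momentum\<close>, \<open>mass\<close> and
  \<open>step\<close> because its name \<open>dual.Y\<close> becomes available only with the
  sublocale below. \<open>s\<close> is a field whose divergence is the exact multiplier, and the
  update is required for divergences only.\<close>

locale condensed_iteration = mixed_galerkin +
  fixes L :: "'a \<Rightarrow> real" and lam :: real and u s :: 'a and un w :: "nat \<Rightarrow> 'a"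
  assumes lam_pos: "0 < lam"
    and u: "u \<in> Y" and s: "s \<in> Y" and un: "un n \<in> Y" and w: "w n \<in> Y"
    and momentum: "v \<in> X \<Longrightarrow> (\<And>z. z \<in> N \<Longrightarrow> a z v = 0) \<Longrightarrow> (\<And>r. r \<in> R \<Longrightarrow> b v r = 0) \<Longrightarrow>
      a u v - b s v = L v"
    and mass: "v \<in> X \<Longrightarrow> (\<And>z. z \<in> N \<Longrightarrow> a z v = 0) \<Longrightarrow> (\<And>r. r \<in> R \<Longrightarrow> b v r = 0) \<Longrightarrow>
      b v u = 0"
    and step: "v \<in> X \<Longrightarrow> (\<And>z. z \<in> N \<Longrightarrow> a z v = 0) \<Longrightarrow> (\<And>r. r \<in> R \<Longrightarrow> b v r = 0) \<Longrightarrow>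
      a (un n) v + lam * b (un n) v = L v + b (w n) v"
    and update: "b (w (Suc n) - (w n - lam *\<^sub>R un n)) (w (Suc n) - (w n - lam *\<^sub>R un n)) = 0"
begin

text \<open>Boundedness and coercivity survive exchanging the arguments of \<open>a\<close>, and the
  exchange turns \<open>Y\<close> into the dual boundary space; every result on \<open>Y\<close>
  thus has its dual counterpart.\<close>

sublocale dual: mixed_galerkin X N R h b "\<lambda>u v. a v u" M \<alpha> d
proof (unfold_locales)
  show "\<bar>a v u\<bar> \<le> M * nh u * nh v" if "u \<in> X" "v \<in> X" for u v
    using bounded[OF that(2,1)] by (simp add: mult_ac)
qed (use X N R h b d_nonneg b_le_h N_null finitely_spanned M_pos \<alpha>_pos coercive
    bilinear_on_flip[OF a] in auto)

section \<open>Consequences of the iteration equations\<close>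

lemma Y_subset: "v \<in> Y \<Longrightarrow> v \<in> X" and Y_a: "v \<in> Y \<Longrightarrow> z \<in> N \<Longrightarrow> a v z = 0"
  and Y_b: "v \<in> Y \<Longrightarrow> r \<in> R \<Longrightarrow> b v r = 0"
  by (auto simp: Y_def)

lemma Y_diff: "v \<in> Y \<Longrightarrow> v' \<in> Y \<Longrightarrow> v - v' \<in> Y"
  using N(2) R by (auto simp: Y_def a_simps b_simps X_closed subset_iff)

lemma dual_Y: "v \<in> dual.Y \<longleftrightarrow> v \<in> X \<and> (\<forall>z\<in>N. a z v = 0) \<and> (\<forall>r\<in>R. b v r = 0)"
  by (simp add: dual.Y_def)

text \<open>
  A member of \<open>Y\<close> and its counterpart in the dual space differ by an interior field, which
  neither the form on \<open>Y\<close> nor the divergence sees.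
\<close>

lemma dual_partner:
  assumes e: "e \<in> Y"
  obtains v where "v \<in> dual.Y" "\<And>y. y \<in> Y \<Longrightarrow> a y v = a y e" "\<And>y. y \<in> X \<Longrightarrow> b y v = b y e"
proof -
  obtain z where z: "z \<in> N" "e - z \<in> dual.Y"
    using dual.boundary_correction[of e] Y_subset[OF e] Y_b[OF e] by blast
  have zX: "z \<in> X" "b z z = 0" using z N N_null by auto
  show thesis
  proof (rule that[OF z(2)])
    show "a y (e - z) = a y e" if "y \<in> Y" for y
      using Y_subset[OF that] Y_subset[OF e] zX Y_a[OF that z(1)] by (simp add: a_simps)
    show "b y (e - z) = b y e" if "y \<in> X" for y
      using that Y_subset[OF e] zX semi_inner_on_null(2)[OF b X zX(1) that zX(2)] by (simp add: b_simps)
  qed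
qed

text \<open>The mass equation offers test fields from the dual space only, but the dual partner of
  \<open>u\<close> has the divergence of \<open>u\<close> itself.\<close>

lemma div_u: "b u u = 0"
proof -
  obtain v where v: "v \<in> dual.Y" "\<And>y. y \<in> X \<Longrightarrow> b y v = b y u"
    using dual_partner[OF u] by blast
  have "b v u = 0" using v(1) by (intro mass) (auto simp: dual_Y)
  then show ?thesis
    using v Y_subset[OF u] semi_inner_on_commute[OF b X, of v u] by (auto simp: dual_Y)
qed

lemma b_error: "x \<in> X \<Longrightarrow> b (u - un n) x = - b (un n) x"
  using semi_inner_on_null(1)[OF b X Y_subset[OF u] _ div_u] Y_subset[OF u] Y_subset[OF un]
  by (simp add: b_simps)

lemma nb_error: "nb (u - un n) = nb (un n)"
proof -
  have m: "u - un n \<in> X" "un n \<in> X" "u \<in> X" using Y_subset u un Y_diff by auto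
  have "b (u - un n) (u - un n) = - b (un n) (u - un n)" by (rule b_error[OF m(1)])
  also have "b (un n) (u - un n) = b (u - un n) (un n)"
    by (rule semi_inner_on_commute[OF b X m(2,1)])
  also have "\<dots> = - b (un n) (un n)" by (rule b_error[OF m(2)])
  finally show ?thesis by simp
qed

lemma b_update: "x \<in> X \<Longrightarrow> b (w (Suc n)) x = b (w n) x - lam * b (un n) x"
  using semi_inner_on_null_diff(1)[OF b X _ _ _ update, of n x]
    Y_subset[OF w] Y_subset[OF un] by (simp add: b_simps X_closed)

text \<open>The penalty term and \<open>w n\<close> merge into \<open>w (Suc n)\<close> through the
  update, which is why the index is shifted.\<close>

lemma error_equation:
  assumes v: "v \<in> dual.Y"
  shows "a (u - un n) v = b (s - w (Suc n)) v"
proof -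
  have vX: "v \<in> X" using v by (simp add: dual_Y)
  have "a u v - b s v = L v" using v by (intro momentum) (auto simp: dual_Y)
  moreover have "a (un n) v + lam * b (un n) v = L v + b (w n) v"
    using v by (intro step) (auto simp: dual_Y)
  ultimately show ?thesis
    using Y_subset[OF u] Y_subset[OF un] Y_subset[OF s] Y_subset[OF w] vX b_update[OF vX]
    by (simp add: a_simps b_simps)
qed

text \<open>The field \<open>z = y - e\<close> is divergence-free and lies in \<open>Y\<close>, so
  its dual partner sees no multiplier in the error equation and \<open>a e z = 0\<close>. Hence
  \<open>a z z = a y z\<close>, \<open>nh z\<close> is at most M/\<alpha> times \<open>nh y\<close>,
  and the triangle inequality yields the factor 1 + M/\<alpha>.\<close>

lemma error_le_preimage:
  assumes y: "y \<in> Y" "b (y - (u - un n)) (y - (u - un n)) = 0"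
  shows "\<alpha> * nh (u - un n) \<le> (M + \<alpha>) * nh y"
proof -
  define e where "e = u - un n"
  have e: "e \<in> Y" unfolding e_def by (intro Y_diff u un)
  define z where "z = y - e"
  have z: "z \<in> Y" "b z z = 0" using y e by (auto simp: z_def e_def intro: Y_diff)
  obtain v where v: "v \<in> dual.Y" "\<And>y. y \<in> Y \<Longrightarrow> a y v = a y z" "\<And>y. y \<in> X \<Longrightarrow> b y v = b y z"
    using dual_partner[OF z(1)] by blast
  note mem = Y_subset[OF e] Y_subset[OF y(1)] Y_subset[OF z(1)]
  have sw: "s - w (Suc n) \<in> X" by (intro Y_subset Y_diff s w)
  have "a e z = a e v" using v(2)[OF e] by simp
  also have "\<dots> = b (s - w (Suc n)) v" unfolding e_def by (rule error_equation[OF v(1)])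
  also have "\<dots> = b (s - w (Suc n)) z" by (rule v(3)[OF sw])
  also have "\<dots> = 0" by (rule semi_inner_on_null(2)[OF b X mem(3) sw z(2)])
  finally have "a z z = a y z" using mem by (simp add: z_def a_simps X_closed)
  then have "\<alpha> * h z z \<le> M * nh y * nh z"
    using coercive[OF mem(3)] bounded[OF mem(2,3)] by linarith
  then have "nh z * (\<alpha> * nh z) \<le> nh z * (M * nh y)"
    using h_nonneg[OF mem(3)] by (simp add: algebra_simps)
  then have "\<alpha> * nh z \<le> M * nh y"
    using h_nonneg[OF mem(3)] h_nonneg[OF mem(2)] M_pos by (cases "nh z = 0") auto
  moreover have "nh e \<le> nh y + nh z"
  proof -
    have "e = y + (-1) *\<^sub>R z" by (simp add: z_def)
    then show ?thesis
      using semi_inner_on_triangle[OF h X mem(2) X_closed(3)[OF mem(3), of "-1"]]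
        semi_inner_on_scale_norm[OF h X mem(3), of "-1"] by simp
  qed
  then have "\<alpha> * nh e \<le> \<alpha> * nh y + \<alpha> * nh z"
    using \<alpha>_pos by (metis distrib_left mult_le_cancel_left_pos)
  ultimately show ?thesis by (simp add: e_def algebra_simps)
qed

lemma div_un_Suc_le: "lam * (nb (un (Suc n)))\<^sup>2 \<le> M * nh (u - un n) * nh (u - un (Suc n))"
proof -
  define e e' where "e = u - un n" and "e' = u - un (Suc n)"
  have e: "e \<in> Y" "e' \<in> Y" unfolding e_def e'_def by (intro Y_diff u un)+
  obtain v where v: "v \<in> dual.Y" "\<And>y. y \<in> Y \<Longrightarrow> a y v = a y e'" "\<And>y. y \<in> X \<Longrightarrow> b y v = b y e'"
    using dual_partner[OF e(2)] by blast
  have vX: "v \<in> X" using v by (simp add: dual_Y)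
  note mem = Y_subset[OF e(1)] Y_subset[OF e(2)] Y_subset[OF s] Y_subset[OF w] Y_subset[OF un]
  \<comment> \<open>The error equation at \<open>Suc n\<close> minus that at \<open>n\<close>: the
    exact multiplier \<open>s\<close> cancels and the update leaves only
    \<open>un (Suc n)\<close>.\<close>
  have "a e' v - a e v = lam * b (un (Suc n)) v"
    unfolding e_def e'_def error_equation[OF v(1)] using b_update[OF vX, of "Suc n"] mem vX
    by (simp add: b_simps)
  then have *: "a e' e' - a e e' = lam * b (un (Suc n)) e'"
    using v e mem by simp
  have "b (un (Suc n)) e' = b e' (un (Suc n))" by (rule semi_inner_on_commute[OF b X mem(5,2)])
  also have "\<dots> = - b (un (Suc n)) (un (Suc n))" unfolding e'_def by (rule b_error[OF mem(5)])
  finally have "lam * b (un (Suc n)) (un (Suc n)) = a e e' - a e' e'" using * by simp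
  also have "\<dots> \<le> M * nh e * nh e'"
  proof -
    \<comment> \<open>Of coercivity only the sign of \<open>a e' e'\<close> is kept.\<close>
    have "0 \<le> \<alpha> * h e' e'" using h_nonneg[OF mem(2)] \<alpha>_pos by simp
    then show ?thesis using coercive[OF mem(2)] bounded[OF mem(1,2)] by linarith
  qed
  finally show ?thesis using b_nonneg[OF mem(5)] by (simp add: e_def e'_def)
qed

text \<open>Covers the case in which the inf-sup constant is an infimum over the empty set: the
  divergence of the error has the preimage 0, so the norms in the claimed estimates vanish whatever
  the value of the constant.\<close>

lemma degenerate:
  assumes "\<And>v. v \<in> X \<Longrightarrow> b v v = 0"
  shows "nh (u - un n) = 0" "nb (un n) = 0" "nb (s - w n) = 0"
proof -
  have Y0: "0 \<in> Y" using Y_diff[OF u u] by simp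
  have "\<alpha> * nh (u - un n) \<le> (M + \<alpha>) * nh 0"
    using Y0 assms Y_subset[OF Y_diff[OF Y0 Y_diff[OF u un]]] by (intro error_le_preimage) auto
  moreover have "h 0 0 = 0" using X_closed by (simp add: h_simps)
  ultimately show "nh (u - un n) = 0"
    using \<alpha>_pos h_nonneg[OF Y_subset[OF Y_diff[OF u un]], of n]
    by (simp add: mult_le_0_iff)
  show "nb (un n) = 0" "nb (s - w n) = 0"
    using assms Y_subset[OF un] Y_subset[OF Y_diff[OF s w]] by auto
qed

section \<open>Estimates in terms of the inf-sup constant\<close>

context
  fixes \<beta> :: real
  assumes \<beta>_pos: "0 < \<beta>" and \<beta>_le: "\<beta> \<le> sqrt d" and \<alpha>_le_M: "\<alpha> \<le> M"
    and d_le: "d \<le> 4"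
    and inf_sup: "\<And>s c. s \<in> X \<Longrightarrow> 0 \<le> c \<Longrightarrow> (\<And>v. v \<in> X \<Longrightarrow> b v s \<le> c * nh v) \<Longrightarrow> \<beta> * nb s \<le> c"
begin

text \<open>Two factors (M + \<alpha>)/\<alpha> meet here, one from finding a preimage inside
  \<open>Y\<close> and one from comparing the error with it.\<close>

lemma error_bound: "nh (u - un n) \<le> (M + \<alpha>)\<^sup>2 / (\<alpha>\<^sup>2 * \<beta>) * nb (un n)"
proof -
  define e where "e = u - un n"
  have e: "e \<in> Y" unfolding e_def by (intro Y_diff u un)
  obtain y where y: "y \<in> Y" "b (y - e) (y - e) = 0" "\<alpha> * \<beta> * nh y \<le> (M + \<alpha>) * nb e"
    using boundary_preimage_inf_sup[OF \<beta>_pos inf_sup Y_subset[OF e] Y_b[OF e]] by blast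
  have "\<alpha> * \<beta> * (\<alpha> * nh e) \<le> \<alpha> * \<beta> * ((M + \<alpha>) * nh y)"
    using error_le_preimage[of y n] y \<alpha>_pos \<beta>_pos by (intro mult_left_mono) (auto simp: e_def)
  also have "\<dots> = (M + \<alpha>) * (\<alpha> * \<beta> * nh y)" by simp
  also have "\<dots> \<le> (M + \<alpha>) * ((M + \<alpha>) * nb e)"
    using y(3) M_pos \<alpha>_pos by (intro mult_left_mono) auto
  also have "nb e = nb (un n)" unfolding e_def by (rule nb_error)
  finally show ?thesis
    using \<alpha>_pos \<beta>_pos by (simp add: e_def field_simps power2_eq_square)
qed

text \<open>The error equation, tested with a preimage in the dual space, controls
  \<open>s - w (Suc n)\<close>. Going back to \<open>w n\<close> costs
  \<open>lam * nb (un n)\<close>, and \<open>nb (un n)\<close> is the divergence norm of the error,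
  at most \<open>sqrt d\<close> times its norm.\<close>

lemma multiplier_bound: "nb (s - w n) \<le> (M * (M + \<alpha>) / (\<alpha> * \<beta>) + sqrt d * lam) * nh (u - un n)"
proof -
  define r where "r = s - w (Suc n)"
  have r: "r \<in> Y" unfolding r_def by (intro Y_diff s w)
  obtain v where v: "v \<in> dual.Y" "b (v - r) (v - r) = 0" "\<alpha> * \<beta> * nh v \<le> (M + \<alpha>) * nb r"
    using dual.boundary_preimage_inf_sup[OF \<beta>_pos inf_sup Y_subset[OF r] Y_b[OF r]] by blast
  have mem: "r \<in> X" "v \<in> X" "u - un n \<in> X" "un n \<in> X" "w n \<in> X" "s \<in> X" "w (Suc n) \<in> X"
    using v(1) Y_subset[OF r] Y_subset[OF Y_diff[OF u un]] Y_subset[OF un] Y_subset[OF w] Y_subset[OF s]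
    by (auto simp: dual_Y)
  have "b r r = b r v" using semi_inner_on_null_diff(2)[OF b X mem(2,1,1) v(2)] by simp
  also have "\<dots> = a (u - un n) v" using error_equation[OF v(1)] by (simp add: r_def)
  also have "\<dots> \<le> M * nh (u - un n) * nh v" using bounded[OF mem(3,2)] by linarith
  finally have "\<alpha> * \<beta> * (nb r * nb r) \<le> \<alpha> * \<beta> * (M * nh (u - un n) * nh v)"
    using \<alpha>_pos \<beta>_pos b_nonneg[OF mem(1)] by simp
  also have "\<dots> = M * nh (u - un n) * (\<alpha> * \<beta> * nh v)" by simp
  also have "\<dots> \<le> M * nh (u - un n) * ((M + \<alpha>) * nb r)"
    using v(3) M_pos h_nonneg[OF mem(3)] by (intro mult_left_mono) auto
  finally have "nb r * (\<alpha> * \<beta> * nb r) \<le> nb r * (M * (M + \<alpha>) * nh (u - un n))"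
    by (simp add: algebra_simps)
  then have "\<alpha> * \<beta> * nb r \<le> M * (M + \<alpha>) * nh (u - un n)"
    using b_nonneg[OF mem(1)] M_pos \<alpha>_pos h_nonneg[OF mem(3)] by (cases "nb r = 0") auto
  then have 1: "nb r \<le> M * (M + \<alpha>) / (\<alpha> * \<beta>) * nh (u - un n)"
    using \<alpha>_pos \<beta>_pos by (simp add: field_simps)
  have "nb (s - w n) \<le> nb r + lam * nb (un n)"
  proof -
    \<comment> \<open>By the update, \<open>t\<close> has the same \<open>b\<close>-products as
      \<open>s - w n\<close>.\<close>
    define t where "t = r + (- lam) *\<^sub>R un n"
    have t: "t \<in> X" "s - w n \<in> X" using mem X_closed(1)[OF mem(1) X_closed(3)[OF mem(4)]]
      by (auto simp: t_def X_closed)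
    have "b (s - w n) x = b t x" if "x \<in> X" for x
      using b_update[OF that, of n] mem that X_closed(3)[OF mem(4), of "- lam"]
      by (simp add: t_def r_def b_simps X_closed del: scaleR_minus_left)
    then have "b (s - w n) (s - w n) = b t (s - w n)" "b (s - w n) t = b t t" using t by auto
    then have "b (s - w n) (s - w n) = b t t" using semi_inner_on_commute[OF b X] t by metis
    then show ?thesis
      using semi_inner_on_triangle[OF b X mem(1) X_closed(3)[OF mem(4), of "- lam"]]
        semi_inner_on_scale_norm[OF b X mem(4), of "- lam"] lam_pos by (simp add: t_def)
  qed
  also have "\<dots> \<le> M * (M + \<alpha>) / (\<alpha> * \<beta>) * nh (u - un n) + lam * (sqrt d * nh (u - un n))"
    using 1 nb_le_nh[OF mem(3)] lam_pos unfolding nb_error by (intro add_mono mult_left_mono) auto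
  finally show ?thesis by (simp add: algebra_simps)
qed

text \<open>Put B = (M + \<alpha>)/\<alpha>. The bracket arises from the factor of
  \<open>multiplier_bound\<close> by multiplying its first term with B^2/\<beta> and its second with
  B/\<beta>. Both multipliers are at least 1 because \<beta> \<le> \<open>sqrt d\<close> \<le> 2
  \<le> B, which rests on d \<le> 4 and \<alpha> \<le> M.\<close>

lemma scaled_multiplier_bound:
  "inverse (M * (M + \<alpha>) ^ 3 / (\<alpha> ^ 3 * \<beta>\<^sup>2) + sqrt d * lam * (M + \<alpha>) / (\<alpha> * \<beta>)) * nb (s - w n)
     \<le> nh (u - un n)"
proof -
  define B where "B = (M + \<alpha>) / \<alpha>"
  have B2: "2 \<le> B" using \<alpha>_le_M \<alpha>_pos by (simp add: B_def field_simps)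
  have \<beta>2: "\<beta> \<le> 2" using \<beta>_le real_sqrt_le_mono[OF d_le] by simp
  have "\<beta> * 1 \<le> B * 1" using B2 \<beta>2 by simp
  also have "\<dots> \<le> B * B" using B2 by (intro mult_left_mono) auto
  finally have BB: "1 \<le> B\<^sup>2 / \<beta>" "1 \<le> B / \<beta>"
    using \<beta>_pos B2 \<beta>2 by (auto simp: power2_eq_square field_simps)
  let ?K = "M * (M + \<alpha>) ^ 3 / (\<alpha> ^ 3 * \<beta>\<^sup>2) + sqrt d * lam * (M + \<alpha>) / (\<alpha> * \<beta>)"
  have d: "0 < sqrt d" using \<beta>_pos \<beta>_le by linarith
  have B0: "0 < B" using B2 by simp
  have K: "?K = M * B / \<beta> * (B\<^sup>2 / \<beta>) + sqrt d * lam * (B / \<beta>)"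
    using \<alpha>_pos \<beta>_pos by (simp add: B_def field_simps power2_eq_square power3_eq_cube)
  have "0 < ?K" unfolding K using M_pos lam_pos \<beta>_pos d B0 by (intro add_pos_pos mult_pos_pos) auto
  have "M * (M + \<alpha>) / (\<alpha> * \<beta>) + sqrt d * lam = M * B / \<beta> * 1 + sqrt d * lam * 1"
    by (simp add: B_def)
  also have "\<dots> \<le> ?K"
    unfolding K using BB M_pos lam_pos \<beta>_pos d B0 by (intro add_mono mult_left_mono) auto
  finally have "nb (s - w n) \<le> ?K * nh (u - un n)"
    using multiplier_bound[of n] h_nonneg[OF Y_subset[OF Y_diff[OF u un]], of n]
    by (meson mult_right_mono order_trans real_sqrt_ge_zero)
  then show ?thesis using \<open>0 < ?K\<close> by (simp add: field_simps)
qed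

text \<open>Let D be the constant of \<open>error_bound\<close>. One use of it cancels a factor in
  the quadratic estimate and bounds \<open>nb (un (Suc n))\<close> by M D/lam times the previous
  error; a second use returns to the error and gives M D^2/lam.\<close>

lemma contraction:
  "nh (u - un (Suc n)) \<le> M * (M + \<alpha>) ^ 4 / (\<alpha> ^ 4 * \<beta>\<^sup>2 * lam) * nh (u - un n)"
proof -
  define D where "D = (M + \<alpha>)\<^sup>2 / (\<alpha>\<^sup>2 * \<beta>)"
  have D: "0 < D" using M_pos \<alpha>_pos \<beta>_pos by (simp add: D_def)
  have mem: "un (Suc n) \<in> X" "u - un n \<in> X" using Y_subset un Y_diff u by auto
  have e: "nh (u - un (Suc n)) \<le> D * nb (un (Suc n))" unfolding D_def by (rule error_bound)
  have "lam * (nb (un (Suc n)))\<^sup>2 \<le> M * nh (u - un n) * nh (u - un (Suc n))"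
    by (rule div_un_Suc_le)
  also have "\<dots> \<le> M * nh (u - un n) * (D * nb (un (Suc n)))"
    using e M_pos h_nonneg[OF mem(2)] by (intro mult_left_mono) auto
  finally have "nb (un (Suc n)) * (lam * nb (un (Suc n))) \<le> nb (un (Suc n)) * (M * D * nh (u - un n))"
    by (simp add: power2_eq_square algebra_simps)
  then have "lam * nb (un (Suc n)) \<le> M * D * nh (u - un n)"
    using b_nonneg[OF mem(1)] M_pos D h_nonneg[OF mem(2)] by (cases "nb (un (Suc n)) = 0") auto
  then have "nb (un (Suc n)) \<le> M * D / lam * nh (u - un n)"
    using lam_pos by (simp add: field_simps)
  then have "D * nb (un (Suc n)) \<le> D * (M * D / lam * nh (u - un n))"
    using D by (intro mult_left_mono) auto
  also have "D * (M * D / lam * nh (u - un n)) = M * (M + \<alpha>) ^ 4 / (\<alpha> ^ 4 * \<beta>\<^sup>2 * lam) * nh (u - un n)"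
    by (simp add: D_def power2_eq_square power4_eq_xxxx mult_ac)
  finally show ?thesis using e by linarith
qed

lemma div_bound:
  "nb (un n) \<le> sqrt d * (M * (M + \<alpha>) ^ 4 / (\<alpha> ^ 4 * \<beta>\<^sup>2 * lam)) ^ n * nh (u - un 0)"
proof -
  define \<theta> where "\<theta> = M * (M + \<alpha>) ^ 4 / (\<alpha> ^ 4 * \<beta>\<^sup>2 * lam)"
  have \<theta>: "0 \<le> \<theta>" using M_pos \<alpha>_pos lam_pos by (simp add: \<theta>_def)
  have "nh (u - un n) \<le> \<theta> ^ n * nh (u - un 0)"
  proof (induction n)
    case (Suc n)
    have "nh (u - un (Suc n)) \<le> \<theta> * nh (u - un n)" unfolding \<theta>_def by (rule contraction)
    also have "\<dots> \<le> \<theta> * (\<theta> ^ n * nh (u - un 0))" using Suc \<theta> by (intro mult_left_mono) auto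
    finally show ?case by (simp add: algebra_simps)
  qed simp
  moreover have "nb (un n) \<le> sqrt d * nh (u - un n)"
    using nb_le_nh[OF Y_subset[OF Y_diff[OF u un]], of n] unfolding nb_error .
  ultimately have "nb (un n) \<le> sqrt d * (\<theta> ^ n * nh (u - un 0))"
    using d_nonneg by (meson mult_left_mono order_trans real_sqrt_ge_zero)
  then show ?thesis by (simp add: \<theta>_def algebra_simps)
qed

end

end

section \<open>Smooth bump functions and the fundamental lemma of the calculus of variations\<close>

text \<open>With the powers of 1/t carried along, the derivative of a member is a combination of
  members, so smoothness of all orders follows by induction.\<close>

definition bump :: "nat \<Rightarrow> real \<Rightarrow> real" where
  "bump j t = (if 0 < t then exp (- inverse t) * inverse t ^ j else 0)"

lemma bump_bounds: "0 \<le> bump 0 t" "bump 0 t \<le> 1"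
  by (auto simp: bump_def)

lemma bump_tendsto_0: "(bump j \<longlongrightarrow> 0) (at 0)"
proof -
  have "((\<lambda>t::real. inverse t ^ j / exp (inverse t)) \<longlongrightarrow> 0) (at_right 0)"
    by (rule filterlim_compose[OF tendsto_power_div_exp_0 filterlim_inverse_at_top_right])
  then have "(bump j \<longlongrightarrow> 0) (at_right 0)"
    by (rule Lim_transform_eventually)
      (auto simp: eventually_at_filter bump_def exp_minus divide_inverse mult.commute)
  moreover have "(bump j \<longlongrightarrow> 0) (at_left 0)"
    by (rule Lim_transform_eventually[OF tendsto_const]) (auto simp: eventually_at_filter bump_def)
  ultimately show ?thesis by (simp add: filterlim_split_at_real)
qed

lemma bump_has_real_derivative:
  "(bump j has_real_derivative (bump (j + 2) t - real j * bump (j + 1) t)) (at t)"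
proof -
  consider "t < 0" | "t = 0" | "t > 0" by linarith
  then show ?thesis
  proof cases
    case 1
    have "(bump j has_real_derivative 0) (at t)"
      by (rule has_field_derivative_transform_within_open[of "\<lambda>_. 0" _ _ "{..<0}"])
        (use 1 in \<open>auto simp: bump_def\<close>)
    then show ?thesis using 1 by (simp add: bump_def)
  next
    case 2
    \<comment> \<open>The difference quotient of \<open>bump j\<close> at zero is
      \<open>bump (Suc j)\<close>.\<close>
    have "(bump (Suc j) \<longlongrightarrow> 0) (at 0)" by (rule bump_tendsto_0)
    then have "((\<lambda>s. (bump j s - bump j 0) / (s - 0)) \<longlongrightarrow> 0) (at 0)"
      by (rule Lim_transform_eventually)
        (auto simp: eventually_at_filter bump_def field_simps)
    then show ?thesis using 2 by (simp add: has_field_derivative_iff bump_def)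
  next
    case 3
    have "((\<lambda>t. exp (- inverse t) * inverse t ^ j) has_real_derivative
            (bump (j + 2) t - real j * bump (j + 1) t)) (at t)"
    proof -
      have inv: "(inverse has_real_derivative - (inverse t * inverse t)) (at t)"
        using DERIV_inverse[of t] 3 by (simp add: power2_eq_square)
      have "((\<lambda>t. inverse t ^ j) has_real_derivative - real j * inverse t ^ (j + 1)) (at t)"
        by (rule DERIV_cong[OF DERIV_power[OF inv]]) (cases j; simp add: algebra_simps)
      from DERIV_mult[OF DERIV_fun_exp[OF DERIV_minus[OF inv]] this]
      show ?thesis using 3 by (simp add: bump_def algebra_simps)
    qed
    then show ?thesis
      by (rule has_field_derivative_transform_within_open[of _ _ _ "{0<..}"])
        (use 3 in \<open>auto simp: bump_def\<close>)
  qed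
qed

section \<open>Calculus of functions with continuous partial derivatives\<close>

lemma partial_eqI:
  assumes "(f has_derivative f') (at x)"
  shows "partial i f x = f' (axis i 1)"
  using frechet_derivative_at[OF assms] by (simp add: partial_def)

lemma partial_mult:
  assumes "f differentiable (at x)" "g differentiable (at x)"
  shows "partial i (\<lambda>x. f x * g x) x = f x * partial i g x + partial i f x * g x"
  unfolding partial_def
  using frechet_derivative_at[OF has_derivative_mult[OF assms[unfolded frechet_derivative_works]]]
  by (metis)

lemma partial_add:
  assumes "f differentiable (at x)" "g differentiable (at x)"
  shows "partial i (\<lambda>x. f x + g x) x = partial i f x + partial i g x"
  unfolding partial_def
  using frechet_derivative_at[OF has_derivative_add[OF assms[unfolded frechet_derivative_works]]]
  by (metis)

lemma partial_const: "partial i (\<lambda>x. c) x = 0"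
  by (simp add: partial_def)

lemma C_k_const: "C_k k (\<lambda>x. c)"
  by (induction k arbitrary: c) (auto simp: partial_const[abs_def])

lemma C_k_continuous: "C_k k f \<Longrightarrow> continuous_on UNIV f"
  by (cases k) (auto simp: continuous_on_eq_continuous_at differentiable_imp_continuous_within)

lemma C_k_add: "C_k k f \<Longrightarrow> C_k k g \<Longrightarrow> C_k k (\<lambda>x. f x + g x)"
proof (induction k arbitrary: f g)
  case 0
  then show ?case by (auto intro: continuous_on_add)
next
  case (Suc k)
  have "partial i (\<lambda>x. f x + g x) = (\<lambda>x. partial i f x + partial i g x)" for i
    using Suc.prems by (intro ext partial_add) auto
  then show ?case using Suc by (auto intro: differentiable_add)
qed

lemma C_k_Suc_imp: "C_k (Suc k) f \<Longrightarrow> C_k k f"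
proof (induction k arbitrary: f)
  case 0
  then show ?case using C_k_continuous by (metis C_k.simps(1))
next
  case (Suc k)
  then show ?case by (metis C_k.simps(2))
qed

lemma C_k_mult: "C_k k f \<Longrightarrow> C_k k g \<Longrightarrow> C_k k (\<lambda>x. f x * g x)"
proof (induction k arbitrary: f g)
  case 0
  then show ?case by (auto intro: continuous_on_mult)
next
  case (Suc k)
  have "partial i (\<lambda>x. f x * g x) = (\<lambda>x. f x * partial i g x + partial i f x * g x)" for i
    using Suc.prems by (intro ext partial_mult) auto
  moreover have "C_k k f" "C_k k g" using Suc.prems C_k_Suc_imp by blast+
  ultimately show ?case using Suc by (auto intro: differentiable_mult C_k_add)
qed

lemma C_k_prod: "finite I \<Longrightarrow> (\<And>i. i \<in> I \<Longrightarrow> C_k k (f i)) \<Longrightarrow> C_k k (\<lambda>x. \<Prod>i\<in>I. f i x)"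
  by (induction I rule: finite_induct) (auto intro: C_k_const C_k_mult)

lemma C_k_bump: "C_k k (\<lambda>x. bump j (c * x $ i + e))"
proof (induction k arbitrary: j)
  case 0
  have "isCont (bump j) t" for t using bump_has_real_derivative DERIV_isCont by blast
  then have "continuous_on UNIV (bump j)" by (simp add: continuous_on_eq_continuous_at)
  then show ?case by (auto intro!: continuous_intros continuous_on_compose2[of UNIV "bump j"])
next
  case (Suc k)
  have der: "((\<lambda>x. bump j (c * x $ i + e)) has_derivative
      (\<lambda>v. (bump (j + 2) (c * x $ i + e) - real j * bump (j + 1) (c * x $ i + e)) * (c * v $ i))) (at x)"
    for x :: "real ^ 'a"
  proof -
    have "((\<lambda>x. c * x $ i + e) has_derivative (\<lambda>v. c * v $ i)) (at x)"
      by (auto intro!: derivative_eq_intros bounded_linear_imp_has_derivative bounded_linear_vec_nth)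
    from has_derivative_compose[OF this bump_has_real_derivative[unfolded has_field_derivative_def]]
    show ?thesis by simp
  qed
  have "partial i' (\<lambda>x. bump j (c * x $ i + e)) = (\<lambda>x. (c * axis i' 1 $ i) *
      (bump (j + 2) (c * x $ i + e) + (- real j) * bump (j + 1) (c * x $ i + e)))" for i'
    by (rule ext) (unfold partial_eqI[OF der], simp add: algebra_simps)
  moreover have "C_k k (\<lambda>x. (c * axis i' 1 $ i) *
      (bump (j + 2) (c * x $ i + e) + (- real j) * bump (j + 1) (c * x $ i + e)))" for i'
    by (intro C_k_mult C_k_add C_k_const Suc.IH)
  ultimately show ?case using der by (auto simp: differentiable_def)
qed

text \<open>Inside the box, a product of terms exp(-1/(m t)) with t the distances to the faces;
  growing \<open>m\<close> drives it to the indicator of the open box.\<close>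

definition box_bump :: "real ^ 'n::finite \<Rightarrow> real ^ 'n \<Rightarrow> real \<Rightarrow> real ^ 'n \<Rightarrow> real" where
  "box_bump a b m x = (\<Prod>i\<in>UNIV. bump 0 (m * (x $ i - a $ i)) * bump 0 (m * (b $ i - x $ i)))"

lemma C_k_box_bump: "C_k k (box_bump a b m)"
proof -
  have "C_k k (\<lambda>x. \<Prod>i\<in>UNIV. bump 0 (m * x $ i + (- m * a $ i)) * bump 0 ((-m) * x $ i + m * b $ i))"
    by (intro C_k_prod C_k_mult C_k_bump) auto
  then show ?thesis by (simp add: box_bump_def[abs_def] algebra_simps)
qed

lemma box_bump_bounds: "0 \<le> box_bump a b m x" "box_bump a b m x \<le> 1"
  unfolding box_bump_def using bump_bounds
  by (auto intro!: prod_nonneg prod_le_1 mult_le_one mult_nonneg_nonneg)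

lemma box_bump_zero:
  assumes "0 < m" "x \<notin> box a b" shows "box_bump a b m x = 0"
proof -
  obtain i where "\<not> (a $ i < x $ i \<and> x $ i < b $ i)" using assms(2) by (auto simp: mem_box_cart)
  then have "bump 0 (m * (x $ i - a $ i)) * bump 0 (m * (b $ i - x $ i)) = 0"
    using assms(1) by (auto simp: bump_def zero_less_mult_iff)
  then show ?thesis unfolding box_bump_def by (intro prod_zero) auto
qed

lemma box_bump_tendsto: "(\<lambda>m. box_bump a b (real (Suc m)) x) \<longlonglongrightarrow> indicator (box a b) x"
proof (cases "x \<in> box a b")
  case True
  have lim: "(\<lambda>m. bump 0 (real (Suc m) * t)) \<longlonglongrightarrow> 1" if "0 < t" for t
  proof -
    have "(\<lambda>m. exp (- (inverse (real (Suc m)) * inverse t))) \<longlonglongrightarrow> exp (- (0 * inverse t))"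
      by (intro tendsto_intros LIMSEQ_inverse_real_of_nat)
    moreover have "bump 0 (real (Suc m) * t) = exp (- (inverse (real (Suc m)) * inverse t))" for m
      using that by (simp add: bump_def)
    ultimately show ?thesis by simp
  qed
  have "(\<lambda>m. box_bump a b (real (Suc m)) x) \<longlonglongrightarrow> (\<Prod>i\<in>(UNIV::'a set). 1 * 1)"
    unfolding box_bump_def using True
    by (intro tendsto_prod tendsto_mult lim) (auto simp: mem_box_cart)
  then show ?thesis using True by simp
next
  case False
  then show ?thesis by (simp add: box_bump_zero del: of_nat_Suc)
qed

lemma box_bump_test_function:
  assumes "cbox a b \<subseteq> \<Omega>" "0 < m"
  shows "box_bump a b m \<in> test_functions \<Omega>"
proof -
  have "{x. box_bump a b m x \<noteq> 0} \<subseteq> cbox a b"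
    using box_bump_zero[OF assms(2)] box_subset_cbox by blast
  then have "closure {x. box_bump a b m x \<noteq> 0} \<subseteq> cbox a b" by (intro closure_minimal) auto
  then show ?thesis using assms C_k_box_bump
    by (auto simp: test_functions_def compact_eq_bounded_closed bounded_subset[OF bounded_cbox])
qed

text \<open>Open boxes are stable under intersection and generate the Borel sets, so vanishing
  integrals spread to all of these by Dynkin's theorem. Complements need the total integral to
  vanish, which follows by exhausting the space with boxes.\<close>

lemma AE_zero_if_box_integrals_zero:
  fixes F :: "'a::euclidean_space \<Rightarrow> real"
  assumes F: "integrable lborel F" and box: "\<And>a b. (LINT x:box a b|lborel. F x) = 0"
  shows "AE x in lborel. F x = 0"
proof (rule sigma_finite_measure.density_zero[OF sigma_finite_lborel F])
  have set_int: "set_integrable lborel A F" if "A \<in> sets borel" for A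
    using integrable_mult_indicator[of A lborel F] F that by (simp add: set_integrable_def)
  have total: "(LINT x:UNIV|lborel. F x) = 0"
  proof -
    have "(\<lambda>n. LINT x:box (- (real n *\<^sub>R One)) (real n *\<^sub>R One)|lborel. F x)
        \<longlonglongrightarrow> (LINT x:(\<Union>n. box (- (real n *\<^sub>R One)) (real n *\<^sub>R One))|lborel. F x)"
    proof (rule set_integral_cont_up)
      show "incseq (\<lambda>n. box (- (real n *\<^sub>R One)) (real n *\<^sub>R One) :: 'a set)"
        by (rule incseq_SucI) (auto simp: box_def algebra_simps add_increasing)
    qed (use set_int in auto)
    then show ?thesis by (simp add: box UN_box_eq_UNIV LIMSEQ_const_iff)
  qed
  fix A :: "'a set" assume "A \<in> sets lborel"
  then have A: "A \<in> sigma_sets UNIV (range (\<lambda>(a, b). box a b :: 'a set))"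
    by (simp add: borel_eq_box)
  have "Int_stable (range (\<lambda>(a, b). box a b :: 'a set))"
    "range (\<lambda>(a, b). box a b :: 'a set) \<subseteq> Pow UNIV"
    by (auto simp: Int_stable_def box_Int_box)
  then show "(LINT x:A|lborel. F x) = 0"
    using A
  proof (induction rule: sigma_sets_induct_disjoint)
    case basic
    then show ?case by (auto simp: box)
  next
    case empty
    then show ?case by (simp add: set_lebesgue_integral_def)
  next
    case (compl A)
    then have A: "A \<in> sets borel" by (simp add: borel_eq_box)
    have "(LINT x:A \<union> (UNIV - A)|lborel. F x) = (LINT x:A|lborel. F x) + (LINT x:UNIV - A|lborel. F x)"
      using A by (intro set_integral_Un set_int) auto
    then show ?case using compl total by simp
  next
    case (union A)
    then have A: "A i \<in> sets lborel" for i by (auto simp: borel_eq_box)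
    have "(LINT x:(\<Union>i. A i)|lborel. F x) = (\<Sum>i. LINT x:A i|lborel. F x)"
      using A union.hyps(1)
      by (intro lebesgue_integral_countable_add set_int) (auto simp: disjoint_family_on_def)
    then show ?case using union by simp
  qed
qed

section \<open>Test functions determine integrable functions\<close>

lemma test_functions_bounded_measurable:
  assumes "\<phi> \<in> test_functions \<Omega>"
  shows "continuous_on UNIV \<phi>" "\<phi> \<in> borel_measurable lebesgue" "\<exists>B. \<forall>x. \<bar>\<phi> x\<bar> \<le> B"
proof -
  show cont: "continuous_on UNIV \<phi>"
    using assms C_k_continuous by (auto simp: test_functions_def)
  then show "\<phi> \<in> borel_measurable lebesgue"
    by (intro measurable_completion) (simp add: borel_measurable_continuous_onI)
  have "compact (closure {x. \<phi> x \<noteq> 0})" using assms by (simp add: test_functions_def)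
  then have "bounded (\<phi> ` closure {x. \<phi> x \<noteq> 0})"
    using cont by (intro compact_imp_bounded compact_continuous_image) (auto intro: continuous_on_subset)
  then obtain B where B: "B > 0" "\<And>x. x \<in> closure {x. \<phi> x \<noteq> 0} \<Longrightarrow> \<bar>\<phi> x\<bar> \<le> B"
    by (auto simp: bounded_pos)
  then have "\<bar>\<phi> x\<bar> \<le> B" for x
    using closure_subset[of "{x. \<phi> x \<noteq> 0}"] by (cases "\<phi> x = 0") auto
  then show "\<exists>B. \<forall>x. \<bar>\<phi> x\<bar> \<le> B" by blast
qed

text \<open>Instead of mollification, smooth bumps converge boundedly to the indicator of a box, so
  the integral vanishes over every box whose closed version lies in the domain. This settles each
  such box, and countably many of them cover the domain.\<close>

theorem fundamental_lemma_calculus_of_variations: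
  fixes g :: "real ^ 'n::finite \<Rightarrow> real"
  assumes \<Omega>: "open \<Omega>" and g: "integrable (lebesgue_on \<Omega>) g"
    and test: "\<And>\<phi>. \<phi> \<in> test_functions \<Omega> \<Longrightarrow> (LINT x|lebesgue_on \<Omega>. g x * \<phi> x) = 0"
  shows "AE x in lebesgue_on \<Omega>. g x = 0"
proof -
  have \<Omega>s: "\<Omega> \<in> sets lebesgue" using \<Omega> by (simp add: lmeasurable_open)
  define G where "G = (\<lambda>x. if x \<in> \<Omega> then g x else 0)"
  have G: "integrable lebesgue G" using g \<Omega>s by (simp add: G_def Lebesgue_Measure.integrable_restrict_UNIV)
  \<comment> \<open>\<open>g\<close> is only Lebesgue measurable, whereas the criterion by boxes is
    about \<open>lborel\<close>; hence a Borel representative.\<close>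
  obtain H where H: "H \<in> borel_measurable lborel" "AE x in lborel. G x = H x"
    using completion_ex_borel_measurable_real[OF borel_measurable_integrable[OF G]] by blast
  have GH: "AE x in lebesgue. G x = H x" using H(2) by (rule AE_completion)
  have H_int: "integrable lborel H"
  proof -
    have "integrable lebesgue H"
      using G GH H(1) by (subst integrable_cong_AE[of _ _ G]) (auto simp: measurable_completion)
    then show ?thesis using H(1) by (simp add: integrable_completion)
  qed
  have box: "(LINT x:box a b|lborel. H x) = 0" if ab: "cbox a b \<subseteq> \<Omega>" for a b
  proof -
    have lim: "(\<lambda>m. LINT x|lborel. H x * box_bump a b (real (Suc m)) x)
        \<longlonglongrightarrow> (LINT x|lborel. H x * indicator (box a b) x)"
    proof (rule integral_dominated_convergence[where w = "\<lambda>x. \<bar>H x\<bar>"])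
      show "AE x in lborel. (\<lambda>m. H x * box_bump a b (real (Suc m)) x) \<longlonglongrightarrow> H x * indicator (box a b) x"
        by (intro AE_I2 tendsto_mult tendsto_const box_bump_tendsto)
      show "AE x in lborel. norm (H x * box_bump a b (real (Suc m)) x) \<le> \<bar>H x\<bar>" for m
        using box_bump_bounds[of a b "real (Suc m)"]
        by (intro AE_I2) (auto simp: abs_mult simp del: of_nat_Suc intro: mult_left_le)
      show "(\<lambda>x. H x * box_bump a b (real (Suc m)) x) \<in> borel_measurable lborel" for m
        using H(1) borel_measurable_continuous_onI[OF C_k_continuous[OF C_k_box_bump[of 0]]]
        by measurable
    qed (use H H_int in auto)
    have "(LINT x|lborel. H x * box_bump a b (real (Suc m)) x) = 0" for m
    proof -
      have meas: "box_bump a b (real (Suc m)) \<in> borel_measurable lborel"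
        using borel_measurable_continuous_onI[OF C_k_continuous[OF C_k_box_bump[of 0]]] by simp
      have "(LINT x|lborel. H x * box_bump a b (real (Suc m)) x)
          = (LINT x|lebesgue. H x * box_bump a b (real (Suc m)) x)"
        using H(1) meas by (intro integral_completion[symmetric]) auto
      also have "\<dots> = (LINT x|lebesgue. G x * box_bump a b (real (Suc m)) x)"
        using GH G measurable_completion[OF H(1)] measurable_completion[OF meas]
        by (intro integral_cong_AE) auto
      also have "\<dots> = (LINT x|lebesgue. (if x \<in> \<Omega> then g x * box_bump a b (real (Suc m)) x else 0))"
        by (rule Bochner_Integration.integral_cong) (auto simp: G_def)
      also have "\<dots> = (LINT x|lebesgue_on \<Omega>. g x * box_bump a b (real (Suc m)) x)"
        by (rule Lebesgue_Measure.integral_restrict_UNIV[OF \<Omega>s])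
      also have "\<dots> = 0" by (rule test[OF box_bump_test_function[OF ab]]) simp
      finally show ?thesis .
    qed
    then show ?thesis
      using lim by (simp add: set_lebesgue_integral_def LIMSEQ_const_iff mult.commute)
  qed
  have local: "AE x in lborel. x \<in> box a b \<longrightarrow> H x = 0" if ab: "cbox a b \<subseteq> \<Omega>" for a b
  proof -
    have "AE x in lborel. indicator (box a b) x * H x = 0"
    proof (rule AE_zero_if_box_integrals_zero)
      show "integrable lborel (\<lambda>x. indicat_real (box a b) x * H x)"
        using integrable_mult_indicator[OF _ H_int, of "box a b"] by simp
      fix c d :: "real ^ 'n"
      obtain c' d' where cd: "box a b \<inter> box c d = box c' d'" by (simp add: box_Int_box)
      show "(LINT x:box c d|lborel. indicat_real (box a b) x * H x) = 0"
      \<comment> \<open>Only for a nonempty open box is the closed box with the same corners its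
        closure; for an empty one the closed box could leave the domain.\<close>
      proof (cases "box c' d' = {}")
        case True
        then have "(\<lambda>x. indicat_real (box c d) x *\<^sub>R (indicat_real (box a b) x * H x)) = (\<lambda>_. 0)"
          using cd by (intro ext) (simp add: indicator_def, blast)
        then show ?thesis unfolding set_lebesgue_integral_def by simp
      next
        case False
        have "cbox c' d' = closure (box c' d')" by (rule closure_box[OF False, symmetric])
        also have "\<dots> \<subseteq> closure (cbox a b)" using cd box_subset_cbox by (intro closure_mono) blast
        finally have "cbox c' d' \<subseteq> \<Omega>" using ab by simp
        then have "(LINT x:box c' d'|lborel. H x) = 0" by (rule box)
        then show ?thesis
          unfolding cd[symmetric] set_lebesgue_integral_def
          by (simp add: indicator_inter_arith mult_ac)
      qed
    qed
    then show ?thesis by eventually_elim (auto simp: indicator_def split: if_splits)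
  qed
  define \<B> where "\<B> = {box a b |a b. cbox a b \<subseteq> \<Omega>}"
  obtain \<D> where \<D>: "\<D> \<subseteq> \<B>" "countable \<D>" "\<Union>\<D> = \<Union>\<B>"
    using Lindelof[of \<B>] by (auto simp: \<B>_def open_box)
  have "\<Omega> \<subseteq> \<Union>\<B>"
  proof
    fix x assume "x \<in> \<Omega>"
    then obtain a b where "x \<in> box a b" "cbox a b \<subseteq> \<Omega>"
      using open_contains_cbox[OF \<Omega>] by metis
    then show "x \<in> \<Union>\<B>" by (auto simp: \<B>_def)
  qed
  moreover have "AE x in lborel. \<forall>X\<in>\<D>. x \<in> X \<longrightarrow> H x = 0"
    using \<D>(1) by (subst AE_ball_countable[OF \<D>(2)]) (auto simp: \<B>_def intro: local)
  ultimately have "AE x in lborel. x \<in> \<Omega> \<longrightarrow> H x = 0"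
    using \<D>(3) by (auto elim!: eventually_mono)
  then have "AE x in lebesgue. x \<in> \<Omega> \<longrightarrow> H x = 0" by (rule AE_completion)
  with GH have "AE x in lebesgue. x \<in> \<Omega> \<longrightarrow> g x = 0"
    by eventually_elim (auto simp: G_def)
  then show ?thesis using \<Omega>s by (simp add: AE_restrict_space_iff)
qed

section \<open>Piecewise polynomials are weakly differentiable\<close>

lemma C_k_nth: "C_k k (\<lambda>x. x $ i)"
proof (cases k)
  case 0
  then show ?thesis by (auto intro!: continuous_intros)
next
  case (Suc k')
  have der: "((\<lambda>x. x $ i) has_derivative (\<lambda>v. v $ i)) (at x)" for x :: "real ^ 'a"
    by (intro bounded_linear_imp_has_derivative bounded_linear_vec_nth)
  have "partial j (\<lambda>x. x $ i) = (\<lambda>x. axis j 1 $ i)" for j :: 'a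
    by (rule ext) (rule partial_eqI[OF der])
  then show ?thesis using Suc der by (auto simp: differentiable_def C_k_const)
qed

lemma C_k_power: "C_k k f \<Longrightarrow> C_k k (\<lambda>x. f x ^ m)"
  by (induction m) (auto intro: C_k_const C_k_mult)

lemma C_k_sum: "(\<And>i. i \<in> I \<Longrightarrow> C_k k (f i)) \<Longrightarrow> C_k k (\<lambda>x. \<Sum>i\<in>I. f i x)"
  by (induction I rule: infinite_finite_induct) (auto intro: C_k_const C_k_add)

lemma polynomial_deg_le_C_k: "polynomial_deg_le p P \<Longrightarrow> C_k k P"
proof -
  assume "polynomial_deg_le p P"
  then obtain c where "P = (\<lambda>x. \<Sum>\<alpha> | (\<Sum>i\<in>UNIV. \<alpha> i) \<le> p. c \<alpha> * (\<Prod>i\<in>UNIV. (x $ i) ^ \<alpha> i))"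
    unfolding polynomial_deg_le_def by blast
  then show ?thesis by (auto intro!: C_k_sum C_k_mult C_k_const C_k_prod C_k_power C_k_nth)
qed

lemma C_1D:
  assumes "C_k 1 f"
  shows "f differentiable (at x)" "continuous_on A (partial i f)" "continuous_on A f"
proof -
  show "f differentiable (at x)" using assms by simp
  show "continuous_on A (partial i f)" using assms by (auto intro: continuous_on_subset)
  show "continuous_on A f" using C_k_continuous[OF assms] by (auto intro: continuous_on_subset)
qed

lemma frechet_derivative_eq_sum_partial:
  assumes "f differentiable (at x)"
  shows "frechet_derivative f (at x) v = (\<Sum>i\<in>UNIV. v $ i * partial i f x)"
proof -
  have lin: "linear (frechet_derivative f (at x))" by (rule linear_frechet_derivative[OF assms])
  have "frechet_derivative f (at x) v = frechet_derivative f (at x) (\<Sum>i\<in>UNIV. v $ i *\<^sub>R axis i 1)"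
    by (simp add: basis_expansion scalar_mult_eq_scaleR[symmetric])
  also have "\<dots> = (\<Sum>i\<in>UNIV. v $ i * partial i f x)"
    by (simp add: linear_sum[OF lin] linear_scale[OF lin] partial_def)
  finally show ?thesis .
qed

lemma C_1_lipschitz:
  fixes f :: "real ^ 'n::finite \<Rightarrow> real"
  assumes f: "C_k 1 f" and K: "compact K" "convex K"
  obtains L where "L-lipschitz_on K f"
proof -
  have "continuous_on K (\<lambda>x. \<Sum>i\<in>UNIV. \<bar>partial i f x\<bar>)"
    by (intro continuous_intros C_1D[OF f])
  then have "bounded ((\<lambda>x. \<Sum>i\<in>UNIV. \<bar>partial i f x\<bar>) ` K)"
    using K compact_continuous_image compact_imp_bounded by blast
  then obtain B where B: "B > 0" "\<And>x. x \<in> K \<Longrightarrow> \<bar>\<Sum>i\<in>UNIV. \<bar>partial i f x\<bar>\<bar> \<le> B"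
    by (auto simp: bounded_pos)
  have "norm (f x - f y) \<le> B * norm (x - y)" if "x \<in> K" "y \<in> K" for x y
  proof (rule differentiable_bound[OF K(2)])
    fix x assume x: "x \<in> K"
    show "(f has_derivative frechet_derivative f (at x)) (at x within K)"
      using C_1D(1)[OF f] frechet_derivative_works has_derivative_at_withinI by blast
    show "onorm (frechet_derivative f (at x)) \<le> B"
    proof (rule onorm_le)
      fix v
      have "norm (frechet_derivative f (at x) v) \<le> (\<Sum>i\<in>UNIV. norm v * \<bar>partial i f x\<bar>)"
        unfolding frechet_derivative_eq_sum_partial[OF C_1D(1)[OF f]] real_norm_def
        by (rule order_trans[OF sum_abs])
          (auto intro!: sum_mono mult_right_mono simp: abs_mult component_le_norm_cart)
      also have "\<dots> = norm v * (\<Sum>i\<in>UNIV. \<bar>partial i f x\<bar>)" by (simp add: sum_distrib_left)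
      also have "\<dots> \<le> norm v * B" using B(2)[OF x] by (intro mult_left_mono) auto
      finally show "norm (frechet_derivative f (at x) v) \<le> B * norm v" by (simp add: mult.commute)
    qed
  qed (use that in auto)
  then have "B-lipschitz_on K f" using B(1) by (auto intro!: lipschitz_onI simp: dist_norm)
  then show thesis by (rule that)
qed

text \<open>On the segment from \<open>x\<close> to \<open>y\<close> the pieces become a finite
  closed cover of the unit interval, where their Lipschitz bounds combine. The pieces may be
  non-convex, such as the complement of the domain.\<close>

lemma lipschitz_on_finite_closed_cover:
  fixes f :: "'a::real_normed_vector \<Rightarrow> 'b::metric_space"
  assumes lip: "\<And>A. A \<in> \<A> \<Longrightarrow> L-lipschitz_on A f" and closed: "\<And>A. A \<in> \<A> \<Longrightarrow> closed A"
    and fin: "finite \<A>" and cover: "\<Union>\<A> = UNIV" and L: "0 \<le> L"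
  shows "L-lipschitz_on UNIV f"
proof (rule lipschitz_onI)
  fix x y :: 'a
  define \<gamma> where "\<gamma> s = x + s *\<^sub>R (y - x)" for s :: real
  have \<gamma>: "dist (\<gamma> s) (\<gamma> t) = dist s t * dist x y" for s t
  proof -
    have "\<gamma> s - \<gamma> t = (s - t) *\<^sub>R (y - x)" by (simp add: \<gamma>_def algebra_simps)
    then show ?thesis by (simp add: dist_norm norm_minus_commute)
  qed
  have "(L * dist x y)-lipschitz_on {0..1} (f \<circ> \<gamma>)"
  proof (rule lipschitz_on_closed_Union[of \<A> "L * dist x y" "\<lambda>A. \<gamma> -` A"])
    show "(L * dist x y)-lipschitz_on (\<gamma> -` A) (f \<circ> \<gamma>)" if "A \<in> \<A>" for A
    proof (rule lipschitz_onI)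
      show "dist ((f \<circ> \<gamma>) s) ((f \<circ> \<gamma>) t) \<le> L * dist x y * dist s t"
        if "s \<in> \<gamma> -` A" "t \<in> \<gamma> -` A" for s t
        using lipschitz_onD[OF lip[OF \<open>A \<in> \<A>\<close>], of "\<gamma> s" "\<gamma> t"] that by (simp add: \<gamma> mult_ac)
    qed (use L in simp)
    show "closed (\<gamma> -` A)" if "A \<in> \<A>" for A
      using closed[OF that] unfolding \<gamma>_def[abs_def]
      by (intro continuous_closed_vimage) (auto intro!: continuous_intros)
  qed (use fin cover L in auto)
  from lipschitz_onD[OF this, of 0 1]
  show "dist (f x) (f y) \<le> L * dist x y" by (simp add: \<gamma>_def)
qed (use L in auto)

section \<open>Bounded functions, translations and difference quotients\<close>

lemma bounded_l2_space:
  assumes \<Omega>: "\<Omega> \<in> lmeasurable" and f: "f \<in> borel_measurable (lebesgue_on \<Omega>)" and B: "bounded (f ` \<Omega>)"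
  shows "f \<in> l2_space (lebesgue_on \<Omega>)"
proof -
  obtain C where C: "\<And>x. x \<in> \<Omega> \<Longrightarrow> norm (f x) \<le> C" using B by (auto simp: bounded_iff)
  have "integrable (lebesgue_on \<Omega>) (\<lambda>x. (norm (f x))\<^sup>2)"
    using C f by (intro finite_measure.integrable_const_bound[OF finite_measure_lebesgue_on[OF \<Omega>], of _ "C\<^sup>2"])
      (auto intro!: AE_I2 power_mono)
  then show ?thesis using f by (simp add: l2_space_def)
qed

lemma bounded_integrable:
  fixes f :: "'a::euclidean_space \<Rightarrow> real"
  assumes "\<Omega> \<in> lmeasurable" "f \<in> borel_measurable (lebesgue_on \<Omega>)" "bounded (f ` \<Omega>)"
  shows "integrable (lebesgue_on \<Omega>) f"
proof -
  obtain C where "\<And>x. x \<in> \<Omega> \<Longrightarrow> norm (f x) \<le> C" using assms(3) by (auto simp: bounded_iff)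
  then show ?thesis
    using assms(2) by (intro finite_measure.integrable_const_bound[OF finite_measure_lebesgue_on[OF assms(1)], of _ C])
      (auto intro!: AE_I2)
qed

lemma integral_translate_lborel:
  fixes f :: "'a::euclidean_space \<Rightarrow> real"
  assumes "f \<in> borel_measurable borel"
  shows "(LINT x|lborel. f (x + c)) = (LINT x|lborel. f x)"
    and "integrable lborel f \<Longrightarrow> integrable lborel (\<lambda>x. f (x + c))"
proof -
  have "(LINT x|lborel. f x) = (LINT x|distr lborel borel ((+) c). f x)"
    by (simp add: lborel_distr_plus)
  also have "\<dots> = (LINT x|lborel. f (c + x))" using assms by (intro integral_distr) auto
  finally show "(LINT x|lborel. f (x + c)) = (LINT x|lborel. f x)" by (simp add: add.commute)
  assume "integrable lborel f"
  then have "integrable (distr lborel borel ((+) c)) f" by (simp add: lborel_distr_plus)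
  then have "integrable lborel (\<lambda>x. f (c + x))" using assms by (subst (asm) integrable_distr_eq) auto
  then show "integrable lborel (\<lambda>x. f (x + c))" by (simp add: add.commute)
qed

lemma difference_quotient_tendsto_partial:
  fixes f :: "real ^ 'n::finite \<Rightarrow> real"
  assumes "f differentiable (at x)"
  shows "(\<lambda>n. (f (x + inverse (real (Suc n)) *\<^sub>R axis i 1) - f x) / inverse (real (Suc n)))
    \<longlonglongrightarrow> partial i f x"
proof -
  have der: "(f has_derivative frechet_derivative f (at x)) (at x)"
    using assms frechet_derivative_works by blast
  have "((\<lambda>t::real. x + t *\<^sub>R axis i 1) has_derivative (\<lambda>t. t *\<^sub>R axis i 1)) (at 0)"
    by (auto intro!: derivative_eq_intros)
  from has_derivative_compose[OF this, of f "frechet_derivative f (at x)"] der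
  have "((\<lambda>t. f (x + t *\<^sub>R axis i 1)) has_derivative (\<lambda>t. t * partial i f x)) (at 0)"
    by (simp add: partial_def linear_scale[OF linear_frechet_derivative[OF assms]])
  then have "((\<lambda>t. f (x + t *\<^sub>R axis i 1)) has_real_derivative partial i f x) (at 0)"
    by (simp add: has_field_derivative_def mult_commute_abs)
  then have "((\<lambda>t. (f (x + t *\<^sub>R axis i 1) - f x) / t) \<longlongrightarrow> partial i f x) (at 0)"
    by (simp add: has_field_derivative_iff)
  moreover have "filterlim (\<lambda>n. inverse (real (Suc n))) (at 0) sequentially"
    using LIMSEQ_inverse_real_of_nat by (auto simp: filterlim_at)
  ultimately show ?thesis by (rule filterlim_compose)
qed

lemma integrable_cball_indicator:
  "integrable lborel (\<lambda>x::'a::euclidean_space. c * indicator (cball 0 R) x :: real)"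
  using emeasure_bounded_finite[OF bounded_cball[of "0::'a" R]]
  by (intro integrable_mult_right integrable_real_indicator) auto

locale bounded_open_set =
  fixes \<Omega> :: "(real ^ 'n::finite) set"
  assumes open_domain: "open \<Omega>" and bounded_domain: "bounded \<Omega>"
begin

lemma domain_lmeasurable: "\<Omega> \<in> lmeasurable"
  using open_domain bounded_domain by (rule lmeasurable_open[rotated])

lemma domain_sets: "\<Omega> \<in> sets lebesgue"
  using domain_lmeasurable by (rule fmeasurableD)

lemma compact_closure_domain: "compact (closure \<Omega>)"
  using bounded_domain by (simp add: compact_closure)

lemma continuous_measurable_bounded:
  fixes f :: "real ^ 'n \<Rightarrow> 'b::euclidean_space"
  assumes "continuous_on (closure \<Omega>) f"
  shows "f \<in> borel_measurable (lebesgue_on \<Omega>)" "bounded (f ` \<Omega>)"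
proof -
  show "f \<in> borel_measurable (lebesgue_on \<Omega>)"
    using continuous_on_subset[OF assms closure_subset] domain_sets
    by (rule continuous_imp_measurable_on_sets_lebesgue)
  have "bounded (f ` closure \<Omega>)"
    using assms compact_closure_domain compact_continuous_image compact_imp_bounded by blast
  then show "bounded (f ` \<Omega>)" by (rule bounded_subset) (use closure_subset in blast)
qed

lemma continuous_l2_space:
  fixes f :: "real ^ 'n \<Rightarrow> 'b::euclidean_space"
  shows "continuous_on (closure \<Omega>) f \<Longrightarrow> f \<in> l2_space (lebesgue_on \<Omega>)"
  using bounded_l2_space[OF domain_lmeasurable] continuous_measurable_bounded by blast

lemma continuous_integrable:
  fixes f :: "real ^ 'n \<Rightarrow> real"
  shows "continuous_on (closure \<Omega>) f \<Longrightarrow> integrable (lebesgue_on \<Omega>) f"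
  using bounded_integrable[OF domain_lmeasurable] continuous_measurable_bounded by blast

end

section \<open>The mesh and its element interiors\<close>

locale polyhedral_mesh =
  fixes \<Omega> :: "(real ^ 'n::finite) set" and \<T> :: "(real ^ 'n) set set"
  assumes domain: "polyhedral_domain \<Omega>" and mesh: "simplicial_mesh \<Omega> \<T>"
begin

sublocale bounded_open_set \<Omega>
  using domain by unfold_locales (auto simp: polyhedral_domain_def)

lemma interior_closure_domain: "interior (closure \<Omega>) = \<Omega>"
  using domain by (auto simp: polyhedral_domain_def)

lemma finite_mesh: "finite \<T>" and mesh_cover: "\<Union>\<T> = closure \<Omega>"
  using mesh by (auto simp: simplicial_mesh_def triangulation_def)

lemma mesh_compact: "K \<in> \<T> \<Longrightarrow> compact K" and mesh_convex: "K \<in> \<T> \<Longrightarrow> convex K"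
  using mesh compact_simplex convex_simplex unfolding simplicial_mesh_def by blast+

text \<open>The intersection is a face of both elements, and a face other than the element itself
  misses its interior.\<close>

lemma mesh_interior_disjoint:
  assumes "K \<in> \<T>" "K' \<in> \<T>" "x \<in> interior K" "x \<in> interior K'"
  shows "K = K'"
proof -
  have f: "K \<inter> K' face_of K" "K \<inter> K' face_of K'"
    using mesh assms(1,2) unfolding simplicial_mesh_def triangulation_def
    by (blast, metis Int_commute)
  have x: "x \<in> K \<inter> K'" using assms interior_subset by blast
  show ?thesis
    using face_of_disjoint_interior[OF f(1)] face_of_disjoint_interior[OF f(2)] x assms(3,4) by blast
qed

lemma mesh_interior_subset: "K \<in> \<T> \<Longrightarrow> interior K \<subseteq> \<Omega>"
  using interior_mono[of K "closure \<Omega>"] mesh_cover interior_closure_domain by auto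

text \<open>Elements are convex, so their frontiers are null. Since the closure of the domain is
  covered, the frontier of the domain is discarded too, and almost every point has a neighbourhood
  inside one element or outside the closure.\<close>

lemma AE_mesh_interior: "AE x in lborel. x \<in> closure \<Omega> \<longrightarrow> (\<exists>K\<in>\<T>. x \<in> interior K)"
proof -
  have "(\<Union>K\<in>\<T>. frontier K) \<in> null_sets lebesgue"
    using negligible_convex_frontier mesh_convex finite_mesh
    by (intro null_sets.finite_UN) (auto simp: negligible_iff_null_sets)
  moreover have "(\<Union>K\<in>\<T>. frontier K) \<in> sets lborel"
    using finite_mesh by (intro sets.finite_UN) auto
  ultimately have "(\<Union>K\<in>\<T>. frontier K) \<in> null_sets lborel"
    by (simp add: null_sets_completion_iff)
  moreover have "{x. \<not> (x \<in> closure \<Omega> \<longrightarrow> (\<exists>K\<in>\<T>. x \<in> interior K))} \<subseteq> (\<Union>K\<in>\<T>. frontier K)"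
  proof
    fix x assume "x \<in> {x. \<not> (x \<in> closure \<Omega> \<longrightarrow> (\<exists>K\<in>\<T>. x \<in> interior K))}"
    then obtain K where "K \<in> \<T>" "x \<in> K" "x \<notin> interior K" using mesh_cover by blast
    then show "x \<in> (\<Union>K\<in>\<T>. frontier K)" using closure_subset[of K] by (auto simp: frontier_def)
  qed
  ultimately show ?thesis by (intro AE_I') auto
qed

context
  fixes v :: "real ^ 'n \<Rightarrow> real" and P :: "(real ^ 'n) set \<Rightarrow> real ^ 'n \<Rightarrow> real"
  assumes cont: "continuous_on (closure \<Omega>) v"
    and C1: "\<And>K. K \<in> \<T> \<Longrightarrow> C_k 1 (P K)" and P: "\<And>K x. K \<in> \<T> \<Longrightarrow> x \<in> K \<Longrightarrow> v x = P K x"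
begin

text \<open>Zero on the element frontiers, a null set; the sum of indicators makes measurability and
  boundedness termwise.\<close>

definition piecewise_partial :: "'n \<Rightarrow> real ^ 'n \<Rightarrow> real" where
  "piecewise_partial i x = (\<Sum>K\<in>\<T>. indicator (interior K) x * partial i (P K) x)"

lemma piecewise_partial_eq:
  assumes "K \<in> \<T>" "x \<in> interior K"
  shows "piecewise_partial i x = partial i (P K) x"
proof -
  have "piecewise_partial i x = (\<Sum>K'\<in>\<T>. if K' = K then partial i (P K) x else 0)"
    unfolding piecewise_partial_def
  proof (rule sum.cong[OF refl])
    fix K' assume "K' \<in> \<T>"
    then show "indicator (interior K') x * partial i (P K') x = (if K' = K then partial i (P K) x else 0)"
      using assms mesh_interior_disjoint[of K K' x] by (cases "x \<in> interior K'") auto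
  qed
  then show ?thesis using assms finite_mesh by simp
qed

lemma piecewise_partial_borel: "piecewise_partial i \<in> borel_measurable borel"
proof -
  have "partial i (P K) \<in> borel_measurable borel" if "K \<in> \<T>" for K
    by (rule borel_measurable_continuous_onI[OF C_1D(2)[OF C1[OF that]]])
  then show ?thesis
    unfolding piecewise_partial_def
    by (intro borel_measurable_sum borel_measurable_times borel_measurable_indicator) auto
qed

lemma piecewise_partial_bounded: "bounded (piecewise_partial i ` \<Omega>)"
proof -
  have "\<exists>B. \<forall>x\<in>closure \<Omega>. \<bar>partial i (P K) x\<bar> \<le> B" if "K \<in> \<T>" for K
    using compact_imp_bounded[OF compact_continuous_image[OF C_1D(2)[OF C1[OF that]] compact_closure_domain]]
    by (auto simp: bounded_iff)
  then obtain B where B: "\<And>K x. K \<in> \<T> \<Longrightarrow> x \<in> closure \<Omega> \<Longrightarrow> \<bar>partial i (P K) x\<bar> \<le> B K" by metis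
  have "\<bar>piecewise_partial i x\<bar> \<le> (\<Sum>K\<in>\<T>. \<bar>B K\<bar>)" if x: "x \<in> \<Omega>" for x
    unfolding piecewise_partial_def
  proof (rule order_trans[OF sum_abs sum_mono])
    fix K assume K: "K \<in> \<T>"
    have "\<bar>partial i (P K) x\<bar> \<le> \<bar>B K\<bar>"
      by (rule order_trans[OF B[OF K subsetD[OF closure_subset x]] abs_ge_self])
    then show "\<bar>indicator (interior K) x * partial i (P K) x\<bar> \<le> \<bar>B K\<bar>"
      by (cases "x \<in> interior K") auto
  qed
  then show ?thesis by (auto simp: bounded_iff)
qed

lemma piecewise_partial_l2: "piecewise_partial i \<in> l2_space (lebesgue_on \<Omega>)"
proof (rule bounded_l2_space[OF domain_lmeasurable _ piecewise_partial_bounded])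
  show "piecewise_partial i \<in> borel_measurable (lebesgue_on \<Omega>)"
    using piecewise_partial_borel by (intro measurable_restrict_space1 measurable_completion) simp
qed

section \<open>Integration by parts against a test function\<close>

context
  fixes \<phi> :: "real ^ 'n \<Rightarrow> real"
  assumes \<phi>: "\<phi> \<in> test_functions \<Omega>"
begin

lemma test_C1: "C_k 1 \<phi>"
  using \<phi> unfolding test_functions_def by blast

lemma test_zero: "x \<notin> \<Omega> \<Longrightarrow> \<phi> x = 0"
  using \<phi> closure_subset[of "{x. \<phi> x \<noteq> 0}"] by (auto simp: test_functions_def)

lemma product_C1: "K \<in> \<T> \<Longrightarrow> C_k 1 (\<lambda>x. P K x * \<phi> x)"
  by (rule C_k_mult[OF C1 test_C1])

definition cutoff :: "real ^ 'n \<Rightarrow> real" where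
  "cutoff x = (if x \<in> \<Omega> then v x * \<phi> x else 0)"

lemma cutoff_eq: "K \<in> \<T> \<Longrightarrow> x \<in> K \<Longrightarrow> cutoff x = P K x * \<phi> x"
  using P[of K x] test_zero[of x] by (simp add: cutoff_def)

text \<open>Each element carries a continuously differentiable function and the complement of the
  domain carries zero; these finitely many closed sets cover the space. The resulting constant later
  dominates the difference quotients.\<close>

lemma cutoff_lipschitz: "\<exists>L\<ge>0. L-lipschitz_on UNIV cutoff"
proof -
  have "\<exists>L. L-lipschitz_on K (\<lambda>x. P K x * \<phi> x)" if "K \<in> \<T>" for K
    using C_1_lipschitz[OF product_C1[OF that] mesh_compact[OF that] mesh_convex[OF that]] by blast
  then obtain L where L: "\<And>K. K \<in> \<T> \<Longrightarrow> (L K)-lipschitz_on K (\<lambda>x. P K x * \<phi> x)" by metis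
  define L0 where "L0 = (\<Sum>K\<in>\<T>. \<bar>L K\<bar>)"
  have L0: "0 \<le> L0" by (simp add: L0_def sum_nonneg)
  have L_le: "L K \<le> L0" if "K \<in> \<T>" for K
    unfolding L0_def
    by (rule order_trans[OF abs_ge_self]) (rule member_le_sum[OF that _ finite_mesh], simp)
  have "L0-lipschitz_on UNIV cutoff"
  proof (rule lipschitz_on_finite_closed_cover[of "insert (- \<Omega>) \<T>"])
    show "\<Union>(insert (- \<Omega>) \<T>) = UNIV" using mesh_cover closure_subset[of \<Omega>] by auto
    fix A assume A: "A \<in> insert (- \<Omega>) \<T>"
    then show "closed A" using open_domain mesh_compact by (auto simp: compact_imp_closed)
    show "L0-lipschitz_on A cutoff"
    proof (cases "A \<in> \<T>")
      case True
      have lip: "L0-lipschitz_on A (\<lambda>x. P A x * \<phi> x)"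
        by (rule lipschitz_on_mono[OF L[OF True] order_refl L_le[OF True]])
      show ?thesis
        by (rule lipschitz_on_transform[OF lip]) (rule cutoff_eq[OF True])
    next
      case False
      then have "cutoff x = 0" if "x \<in> A" for x using A that by (auto simp: cutoff_def)
      then show ?thesis using L0 by (auto intro!: lipschitz_onI)
    qed
  qed (use finite_mesh L0 in auto)
  then show ?thesis using L0 by blast
qed

lemma cutoff_borel: "cutoff \<in> borel_measurable borel"
  using cutoff_lipschitz lipschitz_on_continuous_on borel_measurable_continuous_onI by blast

lemma cutoff_integrable: "integrable lborel cutoff"
proof -
  obtain R where R: "\<Omega> \<subseteq> cball 0 R"
    using bounded_domain bounded_pos[of \<Omega>] by (auto simp: subset_iff)
  obtain B\<phi> where B\<phi>: "\<And>x. \<bar>\<phi> x\<bar> \<le> B\<phi>" using test_functions_bounded_measurable(3)[OF \<phi>] by blast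
  obtain Bv where Bv: "\<And>x. x \<in> closure \<Omega> \<Longrightarrow> \<bar>v x\<bar> \<le> Bv"
    using compact_imp_bounded[OF compact_continuous_image[OF cont compact_closure_domain]]
    by (auto simp: bounded_iff)
  show ?thesis
  proof (rule Bochner_Integration.integrable_bound[OF integrable_cball_indicator[of "Bv * B\<phi>" R]])
    show "cutoff \<in> borel_measurable lborel" using cutoff_borel by simp
    show "AE x in lborel. norm (cutoff x) \<le> norm ((Bv * B\<phi>) * indicator (cball 0 R) x)"
    proof (rule AE_I2)
      fix x
      show "norm (cutoff x) \<le> norm ((Bv * B\<phi>) * indicator (cball 0 R) x)"
      proof (cases "x \<in> \<Omega>")
        case True
        then have vb: "\<bar>v x\<bar> \<le> Bv" by (intro Bv subsetD[OF closure_subset])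
        have "norm (cutoff x) = \<bar>v x\<bar> * \<bar>\<phi> x\<bar>" using True by (simp add: cutoff_def abs_mult)
        also have "\<dots> \<le> Bv * B\<phi>"
          by (rule mult_mono[OF vb B\<phi> order_trans[OF abs_ge_zero vb] abs_ge_zero])
        also have "\<dots> \<le> \<bar>(Bv * B\<phi>) * indicator (cball 0 R) x\<bar>"
          using subsetD[OF R True] by (simp only: indicator_simps(1) mult_1_right abs_ge_self)
        finally show ?thesis by (simp only: real_norm_def)
      qed (simp add: cutoff_def)
    qed
  qed
qed

definition cutoff_partial :: "'n \<Rightarrow> real ^ 'n \<Rightarrow> real" where
  "cutoff_partial i x = indicator \<Omega> x * (v x * partial i \<phi> x + piecewise_partial i x * \<phi> x)"

lemma cutoff_partial_borel: "cutoff_partial i \<in> borel_measurable lborel"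
proof -
  have "(\<lambda>x. indicator \<Omega> x *\<^sub>R v x) \<in> borel_measurable borel"
    using open_domain continuous_on_subset[OF cont closure_subset]
    by (intro borel_measurable_continuous_on_indicator) auto
  moreover have "cutoff_partial i = (\<lambda>x. (indicator \<Omega> x *\<^sub>R v x) * partial i \<phi> x +
      indicator \<Omega> x * (piecewise_partial i x * \<phi> x))"
    by (rule ext) (simp add: cutoff_partial_def algebra_simps)
  moreover have "partial i \<phi> \<in> borel_measurable borel" "\<phi> \<in> borel_measurable borel"
    using C_1D[OF test_C1] by (auto intro: borel_measurable_continuous_onI)
  moreover have "\<Omega> \<in> sets borel" using open_domain by simp
  ultimately show ?thesis using piecewise_partial_borel by simp
qed

text \<open>Such a point has an open neighbourhood on which the cutoff is either a single product
  \<open>P K x * \<phi> x\<close> or zero, so an ordinary derivative is available there.\<close>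

lemma cutoff_quotient_tendsto:
  assumes x: "x \<in> closure \<Omega> \<longrightarrow> (\<exists>K\<in>\<T>. x \<in> interior K)"
  shows "(\<lambda>n. (cutoff (x + inverse (real (Suc n)) *\<^sub>R axis i 1) - cutoff x) / inverse (real (Suc n)))
    \<longlonglongrightarrow> cutoff_partial i x"
proof -
  have lim: "(\<lambda>n. (cutoff (x + inverse (real (Suc n)) *\<^sub>R axis i 1) - cutoff x) / inverse (real (Suc n)))
      \<longlonglongrightarrow> partial i f x"
    if f: "C_k 1 f" and S: "open S" "x \<in> S" and eq: "\<And>y. y \<in> S \<Longrightarrow> cutoff y = f y" for f S
  proof (rule Lim_transform_eventually[OF difference_quotient_tendsto_partial[OF C_1D(1)[OF f]]])
    have "(\<lambda>n. x + inverse (real (Suc n)) *\<^sub>R axis i 1) \<longlonglongrightarrow> x + 0 *\<^sub>R axis i 1"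
      by (intro tendsto_intros LIMSEQ_inverse_real_of_nat)
    then have "\<forall>\<^sub>F n in sequentially. x + inverse (real (Suc n)) *\<^sub>R axis i 1 \<in> S"
      using S by (intro topological_tendstoD) auto
    then show "\<forall>\<^sub>F n in sequentially.
        (f (x + inverse (real (Suc n)) *\<^sub>R axis i 1) - f x) / inverse (real (Suc n)) =
        (cutoff (x + inverse (real (Suc n)) *\<^sub>R axis i 1) - cutoff x) / inverse (real (Suc n))"
      by eventually_elim (simp only: eq S)
  qed
  show ?thesis
  proof (cases "x \<in> closure \<Omega>")
    case True
    then obtain K where K: "K \<in> \<T>" "x \<in> interior K" using x by blast
    have xK: "x \<in> K" "x \<in> \<Omega>" using K interior_subset mesh_interior_subset by blast+
    then have "cutoff_partial i x = partial i (\<lambda>x. P K x * \<phi> x) x"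
      using piecewise_partial_eq[OF K] P[OF K(1) xK(1)]
        partial_mult[OF C_1D(1)[OF C1[OF K(1)]] C_1D(1)[OF test_C1]]
      by (simp add: cutoff_partial_def)
    moreover have "(\<lambda>n. (cutoff (x + inverse (real (Suc n)) *\<^sub>R axis i 1) - cutoff x) / inverse (real (Suc n)))
        \<longlonglongrightarrow> partial i (\<lambda>x. P K x * \<phi> x) x"
      by (rule lim[OF product_C1[OF K(1)] open_interior K(2)])
        (rule cutoff_eq[OF K(1) subsetD[OF interior_subset]])
    ultimately show ?thesis by (simp only:)
  next
    case False
    then have "x \<notin> \<Omega>" using closure_subset[of \<Omega>] by blast
    then have "cutoff_partial i x = 0" by (simp add: cutoff_partial_def)
    moreover have "cutoff y = 0" if "y \<in> - closure \<Omega>" for y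
      using that closure_subset[of \<Omega>] by (auto simp: cutoff_def)
    then have "(\<lambda>n. (cutoff (x + inverse (real (Suc n)) *\<^sub>R axis i 1) - cutoff x) / inverse (real (Suc n)))
        \<longlonglongrightarrow> partial i (\<lambda>x. 0) x"
      using False by (intro lim[of _ "- closure \<Omega>", OF C_k_const]) auto
    ultimately show ?thesis by (simp only: partial_const)
  qed
qed

lemma integral_cutoff_partial: "(LINT x|lborel. cutoff_partial i x) = 0"
proof -
  obtain L where L: "0 \<le> L" "L-lipschitz_on UNIV cutoff" using cutoff_lipschitz by blast
  obtain R where R: "\<Omega> \<subseteq> cball 0 R"
    using bounded_domain bounded_pos[of \<Omega>] by (auto simp: subset_iff)
  define h where "h n = inverse (real (Suc n))" for n
  have h: "0 < h n" "h n \<le> 1" for n by (auto simp: h_def inverse_le_1_iff)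
  define D where "D n x = (cutoff (x + h n *\<^sub>R axis i 1) - cutoff x) / h n" for n x
  have D_int: "(LINT x|lborel. D n x) = 0" for n
    unfolding D_def using integral_translate_lborel[OF cutoff_borel] cutoff_integrable by simp
  have "(\<lambda>n. LINT x|lborel. D n x) \<longlonglongrightarrow> (LINT x|lborel. cutoff_partial i x)"
  \<comment> \<open>The steps have length at most 1, so all quotients live in the ball of radius
    \<open>R + 1\<close>, where the Lipschitz constant bounds them.\<close>
  proof (rule integral_dominated_convergence[OF cutoff_partial_borel _ integrable_cball_indicator[of L "R + 1"]])
    show "D n \<in> borel_measurable lborel" for n
      unfolding D_def using cutoff_borel by measurable
    show "AE x in lborel. (\<lambda>n. D n x) \<longlonglongrightarrow> cutoff_partial i x"
      using AE_mesh_interior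
      by eventually_elim (unfold D_def h_def, rule cutoff_quotient_tendsto)
    show "AE x in lborel. norm (D n x) \<le> L * indicator (cball 0 (R + 1)) x" for n
    proof (rule AE_I2)
      fix x :: "real ^ 'n"
      show "norm (D n x) \<le> L * indicator (cball 0 (R + 1)) x"
      proof (cases "x \<in> cball 0 (R + 1)")
        case True
        have "\<bar>cutoff (x + h n *\<^sub>R axis i 1) - cutoff x\<bar> \<le> L * h n"
          using lipschitz_onD[OF L(2), of "x + h n *\<^sub>R axis i 1" x] h(1)[of n] by (simp add: dist_norm)
        then show ?thesis using True h(1)[of n] by (simp add: D_def abs_divide divide_le_eq)
      next
        case False
        then have x: "norm x > R + 1" by simp
        have "norm (h n *\<^sub>R axis i 1 :: real ^ 'n) \<le> 1" using h[of n] by simp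
        then have "norm (x + h n *\<^sub>R axis i 1) > R"
          using x norm_triangle_ineq4[of "x + h n *\<^sub>R axis i 1" "h n *\<^sub>R axis i 1"]
          by (simp del: norm_scaleR)
        then have "x \<notin> \<Omega>" "x + h n *\<^sub>R axis i 1 \<notin> \<Omega>" using x R by auto
        then show ?thesis using False by (simp add: D_def cutoff_def)
      qed
    qed
  qed
  then show ?thesis by (simp add: D_int LIMSEQ_const_iff)
qed

lemma integral_by_parts_piecewise:
  "(LINT x|lebesgue_on \<Omega>. v x * partial i \<phi> x) = - (LINT x|lebesgue_on \<Omega>. piecewise_partial i x * \<phi> x)"
proof -
  have "integrable (lebesgue_on \<Omega>) (\<lambda>x. v x * partial i \<phi> x)"
    using cont C_1D(2)[OF test_C1] by (intro continuous_integrable continuous_on_mult)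
  moreover have "integrable (lebesgue_on \<Omega>) (\<lambda>x. piecewise_partial i x * \<phi> x)"
  proof (rule bounded_integrable[OF domain_lmeasurable])
    have "\<phi> \<in> borel_measurable (lebesgue_on \<Omega>)"
      using test_functions_bounded_measurable(2)[OF \<phi>] by (rule measurable_restrict_space1)
    then show "(\<lambda>x. piecewise_partial i x * \<phi> x) \<in> borel_measurable (lebesgue_on \<Omega>)"
      using piecewise_partial_l2 by (intro borel_measurable_times) (simp_all add: l2_space_def)
    obtain B\<phi> where B\<phi>: "\<And>x. \<bar>\<phi> x\<bar> \<le> B\<phi>" using test_functions_bounded_measurable(3)[OF \<phi>] by blast
    obtain B where B: "\<And>x. x \<in> \<Omega> \<Longrightarrow> \<bar>piecewise_partial i x\<bar> \<le> B"
      using piecewise_partial_bounded[of i] by (auto simp: bounded_iff)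
    have "\<bar>piecewise_partial i x * \<phi> x\<bar> \<le> B * B\<phi>" if "x \<in> \<Omega>" for x
      unfolding abs_mult
      by (rule mult_mono[OF B[OF that] B\<phi> order_trans[OF abs_ge_zero B[OF that]] abs_ge_zero])
    then show "bounded ((\<lambda>x. piecewise_partial i x * \<phi> x) ` \<Omega>)" by (auto simp: bounded_iff)
  qed
  ultimately have "(LINT x|lebesgue_on \<Omega>. v x * partial i \<phi> x) + (LINT x|lebesgue_on \<Omega>. piecewise_partial i x * \<phi> x)
      = (LINT x|lebesgue_on \<Omega>. v x * partial i \<phi> x + piecewise_partial i x * \<phi> x)" by simp
  also have "\<dots> = (LINT x|lebesgue. cutoff_partial i x)"
    unfolding cutoff_partial_def using domain_sets by (subst integral_restrict_space) auto
  also have "\<dots> = (LINT x|lborel. cutoff_partial i x)"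
    using cutoff_partial_borel by (intro integral_completion)
  finally show ?thesis using integral_cutoff_partial[of i] by simp
qed

end

lemma piecewise_H1: "v \<in> H1 \<Omega>"
  using continuous_l2_space[OF cont] piecewise_partial_l2 integral_by_parts_piecewise
  unfolding H1_def is_weak_partial_def by blast

end

lemma fe_space_H1:
  assumes v: "v \<in> fe_space \<Omega> \<T> p"
  shows "v \<in> H1 \<Omega>"
proof -
  have "\<forall>K\<in>\<T>. \<exists>P. polynomial_deg_le p P \<and> (\<forall>x\<in>K. v x = P x)"
    using v by (simp add: fe_space_def)
  from bchoice[OF this] obtain P
    where P: "\<And>K. K \<in> \<T> \<Longrightarrow> polynomial_deg_le p (P K)" "\<And>K x. K \<in> \<T> \<Longrightarrow> x \<in> K \<Longrightarrow> v x = P K x"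
    by blast
  show ?thesis
  proof (rule piecewise_H1[of v P])
    show "continuous_on (closure \<Omega>) v" using v by (simp add: fe_space_def)
    show "C_k 1 (P K)" if "K \<in> \<T>" for K using P(1)[OF that] by (rule polynomial_deg_le_C_k)
  qed (rule P(2))
qed

end

section \<open>The Sobolev inner product and the divergence\<close>

text \<open>Turns fields into vectors, so that \<open>subspace\<close>, \<open>span\<close> and
  \<open>linear\<close> apply to sets of functions.\<close>

instantiation "fun" :: (type, real_vector) real_vector
begin

definition scaleR_fun :: "real \<Rightarrow> ('a \<Rightarrow> 'b) \<Rightarrow> 'a \<Rightarrow> 'b" where
  "scaleR_fun c f = (\<lambda>x. c *\<^sub>R f x)"

instance
  by standard (simp_all add: scaleR_fun_def fun_eq_iff algebra_simps)

end

lemma scaleR_fun_apply [simp]: "(c *\<^sub>R f) x = c *\<^sub>R f x"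
  by (simp add: scaleR_fun_def)

lemma sum_fun_eq: "(\<lambda>x. \<Sum>i\<in>I. f i x) = (\<Sum>i\<in>I. f i)"
  by (induction I rule: infinite_finite_induct) (auto simp: fun_eq_iff)

section \<open>Constructions of semi-inner products\<close>

lemma semi_inner_on_add:
  "semi_inner_on V b \<Longrightarrow> semi_inner_on V c \<Longrightarrow> semi_inner_on V (\<lambda>u v. b u v + c u v)"
  unfolding semi_inner_on_def bilinear_on_def by (auto simp: algebra_simps)

lemma semi_inner_on_sum:
  "(\<And>i. i \<in> I \<Longrightarrow> semi_inner_on V (b i)) \<Longrightarrow> semi_inner_on V (\<lambda>u v. \<Sum>i\<in>I. b i u v)"
proof (induction I rule: infinite_finite_induct)
  case (insert i I)
  then show ?case by (auto intro: semi_inner_on_add)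
qed (auto simp: semi_inner_on_def bilinear_on_def)

text \<open>\<open>T\<close> has to be linear only up to null vectors of \<open>c\<close>. This is
  what derivatives selected by choice satisfy: they are additive and homogeneous almost
  everywhere.\<close>

lemma semi_inner_on_pullback:
  assumes W: "semi_inner_on W c" "subspace W" and T: "\<And>v. v \<in> V \<Longrightarrow> T v \<in> W" and V: "subspace V"
    and add: "\<And>u v. u \<in> V \<Longrightarrow> v \<in> V \<Longrightarrow> c (T (u + v) - (T u + T v)) (T (u + v) - (T u + T v)) = 0"
    and scale: "\<And>k u. u \<in> V \<Longrightarrow> c (T (k *\<^sub>R u) - k *\<^sub>R T u) (T (k *\<^sub>R u) - k *\<^sub>R T u) = 0"
  shows "semi_inner_on V (\<lambda>u v. c (T u) (T v))"
proof -
  note simps = bilinear_on_simps[OF semi_inner_on_bilinear[OF W] W(2)]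
  have "c (T (u + v)) (T w) = c (T u) (T w) + c (T v) (T w)"
       "c (T w) (T (u + v)) = c (T w) (T u) + c (T w) (T v)" if "u \<in> V" "v \<in> V" "w \<in> V" for u v w
    using semi_inner_on_null_diff(1,2)[OF W _ _ _ add[OF that(1,2)], of "T w"] that T
      subspace_add[OF V] subspace_add[OF W(2)] by (auto simp: simps)
  moreover have "c (T (k *\<^sub>R u)) (T v) = k * c (T u) (T v)" "c (T v) (T (k *\<^sub>R u)) = k * c (T v) (T u)"
    if "u \<in> V" "v \<in> V" for k u v
    using semi_inner_on_null_diff(1,2)[OF W _ _ _ scale[OF that(1)], of k "T v"] that T
      subspace_scale[OF V] subspace_scale[OF W(2)] by (auto simp: simps)
  ultimately show ?thesis
    using T semi_inner_on_commute[OF W] semi_inner_on_nonneg[OF W]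
    unfolding semi_inner_on_def bilinear_on_def by auto
qed

section \<open>Square-integrable functions\<close>

lemma l2_integrable_inner:
  fixes f g :: "'a \<Rightarrow> 'b::euclidean_space"
  assumes "f \<in> l2_space M" "g \<in> l2_space M"
  shows "integrable M (\<lambda>x. f x \<bullet> g x)"
proof (rule Bochner_Integration.integrable_bound)
  show "integrable M (\<lambda>x. (norm (f x))\<^sup>2 + (norm (g x))\<^sup>2)"
    using assms by (auto simp: l2_space_def)
  have "norm (f x \<bullet> g x) \<le> norm ((norm (f x))\<^sup>2 + (norm (g x))\<^sup>2)" for x
  proof -
    have "0 \<le> norm (f x) * norm (g x)" by simp
    then have "\<bar>f x \<bullet> g x\<bar> \<le> (norm (f x))\<^sup>2 + (norm (g x))\<^sup>2"
      using Cauchy_Schwarz_ineq2[of "f x" "g x"] sum_squares_bound[of "norm (f x)" "norm (g x)"]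
      by linarith
    then show ?thesis unfolding real_norm_def by linarith
  qed
  then show "AE x in M. norm (f x \<bullet> g x) \<le> norm ((norm (f x))\<^sup>2 + (norm (g x))\<^sup>2)"
    by (rule AE_I2)
qed (use assms in \<open>auto simp: l2_space_def\<close>)

lemma l2_space_subspace: "subspace (l2_space M)"
proof (rule subspaceI)
  fix f g :: "'a \<Rightarrow> 'b" assume fg: "f \<in> l2_space M" "g \<in> l2_space M"
  then have meas: "f \<in> borel_measurable M" "g \<in> borel_measurable M" by (auto simp: l2_space_def)
  have "(norm (f x + g x))\<^sup>2 = (f x \<bullet> f x + g x \<bullet> g x) + 2 * (f x \<bullet> g x)" for x
    unfolding power2_norm_eq_inner by (simp add: inner_commute algebra_simps)
  moreover have "integrable M (\<lambda>x. (f x \<bullet> f x + g x \<bullet> g x) + 2 * (f x \<bullet> g x))"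
    by (intro Bochner_Integration.integrable_add integrable_mult_right l2_integrable_inner fg)
  ultimately show "f + g \<in> l2_space M" using meas by (simp add: l2_space_def plus_fun_def)
next
  fix f :: "'a \<Rightarrow> 'b" and c :: real assume "f \<in> l2_space M"
  then have "f \<in> borel_measurable M" "integrable M (\<lambda>x. (norm (f x))\<^sup>2)"
    by (auto simp: l2_space_def)
  then show "c *\<^sub>R f \<in> l2_space M"
    unfolding l2_space_def scaleR_fun_def by (auto simp: power_mult_distrib)
qed (simp add: l2_space_def zero_fun_def)

lemma l2_inner_semi_inner: "semi_inner_on (l2_space M) (l2_inner M)"
  unfolding semi_inner_on_def bilinear_on_def
proof (intro conjI ballI allI)
  fix u v w :: "'a \<Rightarrow> 'b" and c :: real
  assume m: "u \<in> l2_space M" "v \<in> l2_space M"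
  show "l2_inner M (c *\<^sub>R u) v = c * l2_inner M u v" "l2_inner M u (c *\<^sub>R v) = c * l2_inner M u v"
    by (simp_all add: l2_inner_def)
  show "l2_inner M u v = l2_inner M v u" by (simp add: l2_inner_def inner_commute)
  assume "w \<in> l2_space M"
  then show "l2_inner M (u + v) w = l2_inner M u w + l2_inner M v w"
    "l2_inner M w (u + v) = l2_inner M w u + l2_inner M w v"
    using m by (simp_all add: l2_inner_def inner_add_left inner_add_right l2_integrable_inner)
qed (simp add: l2_inner_def)

lemma l2_inner_self_eq_0:
  assumes "f \<in> l2_space M"
  shows "l2_inner M f f = 0 \<longleftrightarrow> (AE x in M. f x = 0)"
  unfolding l2_inner_def
  using integral_nonneg_eq_0_iff_AE[OF l2_integrable_inner[OF assms assms]] by simp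

lemma l2_inner_diff_eq_0:
  assumes "f \<in> l2_space M" "g \<in> l2_space M" "AE x in M. f x = g x"
  shows "l2_inner M (f - g) (f - g) = 0"
  using assms subspace_diff[OF l2_space_subspace] by (subst l2_inner_self_eq_0) auto

lemma l2_norm_sq: "(l2_norm M f)\<^sup>2 = l2_inner M f f"
  by (simp add: l2_norm_def l2_inner_def)

lemma l2_space_vec:
  fixes v :: "'a \<Rightarrow> real ^ 'n::finite"
  assumes "\<And>j. (\<lambda>x. v x $ j) \<in> l2_space M"
  shows "v \<in> l2_space M"
proof -
  have "v \<in> borel_measurable M"
    unfolding borel_measurable_euclidean_space[of v]
    using assms by (auto simp: l2_space_def Basis_vec_def inner_axis)
  moreover have "(norm (v x))\<^sup>2 = (\<Sum>j\<in>UNIV. (norm (v x $ j))\<^sup>2)" for x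
    by (simp add: norm_vec_def L2_set_def sum_nonneg)
  moreover have "integrable M (\<lambda>x. \<Sum>j\<in>UNIV. (norm (v x $ j))\<^sup>2)"
    using assms by (intro Bochner_Integration.integrable_sum) (auto simp: l2_space_def)
  ultimately show ?thesis by (simp add: l2_space_def)
qed

lemma borel_measurable_lebesgue_on_AE:
  fixes f g :: "'a::euclidean_space \<Rightarrow> 'b::euclidean_space"
  assumes S: "S \<in> sets lebesgue" and f: "f \<in> borel_measurable (lebesgue_on S)"
    and ae: "AE x in lebesgue_on S. g x = f x"
  shows "g \<in> borel_measurable (lebesgue_on S)"
proof -
  have "(\<lambda>x. if x \<in> S then f x else 0) \<in> borel_measurable lebesgue"
    using f S by (simp add: borel_measurable_if)
  moreover have "AE x in lebesgue. x \<in> S \<longrightarrow> g x = f x"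
    using ae S by (simp add: AE_restrict_space_iff)
  then have "AE x in lebesgue. (if x \<in> S then f x else 0) = (if x \<in> S then g x else 0)"
    by eventually_elim auto
  ultimately have "(\<lambda>x. if x \<in> S then g x else 0) \<in> borel_measurable lebesgue"
    by (rule borel_measurable_AE)
  then show ?thesis using S by (simp add: borel_measurable_if)
qed

lemma l2_space_lebesgue_on_AE:
  assumes S: "S \<in> sets lebesgue" and f: "f \<in> l2_space (lebesgue_on S)"
    and ae: "AE x in lebesgue_on S. g x = f x"
  shows "g \<in> l2_space (lebesgue_on S)"
proof -
  have g: "g \<in> borel_measurable (lebesgue_on S)"
    using borel_measurable_lebesgue_on_AE[OF S _ ae] f by (simp add: l2_space_def)
  moreover have "integrable (lebesgue_on S) (\<lambda>x. (norm (g x))\<^sup>2)"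
    using ae f g by (subst integrable_cong_AE[of _ _ "\<lambda>x. (norm (f x))\<^sup>2"]) (auto simp: l2_space_def)
  ultimately show ?thesis by (simp add: l2_space_def)
qed

definition h1_inner :: "(real ^ 'n::finite) set \<Rightarrow> (real ^ 'n \<Rightarrow> real ^ 'n) \<Rightarrow> (real ^ 'n \<Rightarrow> real ^ 'n) \<Rightarrow> real" where
  "h1_inner \<Omega> u v = l2_inner (lebesgue_on \<Omega>) u v +
     (\<Sum>j\<in>UNIV. \<Sum>i\<in>UNIV. l2_inner (lebesgue_on \<Omega>)
        (weak_partial \<Omega> i (\<lambda>x. u x $ j)) (weak_partial \<Omega> i (\<lambda>x. v x $ j)))"

lemma h1_norm_eq: "h1_norm \<Omega> v = sqrt (h1_inner \<Omega> v v)"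
  by (simp add: h1_norm_def h1_inner_def l2_norm_sq)

definition div_inner :: "(real ^ 'n::finite) set \<Rightarrow> (real ^ 'n \<Rightarrow> real ^ 'n) \<Rightarrow> (real ^ 'n \<Rightarrow> real ^ 'n) \<Rightarrow> real" where
  "div_inner \<Omega> u v = l2_inner (lebesgue_on \<Omega>) (divergence \<Omega> u) (divergence \<Omega> v)"

lemma nth_fun_simps:
  "(\<lambda>x. (u + v) x $ j) = (\<lambda>x. u x $ j) + (\<lambda>x. v x $ j)"
  "(\<lambda>x. (c *\<^sub>R u) x $ j) = c *\<^sub>R (\<lambda>x. u x $ j)"
  "(\<lambda>x. (0 :: 'a \<Rightarrow> real ^ 'n) x $ j) = 0"
  by (auto simp: fun_eq_iff)

section \<open>Weak derivatives and divergences of Sobolev fields\<close>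

context bounded_open_set
begin

lemma test_function_l2:
  assumes "\<phi> \<in> test_functions \<Omega>"
  shows "\<phi> \<in> l2_space (lebesgue_on \<Omega>)" "partial i \<phi> \<in> l2_space (lebesgue_on \<Omega>)"
proof -
  have "C_k 1 \<phi>" using assms unfolding test_functions_def by blast
  from C_1D(2,3)[OF this] show "\<phi> \<in> l2_space (lebesgue_on \<Omega>)" "partial i \<phi> \<in> l2_space (lebesgue_on \<Omega>)"
    by (auto intro: continuous_l2_space)
qed

lemma l2_times_integrable:
  "f \<in> l2_space (lebesgue_on \<Omega>) \<Longrightarrow> g \<in> l2_space (lebesgue_on \<Omega>) \<Longrightarrow>
    integrable (lebesgue_on \<Omega>) (\<lambda>x. f x * g x :: real)"
  using l2_integrable_inner[of f "lebesgue_on \<Omega>" g] by simp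

lemma l2_imp_integrable:
  assumes "f \<in> l2_space (lebesgue_on \<Omega>)"
  shows "integrable (lebesgue_on \<Omega>) (f :: _ \<Rightarrow> real)"
proof -
  have "(\<lambda>x. 1 :: real) \<in> l2_space (lebesgue_on \<Omega>)" by (intro continuous_l2_space) auto
  from l2_times_integrable[OF assms this] show ?thesis by simp
qed

lemma weak_partial_unique:
  assumes g: "g \<in> l2_space (lebesgue_on \<Omega>)" "is_weak_partial \<Omega> i u g"
    and g': "g' \<in> l2_space (lebesgue_on \<Omega>)" "is_weak_partial \<Omega> i u g'"
  shows "AE x in lebesgue_on \<Omega>. g x = g' x"
proof -
  have "AE x in lebesgue_on \<Omega>. g x - g' x = 0"
  proof (rule fundamental_lemma_calculus_of_variations[OF open_domain])
    show "integrable (lebesgue_on \<Omega>) (\<lambda>x. g x - g' x)"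
      using g(1) g'(1) by (intro Bochner_Integration.integrable_diff l2_imp_integrable)
    fix \<phi> assume \<phi>: "\<phi> \<in> test_functions \<Omega>"
    have "(LINT x|lebesgue_on \<Omega>. g x * \<phi> x) = (LINT x|lebesgue_on \<Omega>. g' x * \<phi> x)"
      using g(2)[unfolded is_weak_partial_def, rule_format, OF \<phi>]
        g'(2)[unfolded is_weak_partial_def, rule_format, OF \<phi>] by linarith
    then show "(LINT x|lebesgue_on \<Omega>. (g x - g' x) * \<phi> x) = 0"
      using l2_times_integrable[OF g(1) test_function_l2(1)[OF \<phi>]]
        l2_times_integrable[OF g'(1) test_function_l2(1)[OF \<phi>]]
      by (simp add: left_diff_distrib)
  qed
  then show ?thesis by simp
qed

lemma H1_l2: "u \<in> H1 \<Omega> \<Longrightarrow> u \<in> l2_space (lebesgue_on \<Omega>)"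
  by (simp add: H1_def)

lemma weak_partial:
  assumes "u \<in> H1 \<Omega>"
  shows "weak_partial \<Omega> i u \<in> l2_space (lebesgue_on \<Omega>)" "is_weak_partial \<Omega> i u (weak_partial \<Omega> i u)"
proof -
  have "\<exists>g. g \<in> l2_space (lebesgue_on \<Omega>) \<and> is_weak_partial \<Omega> i u g"
    using assms by (auto simp: H1_def)
  from someI_ex[OF this]
  show "weak_partial \<Omega> i u \<in> l2_space (lebesgue_on \<Omega>)" "is_weak_partial \<Omega> i u (weak_partial \<Omega> i u)"
    unfolding weak_partial_def by blast+
qed

lemma weak_partial_AE_eq:
  assumes "u \<in> H1 \<Omega>" "g \<in> l2_space (lebesgue_on \<Omega>)" "is_weak_partial \<Omega> i u g"
  shows "AE x in lebesgue_on \<Omega>. weak_partial \<Omega> i u x = g x"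
  using weak_partial_unique[OF weak_partial[OF assms(1)] assms(2,3)] .

lemma is_weak_partial_add:
  assumes "u \<in> H1 \<Omega>" "v \<in> H1 \<Omega>"
  shows "is_weak_partial \<Omega> i (u + v) (weak_partial \<Omega> i u + weak_partial \<Omega> i v)"
  unfolding is_weak_partial_def
proof
  fix \<phi> assume \<phi>: "\<phi> \<in> test_functions \<Omega>"
  note int = l2_times_integrable[OF H1_l2 test_function_l2(2)[OF \<phi>]]
    l2_times_integrable[OF weak_partial(1) test_function_l2(1)[OF \<phi>]]
  show "(LINT x|lebesgue_on \<Omega>. (u + v) x * partial i \<phi> x) =
      - (LINT x|lebesgue_on \<Omega>. (weak_partial \<Omega> i u + weak_partial \<Omega> i v) x * \<phi> x)"
    using weak_partial(2)[OF assms(1), of i] weak_partial(2)[OF assms(2), of i] \<phi> int assms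
    by (simp add: distrib_right is_weak_partial_def)
qed

lemma is_weak_partial_scale:
  assumes "u \<in> H1 \<Omega>"
  shows "is_weak_partial \<Omega> i (c *\<^sub>R u) (c *\<^sub>R weak_partial \<Omega> i u)"
  using weak_partial(2)[OF assms, of i] by (simp add: is_weak_partial_def mult.assoc)

lemma H1_subspace: "subspace (H1 \<Omega>)"
proof (rule subspaceI)
  have "is_weak_partial \<Omega> i 0 0" for i by (simp add: is_weak_partial_def)
  then show "0 \<in> H1 \<Omega>" using subspace_0[OF l2_space_subspace] by (auto simp: H1_def)
next
  fix u v assume "u \<in> H1 \<Omega>" "v \<in> H1 \<Omega>"
  note uv = this
  have "weak_partial \<Omega> i u + weak_partial \<Omega> i v \<in> l2_space (lebesgue_on \<Omega>)" for i
    by (rule subspace_add[OF l2_space_subspace weak_partial(1)[OF uv(1)] weak_partial(1)[OF uv(2)]])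
  moreover have "u + v \<in> l2_space (lebesgue_on \<Omega>)"
    by (rule subspace_add[OF l2_space_subspace H1_l2[OF uv(1)] H1_l2[OF uv(2)]])
  ultimately show "u + v \<in> H1 \<Omega>"
    using is_weak_partial_add[OF uv] unfolding H1_def by blast
next
  fix c u assume "u \<in> H1 \<Omega>"
  note u = this
  have "c *\<^sub>R weak_partial \<Omega> i u \<in> l2_space (lebesgue_on \<Omega>)" for i
    by (rule subspace_scale[OF l2_space_subspace weak_partial(1)[OF u]])
  moreover have "c *\<^sub>R u \<in> l2_space (lebesgue_on \<Omega>)"
    by (rule subspace_scale[OF l2_space_subspace H1_l2[OF u]])
  ultimately show "c *\<^sub>R u \<in> H1 \<Omega>"
    using is_weak_partial_scale[OF u] unfolding H1_def by blast
qed

lemma weak_partial_add: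
  assumes "u \<in> H1 \<Omega>" "v \<in> H1 \<Omega>"
  shows "AE x in lebesgue_on \<Omega>. weak_partial \<Omega> i (u + v) x = (weak_partial \<Omega> i u + weak_partial \<Omega> i v) x"
  by (rule weak_partial_AE_eq[OF subspace_add[OF H1_subspace assms]
        subspace_add[OF l2_space_subspace weak_partial(1)[OF assms(1)] weak_partial(1)[OF assms(2)]]
        is_weak_partial_add[OF assms]])

lemma weak_partial_scale:
  assumes "u \<in> H1 \<Omega>"
  shows "AE x in lebesgue_on \<Omega>. weak_partial \<Omega> i (c *\<^sub>R u) x = (c *\<^sub>R weak_partial \<Omega> i u) x"
  by (rule weak_partial_AE_eq[OF subspace_scale[OF H1_subspace assms]
        subspace_scale[OF l2_space_subspace weak_partial(1)[OF assms]] is_weak_partial_scale[OF assms]])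

text \<open>Zero is a weak derivative of such a function, so the chosen one vanishes by
  uniqueness.\<close>

lemma weak_partial_null:
  assumes "u \<in> H1 \<Omega>" "AE x in lebesgue_on \<Omega>. u x = 0"
  shows "AE x in lebesgue_on \<Omega>. weak_partial \<Omega> i u x = 0"
proof -
  have "is_weak_partial \<Omega> i u 0"
    unfolding is_weak_partial_def
  proof
    fix \<phi>
    have "(LINT x|lebesgue_on \<Omega>. u x * partial i \<phi> x) = 0"
      using assms(2) by (intro integral_eq_zero_AE) auto
    then show "(LINT x|lebesgue_on \<Omega>. u x * partial i \<phi> x) = - (LINT x|lebesgue_on \<Omega>. 0 x * \<phi> x)"
      by simp
  qed
  from weak_partial_AE_eq[OF assms(1) subspace_0[OF l2_space_subspace] this] show ?thesis by simp
qed

lemma H1_vec_nth: "v \<in> H1_vec \<Omega> \<Longrightarrow> (\<lambda>x. v x $ j) \<in> H1 \<Omega>"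
  by (simp add: H1_vec_def)

lemma H1_vec_subspace: "subspace (H1_vec \<Omega>)"
  unfolding H1_vec_def
proof (intro subspaceI CollectI allI; (elim CollectE)?)
  fix j
  show "(\<lambda>x. (0 :: real ^ 'n \<Rightarrow> real ^ 'n) x $ j) \<in> H1 \<Omega>"
    unfolding nth_fun_simps by (rule subspace_0[OF H1_subspace])
  fix u v :: "real ^ 'n \<Rightarrow> real ^ 'n" and c :: real
  assume u: "\<forall>j. (\<lambda>x. u x $ j) \<in> H1 \<Omega>"
  then show "(\<lambda>x. (c *\<^sub>R u) x $ j) \<in> H1 \<Omega>"
    unfolding nth_fun_simps by (intro subspace_scale[OF H1_subspace]) blast
  assume v: "\<forall>j. (\<lambda>x. v x $ j) \<in> H1 \<Omega>"
  show "(\<lambda>x. (u + v) x $ j) \<in> H1 \<Omega>"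
    unfolding nth_fun_simps using u v by (intro subspace_add[OF H1_subspace]) auto
qed

lemma H1_vec_l2: "v \<in> H1_vec \<Omega> \<Longrightarrow> v \<in> l2_space (lebesgue_on \<Omega>)"
  by (intro l2_space_vec H1_l2 H1_vec_nth)

lemma divergence_l2: "v \<in> H1_vec \<Omega> \<Longrightarrow> divergence \<Omega> v \<in> l2_space (lebesgue_on \<Omega>)"
proof -
  assume v: "v \<in> H1_vec \<Omega>"
  have "divergence \<Omega> v = (\<Sum>i\<in>UNIV. weak_partial \<Omega> i (\<lambda>x. v x $ i))"
    unfolding sum_fun_eq[symmetric] by (rule ext) (simp add: divergence_def)
  also have "\<dots> \<in> l2_space (lebesgue_on \<Omega>)"
    by (rule subspace_sum[OF l2_space_subspace]) (rule weak_partial(1)[OF H1_vec_nth[OF v]])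
  finally show ?thesis .
qed

lemma divergence_add:
  assumes "u \<in> H1_vec \<Omega>" "v \<in> H1_vec \<Omega>"
  shows "AE x in lebesgue_on \<Omega>. divergence \<Omega> (u + v) x = (divergence \<Omega> u + divergence \<Omega> v) x"
proof -
  have "AE x in lebesgue_on \<Omega>. \<forall>i\<in>UNIV. weak_partial \<Omega> i (\<lambda>x. (u + v) x $ i) x =
      (weak_partial \<Omega> i (\<lambda>x. u x $ i) + weak_partial \<Omega> i (\<lambda>x. v x $ i)) x"
    using assms unfolding nth_fun_simps by (intro AE_finite_allI weak_partial_add H1_vec_nth) auto
  then show ?thesis by eventually_elim (simp add: divergence_def sum.distrib)
qed

lemma divergence_scale:
  assumes "u \<in> H1_vec \<Omega>"
  shows "AE x in lebesgue_on \<Omega>. divergence \<Omega> (c *\<^sub>R u) x = (c *\<^sub>R divergence \<Omega> u) x"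
proof -
  have "AE x in lebesgue_on \<Omega>. \<forall>i\<in>UNIV. weak_partial \<Omega> i (\<lambda>x. (c *\<^sub>R u) x $ i) x =
      (c *\<^sub>R weak_partial \<Omega> i (\<lambda>x. u x $ i)) x"
    using assms unfolding nth_fun_simps by (intro AE_finite_allI weak_partial_scale H1_vec_nth) auto
  then show ?thesis by eventually_elim (simp add: divergence_def sum_distrib_left)
qed

lemma divergence_diff:
  assumes "u \<in> H1_vec \<Omega>" "v \<in> H1_vec \<Omega>"
  shows "AE x in lebesgue_on \<Omega>. divergence \<Omega> (u - v) x = divergence \<Omega> u x - divergence \<Omega> v x"
proof -
  have m: "(-1) *\<^sub>R v \<in> H1_vec \<Omega>" by (intro subspace_scale[OF H1_vec_subspace] assms)
  show ?thesis
    using divergence_add[OF assms(1) m] divergence_scale[OF assms(2), of "-1"]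
    by eventually_elim simp
qed

lemma div_inner_semi_inner: "semi_inner_on (H1_vec \<Omega>) (div_inner \<Omega>)"
  unfolding div_inner_def[abs_def]
proof (rule semi_inner_on_pullback[OF l2_inner_semi_inner l2_space_subspace divergence_l2 H1_vec_subspace])
  fix u v assume uv: "u \<in> H1_vec \<Omega>" "v \<in> H1_vec \<Omega>"
  show "l2_inner (lebesgue_on \<Omega>) (divergence \<Omega> (u + v) - (divergence \<Omega> u + divergence \<Omega> v))
    (divergence \<Omega> (u + v) - (divergence \<Omega> u + divergence \<Omega> v)) = 0"
    by (rule l2_inner_diff_eq_0[OF divergence_l2[OF subspace_add[OF H1_vec_subspace uv]]
          subspace_add[OF l2_space_subspace divergence_l2[OF uv(1)] divergence_l2[OF uv(2)]]
          divergence_add[OF uv]])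
next
  fix c u assume u: "u \<in> H1_vec \<Omega>"
  show "l2_inner (lebesgue_on \<Omega>) (divergence \<Omega> (c *\<^sub>R u) - c *\<^sub>R divergence \<Omega> u)
    (divergence \<Omega> (c *\<^sub>R u) - c *\<^sub>R divergence \<Omega> u) = 0"
    by (rule l2_inner_diff_eq_0[OF divergence_l2[OF subspace_scale[OF H1_vec_subspace u]]
          subspace_scale[OF l2_space_subspace divergence_l2[OF u]] divergence_scale[OF u]])
qed

lemma weak_partial_semi_inner:
  "semi_inner_on (H1_vec \<Omega>) (\<lambda>u v. l2_inner (lebesgue_on \<Omega>)
     (weak_partial \<Omega> i (\<lambda>x. u x $ j)) (weak_partial \<Omega> i (\<lambda>x. v x $ j)))"
proof (rule semi_inner_on_pullback[OF l2_inner_semi_inner l2_space_subspace weak_partial(1)[OF H1_vec_nth] H1_vec_subspace])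
  fix u v assume uv: "u \<in> H1_vec \<Omega>" "v \<in> H1_vec \<Omega>"
  note m = H1_vec_nth[OF uv(1), of j] H1_vec_nth[OF uv(2), of j]
  let ?e = "weak_partial \<Omega> i (\<lambda>x. (u + v) x $ j) -
     (weak_partial \<Omega> i (\<lambda>x. u x $ j) + weak_partial \<Omega> i (\<lambda>x. v x $ j))"
  show "l2_inner (lebesgue_on \<Omega>) ?e ?e = 0"
    unfolding nth_fun_simps
    by (rule l2_inner_diff_eq_0[OF weak_partial(1)[OF subspace_add[OF H1_subspace m]]
          subspace_add[OF l2_space_subspace weak_partial(1)[OF m(1)] weak_partial(1)[OF m(2)]]
          weak_partial_add[OF m]])
next
  fix c u assume u: "u \<in> H1_vec \<Omega>"
  note m = H1_vec_nth[OF u, of j]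
  let ?e = "weak_partial \<Omega> i (\<lambda>x. (c *\<^sub>R u) x $ j) - c *\<^sub>R weak_partial \<Omega> i (\<lambda>x. u x $ j)"
  show "l2_inner (lebesgue_on \<Omega>) ?e ?e = 0"
    unfolding nth_fun_simps
    by (rule l2_inner_diff_eq_0[OF weak_partial(1)[OF subspace_scale[OF H1_subspace m]]
          subspace_scale[OF l2_space_subspace weak_partial(1)[OF m]] weak_partial_scale[OF m]])
qed

lemma h1_inner_semi_inner: "semi_inner_on (H1_vec \<Omega>) (h1_inner \<Omega>)"
  unfolding h1_inner_def[abs_def]
proof (intro semi_inner_on_add semi_inner_on_sum weak_partial_semi_inner)
  show "semi_inner_on (H1_vec \<Omega>) (l2_inner (lebesgue_on \<Omega>))"
    by (rule semi_inner_on_subset[OF l2_inner_semi_inner]) (use H1_vec_l2 in blast)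
qed

lemma l2_inner_self_nonneg: "0 \<le> l2_inner M f f"
  by (simp add: l2_inner_def)

text \<open>Connects null vectors of the abstract setting with equality almost everywhere. One
  direction reads off the L2 part, the other needs the chosen derivatives of a null function to
  vanish as well.\<close>

lemma h1_inner_null_iff:
  assumes v: "v \<in> H1_vec \<Omega>"
  shows "h1_inner \<Omega> v v = 0 \<longleftrightarrow> (AE x in lebesgue_on \<Omega>. v x = 0)"
proof
  assume "h1_inner \<Omega> v v = 0"
  then have "l2_inner (lebesgue_on \<Omega>) v v \<le> 0"
  proof -
    have "0 \<le> (\<Sum>j\<in>UNIV. \<Sum>i\<in>UNIV. l2_inner (lebesgue_on \<Omega>)
        (weak_partial \<Omega> i (\<lambda>x. v x $ j)) (weak_partial \<Omega> i (\<lambda>x. v x $ j)))"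
      by (intro sum_nonneg l2_inner_self_nonneg)
    then show ?thesis using \<open>h1_inner \<Omega> v v = 0\<close> unfolding h1_inner_def by linarith
  qed
  then have "l2_inner (lebesgue_on \<Omega>) v v = 0"
    using l2_inner_self_nonneg[of "lebesgue_on \<Omega>" v] by linarith
  then show "AE x in lebesgue_on \<Omega>. v x = 0" using l2_inner_self_eq_0[OF H1_vec_l2[OF v]] by blast
next
  assume ae: "AE x in lebesgue_on \<Omega>. v x = 0"
  have "AE x in lebesgue_on \<Omega>. v x $ j = 0" for j using ae by eventually_elim simp
  then have "l2_inner (lebesgue_on \<Omega>) (weak_partial \<Omega> i (\<lambda>x. v x $ j)) (weak_partial \<Omega> i (\<lambda>x. v x $ j)) = 0"
    for i j
    using weak_partial_null[OF H1_vec_nth[OF v]] l2_inner_self_eq_0[OF weak_partial(1)[OF H1_vec_nth[OF v]]]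
    by blast
  then show "h1_inner \<Omega> v v = 0"
    using ae l2_inner_self_eq_0[OF H1_vec_l2[OF v]] by (simp add: h1_inner_def)
qed

text \<open>The square of a sum of d terms is at most d times the sum of the squares, and only the
  diagonal entries of the gradient enter. This is the origin of the factors
  \<open>sqrt d\<close>.\<close>

lemma div_inner_le_h1_inner:
  assumes v: "v \<in> H1_vec \<Omega>"
  shows "div_inner \<Omega> v v \<le> real CARD('n) * h1_inner \<Omega> v v"
proof -
  let ?g = "\<lambda>j i. weak_partial \<Omega> i (\<lambda>x. v x $ j)"
  have int: "integrable (lebesgue_on \<Omega>) (\<lambda>x. ?g j i x * ?g j i x)" for i j
    by (intro l2_times_integrable weak_partial H1_vec_nth v)
  have "div_inner \<Omega> v v \<le> (LINT x|lebesgue_on \<Omega>. real CARD('n) * (\<Sum>i\<in>UNIV. ?g i i x * ?g i i x))"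
    unfolding div_inner_def l2_inner_def
  proof (rule integral_mono)
    show "integrable (lebesgue_on \<Omega>) (\<lambda>x. divergence \<Omega> v x \<bullet> divergence \<Omega> v x)"
      by (intro l2_integrable_inner divergence_l2 v)
    show "integrable (lebesgue_on \<Omega>) (\<lambda>x. real CARD('n) * (\<Sum>i\<in>UNIV. ?g i i x * ?g i i x))"
      by (intro integrable_mult_right Bochner_Integration.integrable_sum int)
    show "divergence \<Omega> v x \<bullet> divergence \<Omega> v x \<le> real CARD('n) * (\<Sum>i\<in>UNIV. ?g i i x * ?g i i x)" for x
      using sum_squared_le_sum_of_squares[of "\<lambda>i. ?g i i x" UNIV]
      by (simp add: divergence_def power2_eq_square mult.commute)
  qed
  also have "\<dots> = real CARD('n) * (\<Sum>i\<in>UNIV. l2_inner (lebesgue_on \<Omega>) (?g i i) (?g i i))"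
    using int by (simp add: l2_inner_def)
  also have "\<dots> \<le> real CARD('n) * h1_inner \<Omega> v v"
  proof (rule mult_left_mono)
    have "(\<Sum>i\<in>UNIV. l2_inner (lebesgue_on \<Omega>) (?g i i) (?g i i))
        \<le> (\<Sum>j\<in>UNIV. \<Sum>i\<in>UNIV. l2_inner (lebesgue_on \<Omega>) (?g j i) (?g j i))"
      by (intro sum_mono member_le_sum) (auto simp: l2_inner_self_nonneg)
    then show "(\<Sum>i\<in>UNIV. l2_inner (lebesgue_on \<Omega>) (?g i i) (?g i i)) \<le> h1_inner \<Omega> v v"
      unfolding h1_inner_def using l2_inner_self_nonneg[of "lebesgue_on \<Omega>" v] by linarith
  qed simp
  finally show ?thesis .
qed

text \<open>Dictionary from a pressure \<open>q\<close> to a field \<open>v\<close> with that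
  divergence, on which the abstract setting works.\<close>

lemma div_space_l2:
  assumes v: "v \<in> H1_vec \<Omega>" and q: "AE x in lebesgue_on \<Omega>. q x = divergence \<Omega> v x"
  shows "q \<in> l2_space (lebesgue_on \<Omega>)"
    and "w \<in> H1_vec \<Omega> \<Longrightarrow> l2_inner (lebesgue_on \<Omega>) q (divergence \<Omega> w) = div_inner \<Omega> v w"
    and "w \<in> H1_vec \<Omega> \<Longrightarrow> l2_inner (lebesgue_on \<Omega>) (divergence \<Omega> w) q = div_inner \<Omega> w v"
    and "w \<in> H1_vec \<Omega> \<Longrightarrow> l2_norm (lebesgue_on \<Omega>) (\<lambda>x. q x - divergence \<Omega> w x) = sqrt (div_inner \<Omega> (v - w) (v - w))"
    and "l2_norm (lebesgue_on \<Omega>) q = sqrt (div_inner \<Omega> v v)"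
proof -
  note d = divergence_l2[OF v]
  show q2: "q \<in> l2_space (lebesgue_on \<Omega>)"
    by (rule l2_space_lebesgue_on_AE[OF domain_sets d q])
  note null = semi_inner_on_null_diff[OF l2_inner_semi_inner l2_space_subspace]
  note nq = l2_inner_diff_eq_0[OF q2 d q]
  show "l2_norm (lebesgue_on \<Omega>) q = sqrt (div_inner \<Omega> v v)"
    using null(3)[OF q2 d d nq] by (simp add: l2_norm_def div_inner_def)
  assume w: "w \<in> H1_vec \<Omega>"
  note dw = divergence_l2[OF w]
  show "l2_inner (lebesgue_on \<Omega>) q (divergence \<Omega> w) = div_inner \<Omega> v w"
    "l2_inner (lebesgue_on \<Omega>) (divergence \<Omega> w) q = div_inner \<Omega> w v"
    using null(1,2)[OF q2 d dw nq] by (simp_all add: div_inner_def)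
  have e: "AE x in lebesgue_on \<Omega>. (q - divergence \<Omega> w) x = divergence \<Omega> (v - w) x"
    using q divergence_diff[OF v w] by eventually_elim simp
  have m: "q - divergence \<Omega> w \<in> l2_space (lebesgue_on \<Omega>)" "divergence \<Omega> (v - w) \<in> l2_space (lebesgue_on \<Omega>)"
    using q2 dw v w by (auto intro: subspace_diff[OF l2_space_subspace] divergence_l2 subspace_diff[OF H1_vec_subspace])
  have "l2_inner (lebesgue_on \<Omega>) (q - divergence \<Omega> w) (q - divergence \<Omega> w) = div_inner \<Omega> (v - w) (v - w)"
    unfolding div_inner_def by (rule null(3)[OF m m(2) l2_inner_diff_eq_0[OF m e]])
  then show "l2_norm (lebesgue_on \<Omega>) (\<lambda>x. q x - divergence \<Omega> w x) = sqrt (div_inner \<Omega> (v - w) (v - w))"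
    by (simp only: l2_norm_def fun_diff_def)
qed

end

section \<open>The inf-sup constant and the finite element spaces\<close>

context mixed_galerkin
begin

definition inf_sup :: real where
  "inf_sup = (INF s\<in>{s \<in> X. b s s \<noteq> 0}. SUP v\<in>{v \<in> X. h v v \<noteq> 0}. b v s / (nh v * nb s))"

context
  fixes s\<^sub>0 :: 'v
  assumes nontrivial: "s\<^sub>0 \<in> X" "b s\<^sub>0 s\<^sub>0 \<noteq> 0"
begin

lemma nh_pos: "v \<in> X \<Longrightarrow> h v v \<noteq> 0 \<Longrightarrow> 0 < nh v" and nb_pos: "v \<in> X \<Longrightarrow> b v v \<noteq> 0 \<Longrightarrow> 0 < nb v"
  using h_nonneg[of v] b_nonneg[of v] by auto

lemma h_nontrivial: "{v \<in> X. h v v \<noteq> 0} \<noteq> {}"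
  using nontrivial h_null_b by blast

lemma ratio_le:
  assumes "s \<in> X" "b s s \<noteq> 0" "v \<in> X" "h v v \<noteq> 0"
  shows "b v s / (nh v * nb s) \<le> sqrt d"
proof -
  have pos: "0 < nh v" "0 < nb s" using assms nh_pos nb_pos by auto
  have "b v s \<le> nb v * nb s" using semi_inner_on_Cauchy_Schwarz[OF b X assms(3,1)] by simp
  also have "\<dots> \<le> sqrt d * nh v * nb s"
    using nb_le_nh[OF assms(3)] pos by (intro mult_right_mono) auto
  finally show ?thesis using pos by (simp add: divide_le_eq mult_ac)
qed

lemma ratio_bdd: "s \<in> X \<Longrightarrow> b s s \<noteq> 0 \<Longrightarrow> bdd_above ((\<lambda>v. b v s / (nh v * nb s)) ` {v \<in> X. h v v \<noteq> 0})"
  using ratio_le by (intro bdd_aboveI2) auto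

text \<open>A preimage of \<open>s\<close> bounded by \<open>C * nb s\<close> is a test field whose
  ratio is at least 1/C.\<close>

lemma sup_lower_bound:
  obtains c where "0 < c"
    "\<And>s. s \<in> X \<Longrightarrow> b s s \<noteq> 0 \<Longrightarrow> c \<le> (SUP v\<in>{v \<in> X. h v v \<noteq> 0}. b v s / (nh v * nb s))"
proof -
  obtain C where C: "C > 0" "\<And>s. s \<in> X \<Longrightarrow> \<exists>v\<in>X. b (v - s) (v - s) = 0 \<and> nh v \<le> C * nb s"
    using bounded_right_inverse by blast
  show thesis
  proof (rule that[of "inverse C"])
    fix s assume s: "s \<in> X" "b s s \<noteq> 0"
    obtain v where v: "v \<in> X" "b (v - s) (v - s) = 0" "nh v \<le> C * nb s" using C(2)[OF s(1)] by blast
    have eq: "b v s = b s s" "b v v = b s s"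
      using semi_inner_on_null_diff(1,3)[OF b X v(1) s(1) s(1) v(2)] by auto
    have hv: "h v v \<noteq> 0" using h_null_b[OF v(1)] eq s(2) by auto
    have pos: "0 < nh v" "0 < nb s" using nh_pos nb_pos v s hv by auto
    have "b v s / (nh v * nb s) = nb s / nh v"
      using pos b_nonneg[OF s(1)] eq by (simp add: field_simps)
    also have "\<dots> \<ge> inverse C" using pos C(1) v(3) by (simp add: field_simps)
    finally show "inverse C \<le> (SUP v\<in>{v \<in> X. h v v \<noteq> 0}. b v s / (nh v * nb s))"
      using v(1) hv by (intro cSUP_upper2[OF ratio_bdd[OF s]]) auto
  qed (use C in simp)
qed

lemma inf_sup_pos: "0 < inf_sup"
proof -
  obtain c where c: "0 < c"
    "\<And>s. s \<in> X \<Longrightarrow> b s s \<noteq> 0 \<Longrightarrow> c \<le> (SUP v\<in>{v \<in> X. h v v \<noteq> 0}. b v s / (nh v * nb s))"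
    using sup_lower_bound by blast
  have "c \<le> inf_sup"
    unfolding inf_sup_def using nontrivial c(2) by (intro cINF_greatest) auto
  then show ?thesis using c(1) by simp
qed

lemma inf_sup_le_sup:
  assumes "s \<in> X" "b s s \<noteq> 0"
  shows "inf_sup \<le> (SUP v\<in>{v \<in> X. h v v \<noteq> 0}. b v s / (nh v * nb s))"
  unfolding inf_sup_def
proof (rule cINF_lower)
  obtain c where "\<And>s. s \<in> X \<Longrightarrow> b s s \<noteq> 0 \<Longrightarrow> c \<le> (SUP v\<in>{v \<in> X. h v v \<noteq> 0}. b v s / (nh v * nb s))"
    using sup_lower_bound by blast
  then show "bdd_below ((\<lambda>s. SUP v\<in>{v \<in> X. h v v \<noteq> 0}. b v s / (nh v * nb s)) ` {s \<in> X. b s s \<noteq> 0})"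
    by (intro bdd_belowI2) auto
qed (use assms in auto)

lemma inf_sup_le: "inf_sup \<le> sqrt d"
  using inf_sup_le_sup[OF nontrivial] nontrivial h_nontrivial ratio_le
  by (elim order_trans) (intro cSUP_least; auto)

text \<open>After division by the norms, \<open>c / nb s\<close> bounds every ratio in the supremum.
  This form without a supremum is the one that the preimage argument uses, and it admits
  \<open>b s s = 0\<close>.\<close>

lemma inf_sup_condition:
  assumes s: "s \<in> X" and c: "0 \<le> c" "\<And>v. v \<in> X \<Longrightarrow> b v s \<le> c * nh v"
  shows "inf_sup * nb s \<le> c"
proof (cases "b s s = 0")
  case False
  then have pos: "0 < nb s" using s nb_pos by auto
  have "inf_sup \<le> (SUP v\<in>{v \<in> X. h v v \<noteq> 0}. b v s / (nh v * nb s))"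
    by (rule inf_sup_le_sup[OF s False])
  also have "\<dots> \<le> c / nb s"
  proof (rule cSUP_least[OF h_nontrivial])
    fix v assume "v \<in> {v \<in> X. h v v \<noteq> 0}"
    then have v: "v \<in> X" "0 < nh v" using nh_pos by auto
    then show "b v s / (nh v * nb s) \<le> c / nb s"
      using c(2)[OF v(1)] pos by (simp add: field_simps)
  qed
  finally show ?thesis using pos by (simp add: field_simps)
qed (use c in simp)

text \<open>Coercivity and boundedness are compared at one field of nonzero norm, which exists
  because some divergence is nonzero.\<close>

lemma \<alpha>_le_M: "\<alpha> \<le> M"
proof -
  have "h s\<^sub>0 s\<^sub>0 \<noteq> 0" using nontrivial h_null_b by blast
  then have pos: "0 < h s\<^sub>0 s\<^sub>0" using h_nonneg[OF nontrivial(1)] by simp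
  have "\<alpha> * h s\<^sub>0 s\<^sub>0 \<le> M * h s\<^sub>0 s\<^sub>0"
  proof -
    have "M * nh s\<^sub>0 * nh s\<^sub>0 = M * h s\<^sub>0 s\<^sub>0" using pos by simp
    then show ?thesis using coercive[OF nontrivial(1)] bounded[OF nontrivial(1,1)] by linarith
  qed
  then show ?thesis using pos by simp
qed

end

end

lemma sum_fun_apply: "(\<Sum>i\<in>I. f i) x = (\<Sum>i\<in>I. f i x)"
  by (induction I rule: infinite_finite_induct) auto

section \<open>Finite element spaces as subspaces\<close>

lemma polynomial_deg_le_0: "polynomial_deg_le p (\<lambda>x. 0)"
  unfolding polynomial_deg_le_def by (intro exI[of _ "\<lambda>_. 0"]) simp

lemma polynomial_deg_le_add:
  "polynomial_deg_le p P \<Longrightarrow> polynomial_deg_le p Q \<Longrightarrow> polynomial_deg_le p (\<lambda>x. P x + Q x)"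
proof -
  assume "polynomial_deg_le p P" "polynomial_deg_le p Q"
  then obtain c c' where
    "\<And>x. P x = (\<Sum>\<alpha> | (\<Sum>i\<in>UNIV. \<alpha> i) \<le> p. c \<alpha> * (\<Prod>i\<in>UNIV. (x $ i) ^ \<alpha> i))"
    "\<And>x. Q x = (\<Sum>\<alpha> | (\<Sum>i\<in>UNIV. \<alpha> i) \<le> p. c' \<alpha> * (\<Prod>i\<in>UNIV. (x $ i) ^ \<alpha> i))"
    unfolding polynomial_deg_le_def by blast
  then show ?thesis unfolding polynomial_deg_le_def
    by (intro exI[of _ "\<lambda>\<alpha>. c \<alpha> + c' \<alpha>"]) (simp add: sum.distrib distrib_right)
qed

lemma polynomial_deg_le_scale: "polynomial_deg_le p P \<Longrightarrow> polynomial_deg_le p (\<lambda>x. k * P x)"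
proof -
  assume "polynomial_deg_le p P"
  then obtain c where "\<And>x. P x = (\<Sum>\<alpha> | (\<Sum>i\<in>UNIV. \<alpha> i) \<le> p. c \<alpha> * (\<Prod>i\<in>UNIV. (x $ i) ^ \<alpha> i))"
    unfolding polynomial_deg_le_def by blast
  then show ?thesis unfolding polynomial_deg_le_def
    by (intro exI[of _ "\<lambda>\<alpha>. k * c \<alpha>"]) (simp add: sum_distrib_left mult.assoc)
qed

lemma fe_space_D_subspace: "subspace (fe_space_D \<Omega> \<Gamma>\<^sub>D \<T> p)"
proof (rule subspaceI)
  show "0 \<in> fe_space_D \<Omega> \<Gamma>\<^sub>D \<T> p"
    using polynomial_deg_le_0[of p] by (auto simp: fe_space_D_def fe_space_def zero_fun_def)
next
  fix u v assume uv: "u \<in> fe_space_D \<Omega> \<Gamma>\<^sub>D \<T> p" "v \<in> fe_space_D \<Omega> \<Gamma>\<^sub>D \<T> p"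
  have "\<exists>P. polynomial_deg_le p P \<and> (\<forall>x\<in>K. (u + v) x = P x)" if K: "K \<in> \<T>" for K
  proof -
    obtain P Q where "polynomial_deg_le p P" "\<forall>x\<in>K. u x = P x" "polynomial_deg_le p Q" "\<forall>x\<in>K. v x = Q x"
      using uv K unfolding fe_space_D_def fe_space_def by blast
    then show ?thesis using polynomial_deg_le_add[of p P Q] by (intro exI[of _ "\<lambda>x. P x + Q x"]) simp
  qed
  then show "u + v \<in> fe_space_D \<Omega> \<Gamma>\<^sub>D \<T> p"
    using uv by (simp add: fe_space_D_def fe_space_def continuous_on_add plus_fun_def)
next
  fix u and k :: real assume u: "u \<in> fe_space_D \<Omega> \<Gamma>\<^sub>D \<T> p"
  have "\<exists>P. polynomial_deg_le p P \<and> (\<forall>x\<in>K. (k *\<^sub>R u) x = P x)" if K: "K \<in> \<T>" for K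
  proof -
    obtain P where "polynomial_deg_le p P" "\<forall>x\<in>K. u x = P x"
      using u K unfolding fe_space_D_def fe_space_def by blast
    then show ?thesis using polynomial_deg_le_scale[of p P k] by (intro exI[of _ "\<lambda>x. k * P x"]) simp
  qed
  then show "k *\<^sub>R u \<in> fe_space_D \<Omega> \<Gamma>\<^sub>D \<T> p"
    using u by (simp add: fe_space_D_def fe_space_def continuous_on_mult_left scaleR_fun_def)
qed

lemma X_D_subspace: "subspace (X_D \<Omega> \<Gamma>\<^sub>D \<T> p)"
  unfolding X_D_def
proof (intro subspaceI CollectI allI; (elim CollectE)?)
  note sub = fe_space_D_subspace[of \<Omega> \<Gamma>\<^sub>D \<T> p]
  fix i
  show "(\<lambda>x. (0 :: real ^ 'a \<Rightarrow> real ^ 'a) x $ i) \<in> fe_space_D \<Omega> \<Gamma>\<^sub>D \<T> p"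
    unfolding nth_fun_simps by (rule subspace_0[OF sub])
  fix u v :: "real ^ 'a \<Rightarrow> real ^ 'a" and c :: real
  assume u: "\<forall>i. (\<lambda>x. u x $ i) \<in> fe_space_D \<Omega> \<Gamma>\<^sub>D \<T> p"
  then show "(\<lambda>x. (c *\<^sub>R u) x $ i) \<in> fe_space_D \<Omega> \<Gamma>\<^sub>D \<T> p"
    unfolding nth_fun_simps by (intro subspace_scale[OF sub]) blast
  assume v: "\<forall>i. (\<lambda>x. v x $ i) \<in> fe_space_D \<Omega> \<Gamma>\<^sub>D \<T> p"
  show "(\<lambda>x. (u + v) x $ i) \<in> fe_space_D \<Omega> \<Gamma>\<^sub>D \<T> p"
    unfolding nth_fun_simps using u v by (intro subspace_add[OF sub]) auto
qed

lemma X_I_loc_subspace: "subspace (X_I_loc \<Omega> \<Gamma>\<^sub>D \<T> p K)"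
proof (rule subspaceI)
  show "0 \<in> X_I_loc \<Omega> \<Gamma>\<^sub>D \<T> p K"
    using subspace_0[OF X_D_subspace] by (simp add: X_I_loc_def)
next
  fix u v assume uv: "u \<in> X_I_loc \<Omega> \<Gamma>\<^sub>D \<T> p K" "v \<in> X_I_loc \<Omega> \<Gamma>\<^sub>D \<T> p K"
  have "closure {x \<in> closure \<Omega>. (u + v) x \<noteq> 0}
      \<subseteq> closure ({x \<in> closure \<Omega>. u x \<noteq> 0} \<union> {x \<in> closure \<Omega>. v x \<noteq> 0})"
    by (intro closure_mono) auto
  then show "u + v \<in> X_I_loc \<Omega> \<Gamma>\<^sub>D \<T> p K"
    using uv subspace_add[OF X_D_subspace] by (auto simp: X_I_loc_def closure_Un)
next
  fix u and k :: real assume u: "u \<in> X_I_loc \<Omega> \<Gamma>\<^sub>D \<T> p K"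
  have "closure {x \<in> closure \<Omega>. (k *\<^sub>R u) x \<noteq> 0} \<subseteq> closure {x \<in> closure \<Omega>. u x \<noteq> 0}"
    by (intro closure_mono) auto
  then show "k *\<^sub>R u \<in> X_I_loc \<Omega> \<Gamma>\<^sub>D \<T> p K"
    using u subspace_scale[OF X_D_subspace] by (auto simp: X_I_loc_def)
qed

lemma mesh_sum_subset:
  assumes "subspace X" "\<And>K. K \<in> \<T> \<Longrightarrow> V K \<subseteq> X" shows "mesh_sum \<T> V \<subseteq> X"
proof
  fix v assume "v \<in> mesh_sum \<T> V"
  then obtain w where w: "\<forall>K\<in>\<T>. w K \<in> V K" "v = (\<lambda>x. \<Sum>K\<in>\<T>. w K x)" by (auto simp: mesh_sum_def)
  have "(\<Sum>K\<in>\<T>. w K) \<in> X" using w assms by (intro subspace_sum) auto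
  then show "v \<in> X" using w by (simp add: sum_fun_eq)
qed

lemma mesh_sum_subspace:
  assumes V: "\<And>K. K \<in> \<T> \<Longrightarrow> subspace (V K)" shows "subspace (mesh_sum \<T> V)"
proof (rule subspaceI)
  show "0 \<in> mesh_sum \<T> V"
    unfolding mesh_sum_def using V subspace_0
    by (intro CollectI exI[of _ "\<lambda>_. 0"]) (auto simp: fun_eq_iff)
next
  fix u v assume "u \<in> mesh_sum \<T> V" "v \<in> mesh_sum \<T> V"
  then obtain y z where yz: "\<And>K. K \<in> \<T> \<Longrightarrow> y K \<in> V K" "u = (\<lambda>x. \<Sum>K\<in>\<T>. y K x)"
    "\<And>K. K \<in> \<T> \<Longrightarrow> z K \<in> V K" "v = (\<lambda>x. \<Sum>K\<in>\<T>. z K x)" by (auto simp: mesh_sum_def)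
  have "y K + z K \<in> V K" if "K \<in> \<T>" for K
    by (rule subspace_add[OF V[OF that] yz(1)[OF that] yz(3)[OF that]])
  moreover have "u + v = (\<lambda>x. \<Sum>K\<in>\<T>. (y K + z K) x)"
    using yz(2,4) by (simp add: fun_eq_iff sum.distrib)
  ultimately show "u + v \<in> mesh_sum \<T> V"
    unfolding mesh_sum_def by (intro CollectI exI[of _ "\<lambda>K. y K + z K"]) blast
next
  fix u and c :: real assume "u \<in> mesh_sum \<T> V"
  then obtain y where y: "\<And>K. K \<in> \<T> \<Longrightarrow> y K \<in> V K" "u = (\<lambda>x. \<Sum>K\<in>\<T>. y K x)"
    by (auto simp: mesh_sum_def)
  have "c *\<^sub>R y K \<in> V K" if "K \<in> \<T>" for K
    by (rule subspace_scale[OF V[OF that] y(1)[OF that]])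
  moreover have "c *\<^sub>R u = (\<lambda>x. \<Sum>K\<in>\<T>. (c *\<^sub>R y K) x)"
    using y(2) by (simp add: fun_eq_iff scaleR_sum_right)
  ultimately show "c *\<^sub>R u \<in> mesh_sum \<T> V"
    unfolding mesh_sum_def by (intro CollectI exI[of _ "\<lambda>K. c *\<^sub>R y K"]) blast
qed

lemma X_I_subset: "X_I \<Omega> \<Gamma>\<^sub>D \<T> p \<subseteq> X_D \<Omega> \<Gamma>\<^sub>D \<T> p"
  unfolding X_I_def by (rule mesh_sum_subset[OF X_D_subspace]) (auto simp: X_I_loc_def)

lemma N_I_subset: "N_I \<Omega> \<Gamma>\<^sub>D \<T> p \<subseteq> X_D \<Omega> \<Gamma>\<^sub>D \<T> p"
  unfolding N_I_def by (rule mesh_sum_subset[OF X_D_subspace]) (auto simp: X_I_loc_def N_I_loc_def)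

lemma finite_multi_indices: "finite {\<alpha> :: 'n::finite \<Rightarrow> nat. (\<Sum>i\<in>UNIV. \<alpha> i) \<le> p}"
proof (rule finite_subset)
  show "{\<alpha> :: 'n \<Rightarrow> nat. (\<Sum>i\<in>UNIV. \<alpha> i) \<le> p} \<subseteq> PiE UNIV (\<lambda>_. {..p})"
  proof
    fix \<alpha> :: "'n \<Rightarrow> nat" assume "\<alpha> \<in> {\<alpha>. (\<Sum>i\<in>UNIV. \<alpha> i) \<le> p}"
    then have "\<alpha> i \<le> p" for i using member_le_sum[of i UNIV \<alpha>] by simp
    then show "\<alpha> \<in> PiE UNIV (\<lambda>_. {..p})" by auto
  qed
qed (intro finite_PiE; simp)

section \<open>Finite element fields within the Sobolev setting\<close>

context polyhedral_mesh
begin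

lemma X_D_H1_vec: "X_D \<Omega> \<Gamma>\<^sub>D \<T> p \<subseteq> H1_vec \<Omega>"
  using fe_space_H1 by (auto simp: X_D_def fe_space_D_def H1_vec_def)

text \<open>Fields of \<open>X_D\<close> are continuous up to the boundary, so the constant sequence
  \<open>v\<close> is an admissible approximation in the definition of the trace.\<close>

lemma X_D_H1_D: "X_D \<Omega> \<Gamma>\<^sub>D \<T> p \<subseteq> H1_D \<Omega> \<Gamma>\<^sub>D"
proof
  fix v assume v: "v \<in> X_D \<Omega> \<Gamma>\<^sub>D \<T> p"
  then have v1: "v \<in> H1_vec \<Omega>" using X_D_H1_vec by blast
  have cont: "continuous_on (closure \<Omega>) v"
    using v by (subst continuous_on_componentwise)
      (auto simp: Basis_vec_def inner_axis X_D_def fe_space_D_def fe_space_def)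
  have v0: "v x = 0" if "x \<in> \<Gamma>\<^sub>D" for x
    using v that by (auto simp: X_D_def fe_space_D_def vec_eq_iff)
  have "h1_norm \<Omega> (\<lambda>x. v x - v x) = 0"
    using h1_inner_null_iff[OF subspace_0[OF H1_vec_subspace]] by (simp add: h1_norm_eq zero_fun_def)
  moreover have "l2_norm (restrict_space surface_measure \<Gamma>\<^sub>D) (\<lambda>x. 0 - v x) = 0"
  proof -
    have "(LINT x|restrict_space surface_measure \<Gamma>\<^sub>D. (0 - v x) \<bullet> (0 - v x)) = (LINT x|restrict_space surface_measure \<Gamma>\<^sub>D. 0)"
      using v0 by (intro Bochner_Integration.integral_cong) (auto simp: space_restrict_space)
    then show ?thesis by (simp add: l2_norm_def l2_inner_def)
  qed
  ultimately have "has_trace_on \<Omega> \<Gamma>\<^sub>D v (\<lambda>x. 0)"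
    unfolding has_trace_on_def using v1 cont
    by (intro conjI exI[of _ "\<lambda>_. v"]) (auto simp: l2_space_def)
  then show "v \<in> H1_D \<Omega> \<Gamma>\<^sub>D" using v1 by (simp add: H1_D_def)
qed

lemma N_I_loc_subspace: "subspace (N_I_loc \<Omega> \<Gamma>\<^sub>D \<T> p K)"
proof (rule subspaceI)
  note sub = X_I_loc_subspace[of \<Omega> \<Gamma>\<^sub>D \<T> p K]
  have mem: "v \<in> X_I_loc \<Omega> \<Gamma>\<^sub>D \<T> p K" "v \<in> H1_vec \<Omega>" "AE x in lebesgue_on \<Omega>. divergence \<Omega> v x = 0"
    if "v \<in> N_I_loc \<Omega> \<Gamma>\<^sub>D \<T> p K" for v
    using that X_D_H1_vec by (auto simp: N_I_loc_def X_I_loc_def)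
  have "AE x in lebesgue_on \<Omega>. divergence \<Omega> 0 x = 0"
    using divergence_scale[OF subspace_0[OF H1_vec_subspace], of 0] by simp
  then show "0 \<in> N_I_loc \<Omega> \<Gamma>\<^sub>D \<T> p K"
    using subspace_0[OF sub] by (simp add: N_I_loc_def)
  fix u assume u: "u \<in> N_I_loc \<Omega> \<Gamma>\<^sub>D \<T> p K"
  {
    fix v assume v: "v \<in> N_I_loc \<Omega> \<Gamma>\<^sub>D \<T> p K"
    have "AE x in lebesgue_on \<Omega>. divergence \<Omega> (u + v) x = 0"
      using mem(3)[OF u] mem(3)[OF v] divergence_add[OF mem(2)[OF u] mem(2)[OF v]]
      by eventually_elim simp
    then show "u + v \<in> N_I_loc \<Omega> \<Gamma>\<^sub>D \<T> p K"
      using subspace_add[OF sub mem(1)[OF u] mem(1)[OF v]] by (simp add: N_I_loc_def)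
  }
  fix c :: real
  have "AE x in lebesgue_on \<Omega>. divergence \<Omega> (c *\<^sub>R u) x = 0"
    using mem(3)[OF u] divergence_scale[OF mem(2)[OF u], of c] by eventually_elim simp
  then show "c *\<^sub>R u \<in> N_I_loc \<Omega> \<Gamma>\<^sub>D \<T> p K"
    using subspace_scale[OF sub mem(1)[OF u]] by (simp add: N_I_loc_def)
qed

lemma N_I_subspace: "subspace (N_I \<Omega> \<Gamma>\<^sub>D \<T> p)"
  unfolding N_I_def by (rule mesh_sum_subspace[OF N_I_loc_subspace])

lemma div_inner_null_iff:
  "v \<in> H1_vec \<Omega> \<Longrightarrow> div_inner \<Omega> v v = 0 \<longleftrightarrow> (AE x in lebesgue_on \<Omega>. divergence \<Omega> v x = 0)"
  unfolding div_inner_def by (rule l2_inner_self_eq_0[OF divergence_l2])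

lemma N_I_null:
  assumes "z \<in> N_I \<Omega> \<Gamma>\<^sub>D \<T> p" shows "div_inner \<Omega> z z = 0"
proof -
  have "N_I \<Omega> \<Gamma>\<^sub>D \<T> p \<subseteq> {v \<in> H1_vec \<Omega>. div_inner \<Omega> v v = 0}"
    unfolding N_I_def
  proof (rule mesh_sum_subset)
    show "N_I_loc \<Omega> \<Gamma>\<^sub>D \<T> p K \<subseteq> {v \<in> H1_vec \<Omega>. div_inner \<Omega> v v = 0}" for K
      using X_D_H1_vec div_inner_null_iff by (auto simp: N_I_loc_def X_I_loc_def)
    show "subspace {v \<in> H1_vec \<Omega>. div_inner \<Omega> v v = 0}"
      by (rule semi_inner_on_kernel_subspace[OF div_inner_semi_inner H1_vec_subspace])
  qed
  then show ?thesis using assms by blast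
qed

text \<open>Erases the arbitrary values outside the closure of the domain; within the domain only a
  null set is lost. What remains is spanned by finitely many truncated monomials.\<close>

definition piecewise_restriction :: "(real ^ 'n \<Rightarrow> real ^ 'n) \<Rightarrow> real ^ 'n \<Rightarrow> real ^ 'n" where
  "piecewise_restriction v x = (if x \<in> (\<Union>K\<in>\<T>. interior K) then v x else 0)"

definition piecewise_monomial :: "(real ^ 'n) set \<Rightarrow> ('n \<Rightarrow> nat) \<Rightarrow> 'n \<Rightarrow> real ^ 'n \<Rightarrow> real ^ 'n" where
  "piecewise_monomial K \<alpha> j x = (indicator (interior K) x * (\<Prod>i\<in>UNIV. (x $ i) ^ \<alpha> i)) *\<^sub>R axis j 1"

definition piecewise_monomials :: "nat \<Rightarrow> (real ^ 'n \<Rightarrow> real ^ 'n) set" where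
  "piecewise_monomials p =
     (\<lambda>(K, \<alpha>, j). piecewise_monomial K \<alpha> j) ` (\<T> \<times> {\<alpha>. (\<Sum>i\<in>UNIV. \<alpha> i) \<le> p} \<times> UNIV)"

lemma linear_piecewise_restriction: "linear piecewise_restriction"
  by (rule linearI) (auto simp: piecewise_restriction_def fun_eq_iff)

lemma piecewise_restriction_span:
  assumes v: "v \<in> X_D \<Omega> \<Gamma>\<^sub>D \<T> p"
  shows "piecewise_restriction v \<in> span (piecewise_monomials p)"
proof -
  let ?A = "{\<alpha> :: 'n \<Rightarrow> nat. (\<Sum>i\<in>UNIV. \<alpha> i) \<le> p}"
  have ex: "\<exists>c. \<forall>x\<in>K. v x $ j = (\<Sum>\<alpha>\<in>?A. c \<alpha> * (\<Prod>i\<in>UNIV. (x $ i) ^ \<alpha> i))" if "K \<in> \<T>" for K j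
  proof -
    have "(\<lambda>x. v x $ j) \<in> fe_space \<Omega> \<T> p" using v by (simp add: X_D_def fe_space_D_def)
    then have "\<forall>K\<in>\<T>. \<exists>P. polynomial_deg_le p P \<and> (\<forall>x\<in>K. v x $ j = P x)"
      by (simp add: fe_space_def)
    from bspec[OF this that] obtain P where P: "polynomial_deg_le p P" "\<forall>x\<in>K. v x $ j = P x"
      by (elim exE conjE)
    then obtain c where "\<forall>x. P x = (\<Sum>\<alpha>\<in>?A. c \<alpha> * (\<Prod>i\<in>UNIV. (x $ i) ^ \<alpha> i))"
      by (auto simp: polynomial_deg_le_def)
    then show ?thesis using P(2) by auto
  qed
  define c where "c K j = (SOME c. \<forall>x\<in>K. v x $ j = (\<Sum>\<alpha>\<in>?A. c \<alpha> * (\<Prod>i\<in>UNIV. (x $ i) ^ \<alpha> i)))" for K j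
  have c: "v x $ j = (\<Sum>\<alpha>\<in>?A. c K j \<alpha> * (\<Prod>i\<in>UNIV. (x $ i) ^ \<alpha> i))" if "K \<in> \<T>" "x \<in> K" for K j x
    using someI_ex[OF ex[OF that(1), of j]] that(2) unfolding c_def by blast
  have "piecewise_restriction v = (\<Sum>K\<in>\<T>. \<Sum>j\<in>UNIV. \<Sum>\<alpha>\<in>?A. c K j \<alpha> *\<^sub>R piecewise_monomial K \<alpha> j)"
  proof
    fix x
    have inner: "(\<Sum>j\<in>UNIV. \<Sum>\<alpha>\<in>?A. c K j \<alpha> *\<^sub>R piecewise_monomial K \<alpha> j x) =
        (if x \<in> interior K then v x else 0)" if K: "K \<in> \<T>" for K
    proof (cases "x \<in> interior K")
      case True
      then have "x \<in> K" using interior_subset by blast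
      have "(\<Sum>j\<in>UNIV. \<Sum>\<alpha>\<in>?A. c K j \<alpha> *\<^sub>R piecewise_monomial K \<alpha> j x) = (\<Sum>j\<in>UNIV. (v x $ j) *\<^sub>R axis j 1)"
        using True c[OF K \<open>x \<in> K\<close>] by (simp add: piecewise_monomial_def scaleR_sum_left)
      then show ?thesis using True by (simp add: basis_expansion scalar_mult_eq_scaleR[symmetric])
    qed (simp add: piecewise_monomial_def)
    have "(\<Sum>K\<in>\<T>. if x \<in> interior K then v x else 0) = piecewise_restriction v x"
    proof (cases "\<exists>K\<in>\<T>. x \<in> interior K")
      case True
      then obtain K where K: "K \<in> \<T>" "x \<in> interior K" by blast
      have "(\<Sum>K'\<in>\<T>. if x \<in> interior K' then v x else 0) = (\<Sum>K'\<in>\<T>. if K' = K then v x else 0)"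
      proof (rule sum.cong[OF refl])
        fix K' assume "K' \<in> \<T>"
        then show "(if x \<in> interior K' then v x else 0) = (if K' = K then v x else 0)"
          using K mesh_interior_disjoint[of K K' x] by (cases "x \<in> interior K'"; cases "K' = K") simp_all
      qed
      also have "\<dots> = v x" using K(1) finite_mesh by simp
      finally show ?thesis using True by (simp add: piecewise_restriction_def)
    qed (simp add: piecewise_restriction_def)
    then show "piecewise_restriction v x =
        (\<Sum>K\<in>\<T>. \<Sum>j\<in>UNIV. \<Sum>\<alpha>\<in>?A. c K j \<alpha> *\<^sub>R piecewise_monomial K \<alpha> j) x"
      by (simp add: sum_fun_apply inner)
  qed
  also have "\<dots> \<in> span (piecewise_monomials p)"
  proof (intro span_sum span_scale span_base)
    show "piecewise_monomial K \<alpha> j \<in> piecewise_monomials p" if "K \<in> \<T>" "\<alpha> \<in> ?A" for K \<alpha> j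
      unfolding piecewise_monomials_def using that by (intro image_eqI[of _ _ "(K, \<alpha>, j)"]) auto
  qed
  finally show ?thesis .
qed

lemma X_D_finitely_spanned:
  assumes V: "subspace V" "V \<subseteq> X_D \<Omega> \<Gamma>\<^sub>D \<T> p"
  shows "finitely_spanned_mod (h1_inner \<Omega>) V"
proof (rule finitely_spanned_modI[OF linear_piecewise_restriction])
  show "finite (piecewise_monomials p)"
    unfolding piecewise_monomials_def
    by (intro finite_imageI finite_cartesian_product finite_mesh finite_multi_indices) simp
  show "piecewise_restriction ` V \<subseteq> span (piecewise_monomials p)"
    using piecewise_restriction_span V(2) by blast
  fix v assume v: "v \<in> V" "piecewise_restriction v = 0"
  have "AE x in lebesgue. x \<in> closure \<Omega> \<longrightarrow> (\<exists>K\<in>\<T>. x \<in> interior K)"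
    by (rule AE_completion[OF AE_mesh_interior])
  then have "AE x in lebesgue. x \<in> \<Omega> \<longrightarrow> v x = 0"
  proof eventually_elim
    case (elim x)
    then show ?case
      using fun_cong[OF v(2), of x] closure_subset[of \<Omega>]
      by (auto simp: piecewise_restriction_def split: if_splits)
  qed
  then have "AE x in lebesgue_on \<Omega>. v x = 0" using domain_sets by (simp add: AE_restrict_space_iff)
  then show "h1_inner \<Omega> v v = 0" using h1_inner_null_iff[of v] v(1) V(2) X_D_H1_vec by blast
qed (rule V(1))

text \<open>One infimum runs over pressures, the other over fields having them as divergence. The
  two sets of suprema coincide, so the identity also holds if both are empty.\<close>

lemma inf_sup_const_eq:
  "inf_sup_const \<Omega> \<Gamma>\<^sub>D \<T> p =
     (INF s\<in>{s \<in> X_D \<Omega> \<Gamma>\<^sub>D \<T> p. div_inner \<Omega> s s \<noteq> 0}.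
        SUP v\<in>{v \<in> X_D \<Omega> \<Gamma>\<^sub>D \<T> p. h1_inner \<Omega> v v \<noteq> 0}.
          div_inner \<Omega> v s / (sqrt (h1_inner \<Omega> v v) * sqrt (div_inner \<Omega> s s)))"
proof -
  let ?X = "X_D \<Omega> \<Gamma>\<^sub>D \<T> p"
  have X: "v \<in> H1_vec \<Omega>" if "v \<in> ?X" for v using that X_D_H1_vec by blast
  define V where "V = {v \<in> ?X. h1_inner \<Omega> v v \<noteq> 0}"
  have V: "{v \<in> ?X. \<not> (AE x in lebesgue_on \<Omega>. v x = 0)} = V"
    using h1_inner_null_iff[OF X] by (auto simp: V_def)
  define F where "F q = (SUP v\<in>V. l2_inner (lebesgue_on \<Omega>) (divergence \<Omega> v) q /
    (h1_norm \<Omega> v * l2_norm (lebesgue_on \<Omega>) q))" for q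
  define G where "G s = (SUP v\<in>V. div_inner \<Omega> v s / (sqrt (h1_inner \<Omega> v v) * sqrt (div_inner \<Omega> s s)))" for s
  have FG: "F q = G s" if s: "s \<in> ?X" "AE x in lebesgue_on \<Omega>. q x = divergence \<Omega> s x" for q s
    unfolding F_def G_def
    by (rule SUP_cong[OF refl])
      (simp add: V_def X div_space_l2(3)[OF X[OF s(1)] s(2)] div_space_l2(5)[OF X[OF s(1)] s(2)] h1_norm_eq)
  have null: "(AE x in lebesgue_on \<Omega>. q x = 0) \<longleftrightarrow> div_inner \<Omega> s s = 0"
    if s: "s \<in> ?X" "AE x in lebesgue_on \<Omega>. q x = divergence \<Omega> s x" for q s
  proof -
    have "(AE x in lebesgue_on \<Omega>. q x = 0) \<longleftrightarrow> (AE x in lebesgue_on \<Omega>. divergence \<Omega> s x = 0)"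
    proof
      assume "AE x in lebesgue_on \<Omega>. q x = 0"
      with s(2) show "AE x in lebesgue_on \<Omega>. divergence \<Omega> s x = 0" by eventually_elim simp
    next
      assume "AE x in lebesgue_on \<Omega>. divergence \<Omega> s x = 0"
      with s(2) show "AE x in lebesgue_on \<Omega>. q x = 0" by eventually_elim simp
    qed
    then show ?thesis using div_inner_null_iff[OF X[OF s(1)]] by blast
  qed
  have "F ` {q \<in> div_space \<Omega> ?X. \<not> (AE x in lebesgue_on \<Omega>. q x = 0)} = G ` {s \<in> ?X. div_inner \<Omega> s s \<noteq> 0}"
  proof (intro equalityI subsetI)
    fix y assume "y \<in> F ` {q \<in> div_space \<Omega> ?X. \<not> (AE x in lebesgue_on \<Omega>. q x = 0)}"
    then obtain q s where q: "y = F q" "\<not> (AE x in lebesgue_on \<Omega>. q x = 0)" "s \<in> ?X"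
      "AE x in lebesgue_on \<Omega>. q x = divergence \<Omega> s x" by (auto simp: div_space_def)
    then show "y \<in> G ` {s \<in> ?X. div_inner \<Omega> s s \<noteq> 0}"
      using FG[OF q(3,4)] null[OF q(3,4)] by blast
  next
    fix y assume "y \<in> G ` {s \<in> ?X. div_inner \<Omega> s s \<noteq> 0}"
    then obtain s where s: "y = G s" "s \<in> ?X" "div_inner \<Omega> s s \<noteq> 0" by blast
    have ae: "AE x in lebesgue_on \<Omega>. divergence \<Omega> s x = divergence \<Omega> s x" by simp
    have "divergence \<Omega> s \<in> div_space \<Omega> ?X" using s(2) by (auto simp: div_space_def)
    then show "y \<in> F ` {q \<in> div_space \<Omega> ?X. \<not> (AE x in lebesgue_on \<Omega>. q x = 0)}"
      using s FG[OF s(2) ae] null[OF s(2) ae] by (intro image_eqI[of _ F "divergence \<Omega> s"]) simp_all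
  qed
  then show ?thesis
    unfolding inf_sup_const_def V by (simp add: F_def G_def V_def)
qed

lemma div_space_orthogonal_iff:
  assumes v: "v \<in> H1_vec \<Omega>" and Y: "Y \<subseteq> H1_vec \<Omega>"
  shows "(\<forall>r\<in>div_space \<Omega> Y. l2_inner (lebesgue_on \<Omega>) (divergence \<Omega> v) r = 0) \<longleftrightarrow>
    (\<forall>y\<in>Y. div_inner \<Omega> v y = 0)"
proof
  assume *: "\<forall>r\<in>div_space \<Omega> Y. l2_inner (lebesgue_on \<Omega>) (divergence \<Omega> v) r = 0"
  show "\<forall>y\<in>Y. div_inner \<Omega> v y = 0"
  proof
    fix y assume "y \<in> Y"
    then have "divergence \<Omega> y \<in> div_space \<Omega> Y" by (auto simp: div_space_def)
    then show "div_inner \<Omega> v y = 0" using * by (simp add: div_inner_def)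
  qed
next
  assume *: "\<forall>y\<in>Y. div_inner \<Omega> v y = 0"
  show "\<forall>r\<in>div_space \<Omega> Y. l2_inner (lebesgue_on \<Omega>) (divergence \<Omega> v) r = 0"
  proof
    fix r assume "r \<in> div_space \<Omega> Y"
    then obtain y where y: "y \<in> Y" "AE x in lebesgue_on \<Omega>. r x = divergence \<Omega> y x"
      by (auto simp: div_space_def)
    then show "l2_inner (lebesgue_on \<Omega>) (divergence \<Omega> v) r = 0"
      using div_space_l2(3)[OF subsetD[OF Y y(1)] y(2) v] * by simp
  qed
qed

end

section \<open>Instantiation of the abstract iteration\<close>

lemma bilinear_form_H1_bilinear_on: "bilinear_form_H1 \<Omega> a \<Longrightarrow> bilinear_on (H1_vec \<Omega>) a"
  unfolding bilinear_form_H1_def bilinear_on_def plus_fun_def scaleR_fun_def by blast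

theorem theorem4p5:
  fixes \<Omega> \<Gamma>\<^sub>D \<Gamma>\<^sub>N :: "(real ^ 'n::finite) set"
    and \<T> :: "(real ^ 'n) set set"
    and p :: nat
    and a :: "(real ^ 'n \<Rightarrow> real ^ 'n) \<Rightarrow> (real ^ 'n \<Rightarrow> real ^ 'n) \<Rightarrow> real"
    and M \<alpha> lam \<beta> :: real
    and f g u_sol :: "real ^ 'n \<Rightarrow> real ^ 'n"
    and q_sol :: "real ^ 'n \<Rightarrow> real"
    and u w :: "nat \<Rightarrow> real ^ 'n \<Rightarrow> real ^ 'n"
    and L :: "(real ^ 'n \<Rightarrow> real ^ 'n) \<Rightarrow> real"
    and inn :: "(real ^ 'n \<Rightarrow> real) \<Rightarrow> (real ^ 'n \<Rightarrow> real) \<Rightarrow> real"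
    and nrm :: "(real ^ 'n \<Rightarrow> real) \<Rightarrow> real"
    and XB XB_dag :: "(real ^ 'n \<Rightarrow> real ^ 'n) set"
  defines "inn \<equiv> l2_inner (lebesgue_on \<Omega>)"
    and "nrm \<equiv> l2_norm (lebesgue_on \<Omega>)"
    and "L \<equiv> load \<Omega> \<Gamma>\<^sub>N f g"
    and "XB \<equiv> X_B \<Omega> \<Gamma>\<^sub>D \<T> p a"
    and "XB_dag \<equiv> X_B_dagger \<Omega> \<Gamma>\<^sub>D \<T> p a"
    and "\<beta> \<equiv> inf_sup_const \<Omega> \<Gamma>\<^sub>D \<T> p"
  assumes dim: "CARD('n) = 2 \<or> CARD('n) = 3"
    and domain: "polyhedral_domain \<Omega>"
    and boundary: "\<Gamma>\<^sub>D \<union> \<Gamma>\<^sub>N = frontier \<Omega>" "\<Gamma>\<^sub>D \<inter> \<Gamma>\<^sub>N = {}"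
    and Dirichlet: "emeasure surface_measure \<Gamma>\<^sub>D > 0"
    and mesh: "simplicial_mesh \<Omega> \<T>" "mesh_resolves_interface \<T> \<Gamma>\<^sub>D \<Gamma>\<^sub>N"
    and form: "bilinear_form_H1 \<Omega> a"
    and const_pos: "M > 0" "\<alpha> > 0"
    and bounded: "\<And>u v. u \<in> H1_D \<Omega> \<Gamma>\<^sub>D \<Longrightarrow> v \<in> H1_D \<Omega> \<Gamma>\<^sub>D \<Longrightarrow> \<bar>a u v\<bar> \<le> M * h1_norm \<Omega> u * h1_norm \<Omega> v"
    and coercive: "\<And>u. u \<in> H1_D \<Omega> \<Gamma>\<^sub>D \<Longrightarrow> a u u \<ge> \<alpha> * (h1_norm \<Omega> u)\<^sup>2"
    and data: "f \<in> l2_space (lebesgue_on \<Omega>)" "g \<in> l2_space (restrict_space surface_measure \<Gamma>\<^sub>N)"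
    and lam_pos: "lam > 0"
    and sol_in: "u_sol \<in> XB" "q_sol \<in> div_space \<Omega> XB"
    and sol_momentum: "\<And>v. v \<in> XB_dag \<Longrightarrow> a u_sol v - inn q_sol (divergence \<Omega> v) = L v"
    and sol_mass: "\<And>r. r \<in> div_space \<Omega> XB_dag \<Longrightarrow> - inn r (divergence \<Omega> u_sol) = 0"
    and iter_in: "\<And>n. u n \<in> XB" "\<And>n. w n \<in> XB"
    and iter_0: "\<And>x. x \<in> closure \<Omega> \<Longrightarrow> w 0 x = 0"
    and iter_u: "\<And>n v. v \<in> XB_dag \<Longrightarrow>
          a (u n) v + lam * inn (divergence \<Omega> (u n)) (divergence \<Omega> v)
            = L v + inn (divergence \<Omega> (w n)) (divergence \<Omega> v)"
    and iter_w: "\<And>n x. x \<in> closure \<Omega> \<Longrightarrow> w (Suc n) x = w n x - lam *\<^sub>R u n x"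
  shows "(\<forall>n. max (h1_norm \<Omega> (\<lambda>x. u_sol x - u n x))
               (inverse (M * (M + \<alpha>) ^ 3 / (\<alpha> ^ 3 * \<beta>\<^sup>2)
                          + sqrt (real CARD('n)) * lam * (M + \<alpha>) / (\<alpha> * \<beta>))
                 * nrm (\<lambda>x. q_sol x - divergence \<Omega> (w n) x))
             \<le> (M + \<alpha>)\<^sup>2 / (\<alpha>\<^sup>2 * \<beta>) * nrm (divergence \<Omega> (u n))) \<and>
         (\<forall>n. nrm (divergence \<Omega> (u n))
             \<le> sqrt (real CARD('n)) * (M * (M + \<alpha>) ^ 4 / (\<alpha> ^ 4 * \<beta>\<^sup>2 * lam)) ^ n
                 * h1_norm \<Omega> (\<lambda>x. u_sol x - u 0 x))"
proof -
  interpret polyhedral_mesh \<Omega> \<T> using domain mesh(1) by unfold_locales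
  let ?X = "X_D \<Omega> \<Gamma>\<^sub>D \<T> p" and ?N = "N_I \<Omega> \<Gamma>\<^sub>D \<T> p" and ?R = "X_I \<Omega> \<Gamma>\<^sub>D \<T> p"
  let ?h = "h1_inner \<Omega>" and ?b = "div_inner \<Omega>" and ?d = "real CARD('n)"
  have XH: "?X \<subseteq> H1_vec \<Omega>" by (rule X_D_H1_vec)
  have XD: "v \<in> H1_D \<Omega> \<Gamma>\<^sub>D" if "v \<in> ?X" for v using that X_D_H1_D by blast
  have RH: "?R \<subseteq> H1_vec \<Omega>" using X_I_subset XH by blast
  interpret G: mixed_galerkin ?X ?N ?R ?h ?b a M \<alpha> ?d
  proof unfold_locales
    show "bilinear_on ?X a" using bilinear_on_subset[OF bilinear_form_H1_bilinear_on[OF form] XH] .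
    show "\<bar>a v v'\<bar> \<le> M * sqrt (?h v v) * sqrt (?h v' v')" if "v \<in> ?X" "v' \<in> ?X" for v v'
      using bounded[OF XD XD, OF that] by (simp add: h1_norm_eq)
    show "\<alpha> * ?h v v \<le> a v v" if "v \<in> ?X" for v
    proof -
      have "0 \<le> ?h v v" using semi_inner_on_nonneg[OF h1_inner_semi_inner H1_vec_subspace] that XH by blast
      then show ?thesis using coercive[OF XD[OF that]] by (simp add: h1_norm_eq)
    qed
    show "?b v v \<le> ?d * ?h v v" if "v \<in> ?X" for v
      using div_inner_le_h1_inner that XH by blast
    show "semi_inner_on ?X ?h" "semi_inner_on ?X ?b"
      using semi_inner_on_subset[OF h1_inner_semi_inner XH] semi_inner_on_subset[OF div_inner_semi_inner XH] by auto
  qed (rule X_D_subspace N_I_subspace N_I_subset X_I_subset N_I_null X_D_finitely_spanned const_pos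
      of_nat_0_le_iff; assumption)+
  have XB: "v \<in> XB \<longleftrightarrow> v \<in> G.Y" for v
  proof (cases "v \<in> ?X")
    case True
    then show ?thesis
      using div_space_orthogonal_iff[OF subsetD[OF XH True] RH] by (simp add: XB_def X_B_def G.Y_def)
  qed (auto simp: XB_def X_B_def G.Y_def)
  have XB_dag: "v \<in> XB_dag" if v: "v \<in> ?X" "\<And>z. z \<in> ?N \<Longrightarrow> a z v = 0" "\<And>r. r \<in> ?R \<Longrightarrow> ?b v r = 0" for v
    using v div_space_orthogonal_iff[OF subsetD[OF XH v(1)] RH] by (simp add: XB_dag_def X_B_dagger_def)
  have XBH: "v \<in> H1_vec \<Omega>" if "v \<in> XB" for v using that XH by (auto simp: XB_def X_B_def)
  \<comment> \<open>The abstract iteration knows pressures only through fields; \<open>s\<close>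
    takes the place of \<open>q_sol\<close>.\<close>
  obtain s where s: "s \<in> XB" "AE x in lebesgue_on \<Omega>. q_sol x = divergence \<Omega> s x"
    using sol_in(2) by (auto simp: div_space_def)
  note sH = XBH[OF s(1)]
  interpret I: condensed_iteration ?X ?N ?R ?h ?b a M \<alpha> ?d L lam u_sol s u w
  proof unfold_locales
    show "0 < lam" by (rule lam_pos)
    show "u_sol \<in> G.Y" "s \<in> G.Y" "u n \<in> G.Y" "w n \<in> G.Y" for n
      using sol_in(1) s(1) iter_in XB by auto
    fix v n
    assume v: "v \<in> ?X" "\<And>z. z \<in> ?N \<Longrightarrow> a z v = 0" "\<And>r. r \<in> ?R \<Longrightarrow> ?b v r = 0"
    have vd: "v \<in> XB_dag" by (rule XB_dag[OF v])
    show "a u_sol v - ?b s v = L v"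
      using sol_momentum[OF vd] div_space_l2(2)[OF sH s(2) subsetD[OF XH v(1)]] by (simp add: inn_def)
    have "divergence \<Omega> v \<in> div_space \<Omega> XB_dag" using vd by (auto simp: div_space_def)
    then show "?b v u_sol = 0" using sol_mass[of "divergence \<Omega> v"] by (simp add: inn_def div_inner_def)
    show "a (u n) v + lam * ?b (u n) v = L v + ?b (w n) v"
      using iter_u[OF vd, of n] by (simp add: inn_def div_inner_def)
  next
    fix n
    let ?e = "w (Suc n) - (w n - lam *\<^sub>R u n)"
    have XBX: "v \<in> ?X" if "v \<in> XB" for v using that by (simp add: XB_def X_B_def)
    have e: "?e \<in> ?X"
      by (intro G.X_closed XBX iter_in)
    \<comment> \<open>The update is prescribed on the closure of the domain only, so the difference
      is a null field but need not be the zero field.\<close>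
    have "?e x = 0" if "x \<in> \<Omega>" for x
      using iter_w[of x n] that closure_subset[of \<Omega>] by auto
    then have "AE x in lebesgue_on \<Omega>. ?e x = 0" by (intro AE_I2) simp
    then have "?h ?e ?e = 0" using h1_inner_null_iff[OF subsetD[OF XH e]] by blast
    then show "?b ?e ?e = 0" by (rule G.h_null_b[OF e])
  qed
  have err: "h1_norm \<Omega> (\<lambda>x. u_sol x - u n x) = sqrt (?h (u_sol - u n) (u_sol - u n))" for n
    by (simp only: h1_norm_eq fun_diff_def)
  have mult: "nrm (\<lambda>x. q_sol x - divergence \<Omega> (w n) x) = sqrt (?b (s - w n) (s - w n))" for n
    unfolding nrm_def by (rule div_space_l2(4)[OF sH s(2) XBH[OF iter_in(2)]])
  have div: "nrm (divergence \<Omega> (u n)) = sqrt (?b (u n) (u n))" for n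
    by (simp add: nrm_def l2_norm_def div_inner_def)
  show ?thesis
  \<comment> \<open>If no field has a nonzero divergence, the infimum defining \<beta> is over the
    empty set and its value, even its sign, is unknown; the estimates then hold because the norms in
    them vanish.\<close>
  proof (cases "\<exists>s\<^sub>0\<in>?X. ?b s\<^sub>0 s\<^sub>0 \<noteq> 0")
    case True
    then obtain s\<^sub>0 where s0: "s\<^sub>0 \<in> ?X" "?b s\<^sub>0 s\<^sub>0 \<noteq> 0" by blast
    have \<beta>: "\<beta> = G.inf_sup" unfolding \<beta>_def inf_sup_const_eq G.inf_sup_def ..
    have pos: "0 < \<beta>" "\<beta> \<le> sqrt ?d" "\<alpha> \<le> M"
      using G.inf_sup_pos[OF s0] G.inf_sup_le[OF s0] G.\<alpha>_le_M[OF s0] \<beta> by auto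
    have cond: "\<beta> * sqrt (?b s s) \<le> c"
      if "s \<in> ?X" "0 \<le> c" "\<And>v. v \<in> ?X \<Longrightarrow> ?b v s \<le> c * sqrt (?h v v)" for s c
      unfolding \<beta> by (rule G.inf_sup_condition[OF s0 that])
    have d4: "?d \<le> 4" using dim by auto
    have 1: "sqrt (?h (u_sol - u n) (u_sol - u n)) \<le> (M + \<alpha>)\<^sup>2 / (\<alpha>\<^sup>2 * \<beta>) * sqrt (?b (u n) (u n))" for n
      by (rule I.error_bound[OF pos d4 cond])
    have 2: "inverse (M * (M + \<alpha>) ^ 3 / (\<alpha> ^ 3 * \<beta>\<^sup>2) + sqrt ?d * lam * (M + \<alpha>) / (\<alpha> * \<beta>)) *
        sqrt (?b (s - w n) (s - w n)) \<le> sqrt (?h (u_sol - u n) (u_sol - u n))" for n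
      by (rule I.scaled_multiplier_bound[OF pos d4 cond])
    have 3: "sqrt (?b (u n) (u n)) \<le> sqrt ?d * (M * (M + \<alpha>) ^ 4 / (\<alpha> ^ 4 * \<beta>\<^sup>2 * lam)) ^ n *
        sqrt (?h (u_sol - u 0) (u_sol - u 0))" for n
      by (rule I.div_bound[OF pos d4 cond])
    show ?thesis
      unfolding err mult div using 1 order_trans[OF 2 1] 3 by (simp only: max.bounded_iff) blast
  next
    case False
    then have null: "\<And>v. v \<in> ?X \<Longrightarrow> ?b v v = 0" by blast
    show ?thesis
      unfolding err mult div using I.degenerate[OF null] by simp
  qed
qed

end
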